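(* Suppose that $\mathbf{E}[\ln\rho_0]<0$; that there exists a unique $\kappa>0$ such that $\mathbf{E}[\rho_0^{\kappa}]=1$ and $\mathbf{E}[\rho_0^{\kappa}\ln^+\rho_0]<\infty$; and that there exists $\epsilon_0>0$ such that $\mathbf{E}[\rho_0^{-\epsilon_0}]<\infty$. Then for $\nu\in(0,1\wedge\kappa)$, $$\lim_{n\to\infty}\frac{\ln\mathbb{P}[X_n<n^{\nu}]}{\ln n}=\lim_{n\to\infty}\frac{\ln\mathbb{P}[T_{n^{\nu}}>n]}{\ln n}=-(\kappa-\nu).$$ The same result holds if $\mathbb{P}$ is replaced by $\tilde{\mathbb{P}}$, the annealed law of the walk reflected at the origin.
   Context: Let $\omega=(\omega_i,\ i\in\mathbb{Z})$ be a family of i.i.d. random variables with values in $(0,1)$ (the environment); $\mathbf{P}$ is its law and $\mathbf{E}$ the corresponding expectation. Put $\rho_i=(1-\omega_i)/\omega_i$. Given $\omega$, the quenched law $P_\omega$ is the law of the nearest-neighbour Markov chain $(X_n)_{n\ge0}$ on $\mathbb{Z}$ with $X_0=0$ and $P_\omega[X_{n+1}=x+1\mid X_n=x]=\omega_x$, $P_\omega[X_{n+1}=x-1\mid X_n=x]=1-\omega_x$. The annealed law is $\mathbb{P}=\mathbf{P}\times P_\omega$ (semi-direct product), i.e. $\mathbb{P}[\cdot]=\int P_\omega[\cdot]\,d\mathbf{P}(\omega)$ for walk events. The walk reflected at the origin is the walk on $\mathbb{Z}_+$ started at $0$ and defined in the same way in the environment $\tilde\omega$ with $\tilde\omega_i=\omega_i$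 for $i\neq0$ and $\tilde\omega_0=1$; its quenched law is $P_{\tilde\omega}$ and its annealed law is $\tilde{\mathbb{P}}$. For $a\in\mathbb{Z}$, $T_a=\min\{n\ge0:X_n=a\}$, and for non-integer $a$, $T_a:=T_{\lfloor a\rfloor}$. Also $x\wedge y=\min(x,y)$ and $\ln^+x=\max(\ln x,0)$. *)

theory Defs
  imports "HOL-Probability.Probability"
begin

definition step :: "(int \<Rightarrow> real) \<Rightarrow> int \<Rightarrow> int pmf" where
  "step w x = map_pmf (\<lambda>b. if b then x + 1 else x - 1) (bernoulli_pmf (w x))"

abbreviation path_space :: "(nat \<Rightarrow> int) measure" where
  "path_space \<equiv> (\<Pi>\<^sub>M i\<in>(UNIV::nat set). count_space (UNIV::int set))"

text \<open>
  \<open>walk_kernel w n h\<close> is the conditional law of the position at time \<open>n\<close> given the positions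
  \<open>h 0, \<dots>, h (n - 1)\<close>. The quenched law is the measure on path space which the Ionescu-Tulcea
  theorem attaches to these kernels; see \<open>emeasure_quenched_law\<close> for its finite-dimensional
  marginals.
\<close>

definition walk_kernel :: "(int \<Rightarrow> real) \<Rightarrow> nat \<Rightarrow> (nat \<Rightarrow> int) \<Rightarrow> int measure" where
  "walk_kernel w n h = measure_pmf (case n of 0 \<Rightarrow> return_pmf 0 | Suc m \<Rightarrow> step w (h m))"

definition quenched_law :: "(int \<Rightarrow> real) \<Rightarrow> (nat \<Rightarrow> int) measure" where
  "quenched_law w =
     projective_family.lim UNIV
       (Ionescu_Tulcea.CI (walk_kernel w) (\<lambda>_. count_space UNIV)) (\<lambda>_. count_space UNIV)"

lemma Ionescu_Tulcea_walk: "Ionescu_Tulcea (walk_kernel w) (\<lambda>_. count_space UNIV)"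
proof (rule Ionescu_Tulcea.intro)
  fix i :: nat
  show "walk_kernel w i \<in> (\<Pi>\<^sub>M i\<in>{0..<i}. count_space UNIV) \<rightarrow>\<^sub>M subprob_algebra (count_space UNIV)"
  proof (cases i)
    case 0
    then show ?thesis
      by (auto simp: walk_kernel_def[abs_def] space_subprob_algebra measure_pmf.subprob_space_axioms)
  next
    case (Suc m)
    have "(\<lambda>x. measure_pmf (step w x)) \<in> count_space UNIV \<rightarrow>\<^sub>M subprob_algebra (count_space UNIV)"
      by (auto simp: space_subprob_algebra measure_pmf.subprob_space_axioms)
    moreover have "(\<lambda>h. h m) \<in> (\<Pi>\<^sub>M i\<in>{0..<i}. count_space (UNIV::int set)) \<rightarrow>\<^sub>M count_space UNIV"
      using Suc by (intro measurable_component_singleton) auto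
    ultimately show ?thesis
      using Suc by (auto simp: walk_kernel_def[abs_def] intro: measurable_compose)
  qed
qed (unfold walk_kernel_def, rule prob_space_measure_pmf)

lemma sets_quenched_law [simp, measurable_cong]: "sets (quenched_law w) = sets path_space"
proof -
  interpret Ionescu_Tulcea "walk_kernel w" "\<lambda>_. count_space UNIV" by (rule Ionescu_Tulcea_walk)
  show ?thesis by (simp add: quenched_law_def)
qed

lemma space_quenched_law [simp]: "space (quenched_law w) = UNIV"
  using sets_eq_imp_space_eq[OF sets_quenched_law[of w]] by (simp add: space_PiM)

lemma emeasure_quenched_law:
  "emeasure (quenched_law w) {X. \<forall>i\<le>n. X i = x i} =
     (if x 0 = 0 then (\<Prod>i<n. ennreal (pmf (step w (x i)) (x (Suc i)))) else 0)"
proof -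
  interpret Ionescu_Tulcea "walk_kernel w" "\<lambda>_. count_space UNIV" by (rule Ionescu_Tulcea_walk)
  let ?P = "\<lambda>n. \<Pi>\<^sub>M i\<in>{0..<n}. count_space (UNIV::int set)"
  let ?r = "\<lambda>n. restrict x {0..<n}"
  have r_sets: "{?r n} \<in> sets (?P n)" for n
  proof -
    have "{?r n} = (\<Pi>\<^sub>E i\<in>{0..<n}. {x i})"
      by (auto simp: PiE_singleton[symmetric] restrict_PiE_iff simp flip: PiE_singleton[of "restrict x {0..<n}" "{0..<n}"]
        intro!: PiE_cong)
    also have "\<dots> \<in> sets (?P n)" by (intro sets_PiM_I_finite) auto
    finally show ?thesis .
  qed
  have C: "emeasure (C 0 n (\<lambda>_. undefined)) {?r n} = (\<Prod>i<n. emeasure (walk_kernel w i x) {x i})" for n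
  proof (induction n)
    case 0
    show ?case by (simp add: PiM_empty restrict_def)
  next
    case (Suc n)
    have "emeasure (C 0 (Suc n) (\<lambda>_. undefined)) {?r (Suc n)} =
        (\<integral>\<^sup>+h. emeasure (eP n h) {?r (Suc n)} \<partial>C 0 n (\<lambda>_. undefined))"
      using measurable_eP[of n] r_sets[of "Suc n"]
      by (simp, subst emeasure_bind[where N="?P (Suc n)"])
         (auto simp: space_C space_PiM measurable_cong_sets[OF sets_C])
    also have "\<dots> = (\<integral>\<^sup>+h. emeasure (walk_kernel w n x) {x n} * indicator {?r n} h \<partial>C 0 n (\<lambda>_. undefined))"
    proof (rule nn_integral_cong)
      fix h assume "h \<in> space (C 0 n (\<lambda>_. undefined))"
      then have h: "h \<in> space (?P n)" by (simp add: space_C space_PiM)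
      have u: "h n = undefined"
        using h by (auto simp: space_PiM PiE_def extensional_def)
      have r: "?r (Suc n) = (?r n)(n := x n)"
        by (auto simp: restrict_def)
      have *: "h(n := y) = ?r (Suc n) \<longleftrightarrow> y = x n \<and> h = ?r n" for y
      proof
        assume eq: "h(n := y) = ?r (Suc n)"
        have "h = (h(n := y))(n := undefined)" using u by auto
        also have "\<dots> = ?r n" unfolding eq by (auto simp: restrict_def)
        finally show "y = x n \<and> h = ?r n" using fun_cong[OF eq, of n] by simp
      qed (simp only: r)
      have k: "walk_kernel w n h = walk_kernel w n x" if "h = ?r n"
        using that by (auto simp: walk_kernel_def split: nat.split)
      show "emeasure (eP n h) {?r (Suc n)} = emeasure (walk_kernel w n x) {x n} * indicator {?r n} h"
        using k by (subst emeasure_eP[OF h r_sets]) (auto simp: * vimage_def split: split_indicator)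
    qed
    also have "\<dots> = emeasure (walk_kernel w n x) {x n} * emeasure (C 0 n (\<lambda>_. undefined)) {?r n}"
      using r_sets[of n] by (subst nn_integral_cmult_indicator) (auto simp: sets_C space_PiM)
    finally show ?case using Suc by (simp add: mult.commute del: C.simps restrict_apply)
  qed
  have "restrict X {0..<Suc n} = ?r (Suc n) \<longleftrightarrow> (\<forall>i\<le>n. X i = x i)" for X
    by (simp add: fun_eq_iff restrict_def less_Suc_eq_le)
  then have "{X. \<forall>i\<le>n. X i = x i} = PF.emb UNIV {0..<Suc n} {?r (Suc n)}"
    by (simp add: prod_emb_def space_PiM vimage_def del: restrict_apply)
  then have "emeasure (quenched_law w) {X. \<forall>i\<le>n. X i = x i} = emeasure (CI {0..<Suc n}) {?r (Suc n)}"
    unfolding quenched_law_def using r_sets[of "Suc n"] by (simp only: lim finite_atLeastLessThan)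
  also have "\<dots> = emeasure (C 0 (Suc n) (\<lambda>_. undefined)) {?r (Suc n)}"
    using r_sets[of "Suc n"] by (subst emeasure_CI[OF subset_refl])
      (auto intro!: arg_cong2[where f=emeasure] simp: prod_emb_def space_PiM)
  also have "\<dots> = emeasure (walk_kernel w 0 x) {x 0} * (\<Prod>i<n. emeasure (walk_kernel w (Suc i) x) {x (Suc i)})"
    unfolding C by (rule prod.lessThan_Suc_shift)
  finally show ?thesis
    by (simp add: walk_kernel_def emeasure_pmf_single)
qed

lemma prob_space_quenched_law: "prob_space (quenched_law w)"
proof -
  interpret Ionescu_Tulcea "walk_kernel w" "\<lambda>_. count_space UNIV" by (rule Ionescu_Tulcea_walk)
  have "prob_space (CI {})" by (rule PF.prob_space_P) auto
  then have "emeasure (CI {}) (space (CI {})) = 1" by (rule prob_space.emeasure_space_1)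
  moreover have "emeasure PF.lim (PF.emb UNIV {} (space (\<Pi>\<^sub>M i\<in>{}. count_space (UNIV::int set)))) =
      emeasure (CI {}) (space (\<Pi>\<^sub>M i\<in>{}. count_space (UNIV::int set)))"
    by (rule lim) auto
  moreover have "PF.emb UNIV {} (space (\<Pi>\<^sub>M i\<in>{}. count_space (UNIV::int set))) = UNIV"
    by (auto simp: prod_emb_def space_PiM)
  moreover have "space (CI {}) = space (\<Pi>\<^sub>M i\<in>{}. count_space (UNIV::int set))"
    by (simp add: CI_def)
  ultimately show ?thesis
    by (intro prob_spaceI) (metis quenched_law_def space_quenched_law)
qed

lemma measurable_quenched_law:
  "quenched_law \<in> (\<Pi>\<^sub>M i\<in>UNIV. borel) \<rightarrow>\<^sub>M prob_algebra path_space"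
proof -
  define cyl :: "int list \<Rightarrow> (nat \<Rightarrow> int) set" where
    "cyl xs = {X. \<forall>i<length xs. X i = xs ! i}" for xs
  let ?G = "insert {} (range cyl)"
  have cyl_sets: "cyl xs \<in> sets path_space" for xs
  proof -
    have "cyl xs = (\<Inter>i\<in>{..<length xs}. {X \<in> space path_space. X i = xs ! i}) \<inter> space path_space"
      by (auto simp: cyl_def space_PiM)
    also have "\<dots> \<in> sets path_space" by measurable
    finally show ?thesis .
  qed
  have comp: "{X::nat \<Rightarrow> int. X i = a} \<in> sigma_sets UNIV ?G" for i a
  proof -
    have "{X::nat \<Rightarrow> int. X i = a} = (\<Union>xs\<in>{xs. length xs = Suc i \<and> xs ! i = a}. cyl xs)"
    proof (intro set_eqI iffI)
      fix X :: "nat \<Rightarrow> int" assume "X \<in> {X. X i = a}"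
      then show "X \<in> (\<Union>xs\<in>{xs. length xs = Suc i \<and> xs ! i = a}. cyl xs)"
        by (intro UN_I[of "map X [0..<Suc i]"]) (auto simp: cyl_def simp del: upt_Suc)
    qed (auto simp: cyl_def)
    also have "\<dots> \<in> sigma_sets UNIV ?G"
      by (intro sigma_sets_UNION) (auto intro: sigma_sets.Basic)
    finally show ?thesis .
  qed
  have gen: "sets path_space = sigma_sets UNIV ?G"
  proof
    have "sets path_space =
        sigma_sets UNIV {{X. X i \<in> A} | i A. A \<in> sets (count_space (UNIV::int set))}"
      by (subst sets_PiM_single) simp
    also have "\<dots> \<subseteq> sigma_sets UNIV ?G"
    proof (rule sigma_sets_mono, safe)
      fix i and A :: "int set"
      have "{X::nat \<Rightarrow> int. X i \<in> A} = (\<Union>a\<in>A. {X. X i = a})" by auto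
      also have "\<dots> \<in> sigma_sets UNIV ?G"
        using comp by (intro sigma_sets_UNION) auto
      finally show "{X::nat \<Rightarrow> int. X i \<in> A} \<in> sigma_sets UNIV ?G" .
    qed
    finally show "sets path_space \<subseteq> sigma_sets UNIV ?G" .
    have "?G \<subseteq> sets path_space" using cyl_sets by auto
    from sets.sigma_sets_subset[OF this] show "sigma_sets UNIV ?G \<subseteq> sets path_space"
      by (simp add: space_PiM)
  qed
  have Int: "Int_stable ?G"
  proof -
    have "cyl xs \<inter> cyl ys \<in> ?G" if "length xs \<le> length ys" for xs ys
    proof (cases "\<forall>i<length xs. xs ! i = ys ! i")
      case True
      then have "cyl xs \<inter> cyl ys = cyl ys" using that by (auto simp: cyl_def)
      then show ?thesis by simp
    next
      case False
      then obtain i where "i < length xs" "xs ! i \<noteq> ys ! i" by auto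
      then have "cyl xs \<inter> cyl ys = {}" using that by (fastforce simp: cyl_def)
      then show ?thesis by simp
    qed
    then have "cyl xs \<inter> cyl ys \<in> ?G" for xs ys
      by (metis Int_commute linear)
    then show ?thesis by (auto simp: Int_stable_def)
  qed
  have step: "(\<lambda>w. pmf (step w x) y) \<in> borel_measurable (\<Pi>\<^sub>M i\<in>UNIV. borel)" for x y
  proof -
    have "pmf (step w x) y = (if y = x + 1 then min 1 (max 0 (w x))
        else if y = x - 1 then 1 - min 1 (max 0 (w x)) else 0)" for w
    proof -
      have "(\<lambda>b. if b then x + 1 else x - 1) -` {y} =
          (if y = x + 1 then {True} else if y = x - 1 then {False} else {})"
        by (auto split: if_splits)
      then show ?thesis
        by (simp add: step_def pmf_map measure_pmf_single bernoulli_pmf.rep_eq)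
    qed
    then show ?thesis by (auto intro!: measurable_If)
  qed
  show ?thesis
  proof (rule measurable_prob_algebra_generated[OF gen Int])
    fix A assume "A \<in> ?G"
    then consider "A = {}" | xs where "A = cyl xs" by auto
    then show "(\<lambda>w. emeasure (quenched_law w) A) \<in> borel_measurable (\<Pi>\<^sub>M i\<in>UNIV. borel)"
    proof cases
      case 2
      show ?thesis
      proof (cases "length xs")
        case 0
        have "emeasure (quenched_law w) A = 1" for w
          using 2 0 prob_space.emeasure_space_1[OF prob_space_quenched_law[of w]]
          by (simp add: cyl_def)
        then show ?thesis by simp
      next
        case (Suc n)
        then have "A = {X. \<forall>i\<le>n. X i = xs ! i}" using 2 by (auto simp: cyl_def less_Suc_eq_le)
        then show ?thesis using step by (simp add: emeasure_quenched_law)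
      qed
    qed simp
  qed (auto simp: prob_space_quenched_law)
qed


definition iid_environment :: "'s measure \<Rightarrow> (int \<Rightarrow> 's \<Rightarrow> real) \<Rightarrow> bool" where
  "iid_environment M \<omega> \<longleftrightarrow>
     prob_space M \<and>
     prob_space.indep_vars M (\<lambda>_. borel) \<omega> UNIV \<and>
     (\<forall>i. distr M borel (\<omega> i) = distr M borel (\<omega> 0)) \<and>
     (\<forall>i. \<forall>s\<in>space M. 0 < \<omega> i s \<and> \<omega> i s < 1)"

text \<open>
  The annealed laws are the path marginals of the semi-direct product; see
  \<open>emeasure_annealed_law\<close> for the formula as an integral of quenched probabilities.
\<close>

definition annealed_law :: "'s measure \<Rightarrow> (int \<Rightarrow> 's \<Rightarrow> real) \<Rightarrow> (nat \<Rightarrow> int) measure" where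
  "annealed_law M \<omega> = M \<bind> (\<lambda>s. quenched_law (\<lambda>i. \<omega> i s))"

definition reflected_annealed_law :: "'s measure \<Rightarrow> (int \<Rightarrow> 's \<Rightarrow> real) \<Rightarrow> (nat \<Rightarrow> int) measure" where
  "reflected_annealed_law M \<omega> = M \<bind> (\<lambda>s. quenched_law ((\<lambda>i. \<omega> i s)(0 := 1)))"

lemma measurable_quenched_law_environment:
  assumes "\<And>i. \<omega> i \<in> borel_measurable M"
  shows "(\<lambda>s. quenched_law (\<lambda>i. \<omega> i s)) \<in> M \<rightarrow>\<^sub>M prob_algebra path_space"
  using assms by (intro measurable_compose[OF _ measurable_quenched_law] measurable_PiM_single') auto

lemma iid_environment_measurable:
  "iid_environment M \<omega> \<Longrightarrow> \<omega> i \<in> borel_measurable M"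
  by (auto simp: iid_environment_def prob_space.indep_vars_def)

lemma emeasure_annealed_law:
  assumes "iid_environment M \<omega>" "A \<in> sets path_space"
  shows "emeasure (annealed_law M \<omega>) A = (\<integral>\<^sup>+s. emeasure (quenched_law (\<lambda>i. \<omega> i s)) A \<partial>M)"
  unfolding annealed_law_def using assms
  by (intro emeasure_bind[where N=path_space] measurable_prob_algebraD
      measurable_quenched_law_environment iid_environment_measurable)
     (auto simp: iid_environment_def prob_space.not_empty)

lemma emeasure_reflected_annealed_law:
  assumes "iid_environment M \<omega>" "A \<in> sets path_space"
  shows "emeasure (reflected_annealed_law M \<omega>) A =
    (\<integral>\<^sup>+s. emeasure (quenched_law ((\<lambda>i. \<omega> i s)(0 := 1))) A \<partial>M)"
proof -
  have eq: "(\<lambda>i. \<omega> i s)(0 := 1) = (\<lambda>i. if i = 0 then 1 else \<omega> i s)" for s by auto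
  have "(\<lambda>s. if i = 0 then 1 else \<omega> i s) \<in> borel_measurable M" for i
    using iid_environment_measurable[OF assms(1)] by simp
  then show ?thesis
    unfolding reflected_annealed_law_def eq using assms
    by (intro emeasure_bind[where N=path_space] measurable_prob_algebraD
        measurable_quenched_law_environment)
       (auto simp: iid_environment_def prob_space.not_empty)
qed

definition odds_ratio :: "real \<Rightarrow> real" where
  "odds_ratio p = (1 - p) / p"

definition critical_exponent :: "'s measure \<Rightarrow> ('s \<Rightarrow> real) \<Rightarrow> real \<Rightarrow> bool" where
  "critical_exponent M \<rho> \<kappa> \<longleftrightarrow>
     \<kappa> > 0 \<and>
     integrable M (\<lambda>s. \<rho> s powr \<kappa>) \<and> (\<integral>s. \<rho> s powr \<kappa> \<partial>M) = 1 \<and>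
     integrable M (\<lambda>s. \<rho> s powr \<kappa> * max (ln (\<rho> s)) 0)"

text \<open>The hitting time is \<open>\<infinity>\<close>, the infimum of the empty set, on paths that never visit \<open>a\<close>.\<close>

definition hitting_time :: "int \<Rightarrow> (nat \<Rightarrow> int) \<Rightarrow> enat" where
  "hitting_time a X = (INF n\<in>{n. X n = a}. enat n)"

end

theory Submission
  imports Defs "HOL-Real_Asymp.Real_Asymp"
begin

text \<open>
  Write \<open>\<rho>\<close> for the odds ratios, \<open>f s = \<^bold>E[\<rho>\<^sub>0 powr s]\<close> and \<open>m = n powr \<nu>\<close>. By weighted AM-GM, \<open>f < 1\<close> on
  \<open>(0, \<kappa>)\<close>. The walk is slow essentially if and only if the window of size \<open>m\<close> contains a single trap
  of depth \<open>ln n\<close>.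

  Lower bound: the product of \<open>\<rho>\<close> over a block of \<open>O(ln n)\<close> sites exceeds \<open>2 n\<close> with probability at least
  \<open>n powr (- \<kappa> - o(1))\<close>, by Chernoff bounds under exponential tilting with a parameter \<open>s < \<kappa>\<close> near \<open>\<kappa>\<close>.
  The window contains \<open>m / O(ln n)\<close> independent blocks, and such a block holds the walk for time \<open>n\<close> with
  quenched probability at least \<open>1/2\<close>, since each visit to its left end crosses it with probability at
  most \<open>1 / (2 n)\<close>.

  Upper bound: up to the exponentially small probability of reaching \<open>- m\<close> or of returning from \<open>2 m\<close>
  to \<open>m\<close>, the quenched probability of \<open>X n < m\<close> decays exponentially in \<open>n / A\<close>, where \<open>A\<close> is the mean
  crossing time of \<open>[- m, 2 m]\<close> for the walk reflected at \<open>- m\<close>. Here \<open>A\<close> is the sum of the mean times \<open>U\<^sub>k\<close> needed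
  to step to the next site, and \<open>U\<^sub>k\<^sub>+\<^sub>1 = 1 + \<rho> (1 + U\<^sub>k)\<close>. Since \<open>\<^bold>E[U\<^sub>k powr s]\<close> is bounded for \<open>s < \<kappa>\<close>, some \<open>U\<^sub>k\<close>
  exceeds \<open>n powr (1 - \<epsilon>)\<close> with probability at most \<open>m n powr (- \<kappa> + o(1))\<close>; if none does, an exponential
  supermartingale shows that \<open>A\<close> stays below \<open>n powr (1 - \<epsilon>/2)\<close> outside an event of stretched exponentially small
  probability. These bounds are monotone in \<open>\<rho>\<close>, and reflection at the origin sets \<open>\<rho>\<^sub>0 = 0\<close>.
\<close>

section \<open>The quenched walk\<close>

definition walk_gen :: "(int \<Rightarrow> real) \<Rightarrow> (int \<Rightarrow> real) \<Rightarrow> int \<Rightarrow> real" where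
  "walk_gen w g x = w x * g (x + 1) + (1 - w x) * g (x - 1)"

lemma nn_integral_step:
  assumes "0 \<le> w x" "w x \<le> 1" "\<And>y. 0 \<le> g y"
  shows "(\<integral>\<^sup>+y. ennreal (g y) \<partial>measure_pmf (step w x)) = ennreal (walk_gen w g x)"
  using assms
  by (simp add: step_def walk_gen_def ennreal_plus ennreal_mult'' mult.commute)

lemma emeasure_quenched_law_Suc:
  "emeasure (quenched_law w) {X. (\<forall>i\<le>k. X i = x i) \<and> X (Suc k) = y} =
    emeasure (quenched_law w) {X. \<forall>i\<le>k. X i = x i} * ennreal (pmf (step w (x k)) y)"
proof -
  have "{X. (\<forall>i\<le>k. X i = x i) \<and> X (Suc k) = y} = {X. \<forall>i\<le>Suc k. X i = (x(Suc k := y)) i}"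
    by (auto simp: le_Suc_eq)
  then show ?thesis
    by (simp add: emeasure_quenched_law mult.commute)
qed

lemma measurable_path_coord [measurable]: "(\<lambda>X. X i) \<in> path_space \<rightarrow>\<^sub>M count_space UNIV"
  by (rule measurable_component_singleton) simp

text \<open>The finite-dimensional formula says that, restricted to a cylinder fixing the times up
  to \<open>k\<close>, the law of \<open>X (Suc k)\<close> is the mass of the cylinder times
  \<open>step w (x k)\<close>; it remains to integrate \<open>g\<close>.\<close>

lemma quenched_Markov_cylinder:
  assumes w: "\<And>x. 0 \<le> w x" "\<And>x. w x \<le> 1" and g: "\<And>y. 0 \<le> g y"
  shows "(\<integral>\<^sup>+X\<in>{X. \<forall>i\<le>k. X i = x i}. ennreal (g (X (Suc k))) \<partial>quenched_law w) =
    (\<integral>\<^sup>+X\<in>{X. \<forall>i\<le>k. X i = x i}. ennreal (walk_gen w g (X k)) \<partial>quenched_law w)"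
proof -
  let ?B = "{X. \<forall>i\<le>k. X i = x i}" and ?Q = "quenched_law w"
  have B: "?B \<in> sets path_space"
  proof -
    have "?B = {X \<in> space path_space. \<forall>i\<in>{..k}. X i = x i}" by (auto simp: space_PiM)
    also have "\<dots> \<in> sets path_space" by measurable
    finally show ?thesis .
  qed
  define N where "N = distr (density ?Q (indicator ?B)) (count_space UNIV) (\<lambda>X. X (Suc k))"
  have N: "N = scale_measure (emeasure ?Q ?B) (measure_pmf (step w (x k)))"
  proof (rule measure_eqI_countable[of _ UNIV])
    fix y :: int
    have "emeasure N {y} = emeasure ?Q ({X. X (Suc k) = y} \<inter> ?B)"
    proof -
      have "{X. X (Suc k) = y} = {X \<in> space path_space. X (Suc k) = y}" by (simp add: space_PiM)
      also have "\<dots> \<in> sets path_space" by measurable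
      finally have "{X. X (Suc k) = y} \<in> sets path_space" .
      then show ?thesis unfolding N_def using B
        by (subst emeasure_distr) (auto simp: emeasure_density indicator_inter_arith[symmetric]
          vimage_def Int_commute)
    qed
    also have "{X. X (Suc k) = y} \<inter> ?B = {X. (\<forall>i\<le>k. X i = x i) \<and> X (Suc k) = y}" by auto
    finally show "emeasure N {y} = emeasure (scale_measure (emeasure ?Q ?B) (measure_pmf (step w (x k)))) {y}"
      by (simp add: emeasure_quenched_law_Suc emeasure_pmf_single)
  qed (auto simp: N_def)
  have "(\<integral>\<^sup>+X\<in>?B. ennreal (g (X (Suc k))) \<partial>?Q) = (\<integral>\<^sup>+y. ennreal (g y) \<partial>N)"
    unfolding N_def using B
    by (subst nn_integral_distr) (auto simp: nn_integral_density mult.commute)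
  also have "\<dots> = emeasure ?Q ?B * ennreal (walk_gen w g (x k))"
    unfolding N using nn_integral_step[of w "x k" g] w g by (simp add: nn_integral_scale_measure)
  also have "\<dots> = (\<integral>\<^sup>+X\<in>?B. ennreal (walk_gen w g (x k)) \<partial>?Q)"
    using B by (simp add: nn_integral_cmult_indicator mult.commute)
  also have "\<dots> = (\<integral>\<^sup>+X\<in>?B. ennreal (walk_gen w g (X k)) \<partial>?Q)"
    by (intro nn_integral_cong) (auto split: split_indicator)
  finally show ?thesis .
qed

text \<open>An event determined by the times up to \<open>k\<close> is a countable disjoint union of
  cylinders, as there are only countably many integer histories of length \<open>Suc k\<close>. The
  closure assumption on \<open>A\<close> expresses dependence on the past without a
  filtration.\<close>

lemma quenched_Markov:
  assumes w: "\<And>x. 0 \<le> w x" "\<And>x. w x \<le> 1" and g: "\<And>y. 0 \<le> g y"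
    and A: "\<And>X Y. X \<in> A \<Longrightarrow> (\<And>i. i \<le> k \<Longrightarrow> X i = Y i) \<Longrightarrow> Y \<in> A" and A_sets: "A \<in> sets path_space"
  shows "(\<integral>\<^sup>+X\<in>A. ennreal (g (X (Suc k))) \<partial>quenched_law w) =
    (\<integral>\<^sup>+X\<in>A. ennreal (walk_gen w g (X k)) \<partial>quenched_law w)"
proof -
  let ?Q = "quenched_law w"
  \<comment> \<open>Paths are sorted by the code of their history up to time \<open>k\<close>; each
    class is empty or a single cylinder.\<close>
  define B where "B n = A \<inter> {X. to_nat (map X [0..<Suc k]) = n}" for n
  have B_cases: "B n = {} \<or> (\<exists>x. B n = {X. \<forall>i\<le>k. X i = x i})" for n
  proof (cases "B n = {}")
    case False
    then obtain x where x: "x \<in> B n" by auto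
    have "X \<in> B n \<longleftrightarrow> (\<forall>i\<le>k. X i = x i)" for X
    proof
      assume "X \<in> B n"
      then have "map X [0..<Suc k] = map x [0..<Suc k]" using x by (auto simp: B_def)
      then show "\<forall>i\<le>k. X i = x i" by (auto simp: map_eq_conv)
    next
      assume *: "\<forall>i\<le>k. X i = x i"
      then have "map X [0..<Suc k] = map x [0..<Suc k]" by (auto simp: map_eq_conv)
      moreover have "X \<in> A" using A[of x X] x * by (auto simp: B_def)
      ultimately show "X \<in> B n" using x by (auto simp: B_def)
    qed
    then show ?thesis by blast
  qed simp
  have B_sets: "B n \<in> sets ?Q" for n
  proof -
    have "{X. \<forall>i\<le>k. X i = x i} \<in> sets path_space" for x :: "nat \<Rightarrow> int"
    proof -
      have "{X. \<forall>i\<le>k. X i = x i} = {X \<in> space path_space. \<forall>i\<in>{..k}. X i = x i}" by (auto simp: space_PiM)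
      also have "\<dots> \<in> sets path_space" by measurable
      finally show ?thesis .
    qed
    then show ?thesis using B_cases[of n] by auto
  qed
  have disj: "disjoint_family B" by (auto simp: disjoint_family_on_def B_def)
  have un: "(\<Union>n. B n) = A" by (auto simp: B_def)
  have meas: "(\<lambda>X. ennreal (h (X j))) \<in> borel_measurable ?Q" for h :: "int \<Rightarrow> real" and j
    by measurable
  have sum: "(\<integral>\<^sup>+X\<in>A. ennreal (h (X j)) \<partial>?Q) = (\<Sum>n. \<integral>\<^sup>+X\<in>B n. ennreal (h (X j)) \<partial>?Q)"
    for h :: "int \<Rightarrow> real" and j
    unfolding un[symmetric] by (rule nn_integral_disjoint_family[OF meas B_sets disj])
  have "(\<integral>\<^sup>+X\<in>B n. ennreal (g (X (Suc k))) \<partial>?Q) = (\<integral>\<^sup>+X\<in>B n. ennreal (walk_gen w g (X k)) \<partial>?Q)" for n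
    using B_cases[of n] quenched_Markov_cylinder[OF w g] by auto
  then show ?thesis by (simp add: sum)
qed

lemma AE_quenched_start: "AE X in quenched_law w. X 0 = 0"
proof -
  interpret prob_space "quenched_law w" by (rule prob_space_quenched_law)
  have "{X. X 0 = (0::int)} = {X::nat \<Rightarrow> int. \<forall>i\<le>0. X i = 0}" by auto
  then have "emeasure (quenched_law w) {X. X 0 = 0} = 1"
    using emeasure_quenched_law[of w 0 "\<lambda>_. 0"] by simp
  then have "prob {X. X 0 = 0} = 1" by (simp add: measure_def)
  moreover have "{X. X 0 = (0::int)} \<in> events"
  proof -
    have "{X. X 0 = (0::int)} = {X \<in> space path_space. X 0 = 0}" by (simp add: space_PiM)
    also have "\<dots> \<in> sets path_space" by measurable
    finally show ?thesis by simp
  qed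
  ultimately have "AE X in quenched_law w. X \<in> {X. X 0 = (0::int)}" by (simp only: prob_eq_1)
  then show ?thesis by simp
qed

text \<open>In terms of the odds \<open>e\<close> of a left step, \<open>e x = 0\<close> is allowed
  and describes a site that always steps right, hence reflection.\<close>

lemma walk_gen_odds:
  assumes "0 \<le> e x"
  shows "walk_gen (\<lambda>i. 1 / (1 + e i)) g x = (g (x + 1) + e x * g (x - 1)) / (1 + e x)"
proof -
  have "1 + e x \<noteq> 0" using assms by linarith
  then have "1 - 1 / (1 + e x) = e x / (1 + e x)" by (simp add: field_simps)
  then show ?thesis by (simp add: walk_gen_def add_divide_distrib)
qed

lemma walk_gen_nonneg:
  assumes "\<And>x. 0 \<le> w x" "\<And>x. w x \<le> 1" "\<And>y. 0 \<le> g y"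
  shows "0 \<le> walk_gen w g x"
  using assms by (auto simp: walk_gen_def)

lemma walk_gen_mono:
  assumes "0 \<le> w x" "w x \<le> 1" "g (x + 1) \<le> h (x + 1)" "g (x - 1) \<le> h (x - 1)"
  shows "walk_gen w g x \<le> walk_gen w h x"
  using assms by (auto simp: walk_gen_def intro!: add_mono mult_left_mono)

text \<open>Peeling off the last step replaces \<open>g\<close> by \<open>walk_gen w g\<close>.
  Estimates for the position thereby reduce to backward inequalities for iterates of the transition
  operator.\<close>

lemma nn_integral_quenched_position:
  assumes w: "\<And>x. 0 \<le> w x" "\<And>x. w x \<le> 1" and g: "\<And>y. 0 \<le> g y"
  shows "(\<integral>\<^sup>+X. ennreal (g (X n)) \<partial>quenched_law w) = ennreal ((walk_gen w ^^ n) g 0)"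
  using g
proof (induction n arbitrary: g)
  case 0
  interpret prob_space "quenched_law w" by (rule prob_space_quenched_law)
  have "(\<integral>\<^sup>+X. ennreal (g (X 0)) \<partial>quenched_law w) = (\<integral>\<^sup>+X. ennreal (g 0) \<partial>quenched_law w)"
    using AE_quenched_start[of w] by (intro nn_integral_cong_AE) auto
  then show ?case using emeasure_space_1 by simp
next
  case (Suc n)
  have "(\<integral>\<^sup>+X. ennreal (g (X (Suc n))) \<partial>quenched_law w) =
      (\<integral>\<^sup>+X. ennreal (walk_gen w g (X n)) \<partial>quenched_law w)"
    using quenched_Markov[OF w Suc.prems, of UNIV n] sets.top[of path_space]
    by (simp add: space_PiM)
  also have "\<dots> = ennreal ((walk_gen w ^^ n) (walk_gen w g) 0)"
    by (intro Suc.IH walk_gen_nonneg w Suc.prems)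
  finally show ?case by (simp add: funpow_Suc_right del: funpow.simps)
qed

lemma measurable_position_event [measurable]: "{X::nat \<Rightarrow> int. P (X n)} \<in> sets path_space"
proof -
  have "{X. P (X n)} = {X \<in> space path_space. P (X n)}" by (simp add: space_PiM)
  also have "\<dots> \<in> sets path_space" by measurable
  finally show ?thesis .
qed

lemma measurable_past_event [measurable]: "{X::nat \<Rightarrow> int. \<forall>k\<le>n. P (X k)} \<in> sets path_space"
proof -
  have "{X. \<forall>k\<le>n. P (X k)} = {X \<in> space path_space. \<forall>k\<in>{..n}. P (X k)}" by (auto simp: space_PiM)
  also have "\<dots> \<in> sets path_space" by measurable
  finally show ?thesis .
qed

lemma quenched_position_prob:
  assumes "\<And>x. 0 \<le> w x" "\<And>x. w x \<le> 1"
  shows "measure (quenched_law w) {X. X n < m} = (walk_gen w ^^ n) (\<lambda>x. of_bool (x < m)) 0"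
proof -
  have nonneg: "0 \<le> (walk_gen w ^^ k) (\<lambda>x. of_bool (x < m)) y" for k y
    by (induction k arbitrary: y) (auto intro!: walk_gen_nonneg assms)
  have "emeasure (quenched_law w) {X. X n < m} = (\<integral>\<^sup>+X. indicator {X. X n < m} X \<partial>quenched_law w)"
    by (rule nn_integral_indicator[symmetric]) simp
  also have "\<dots> = (\<integral>\<^sup>+X. ennreal (of_bool (X n < m)) \<partial>quenched_law w)"
    by (intro nn_integral_cong) (auto split: split_indicator)
  also have "\<dots> = ennreal ((walk_gen w ^^ n) (\<lambda>x. of_bool (x < m)) 0)"
    using assms by (intro nn_integral_quenched_position) auto
  finally show ?thesis using nonneg by (simp add: measure_def)
qed

section \<open>Scale function, backtracking and confinement estimates\<close>

definition odds_prod :: "(int \<Rightarrow> real) \<Rightarrow> int \<Rightarrow> int \<Rightarrow> real" where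
  "odds_prod e a j = (\<Prod>i\<in>{a<..j}. e i)"

text \<open>The scale function of the walk up to normalisation, anchored at \<open>a\<close>: for
  nonnegative odds it is nonnegative and non-increasing in \<open>x\<close>, and it vanishes beyond
  \<open>N\<close>.\<close>

definition scale_sum :: "(int \<Rightarrow> real) \<Rightarrow> int \<Rightarrow> int \<Rightarrow> int \<Rightarrow> real" where
  "scale_sum e a N x = (\<Sum>j\<in>{x..N}. odds_prod e a j)"

lemma odds_prod_nonneg: "(\<And>i. 0 \<le> e i) \<Longrightarrow> 0 \<le> odds_prod e a j"
  by (simp add: odds_prod_def prod_nonneg)

lemma odds_prod_self [simp]: "odds_prod e a a = 1"
  by (simp add: odds_prod_def)

lemma odds_prod_step: "a < x \<Longrightarrow> odds_prod e a x = e x * odds_prod e a (x - 1)"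
proof -
  assume "a < x"
  then have "{a<..x} = insert x {a<..x - 1}" by auto
  then show ?thesis by (simp add: odds_prod_def)
qed

lemma scale_sum_step: "x \<le> N \<Longrightarrow> scale_sum e a N x = odds_prod e a x + scale_sum e a N (x + 1)"
proof -
  assume "x \<le> N"
  then have "{x..N} = insert x {x + 1..N}" by auto
  then show ?thesis by (simp add: scale_sum_def)
qed

lemma scale_sum_nonneg: "(\<And>i. 0 \<le> e i) \<Longrightarrow> 0 \<le> scale_sum e a N x"
  by (simp add: scale_sum_def odds_prod_nonneg sum_nonneg)

lemma scale_sum_ge_1:
  assumes "\<And>i. 0 \<le> e i" "x \<le> a" "a \<le> N" shows "1 \<le> scale_sum e a N x"
  using member_le_sum[of a "{x..N}" "odds_prod e a"] assms
  by (simp add: scale_sum_def odds_prod_nonneg)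

text \<open>\<open>e x\<close> is exactly the ratio of the decrement of the sum after
  \<open>x\<close> to the decrement before it, which balances the odds of stepping left.\<close>

lemma scale_sum_harmonic:
  assumes "\<And>i. 0 \<le> e i" "a < x" "x \<le> N"
  shows "walk_gen (\<lambda>i. 1 / (1 + e i)) (scale_sum e a N) x = scale_sum e a N x"
proof -
  let ?S = "scale_sum e a N" and ?R = "odds_prod e a (x - 1)"
  have 1: "?S x = e x * ?R + ?S (x + 1)"
    using assms scale_sum_step[of x N e a] odds_prod_step[of a x e] by simp
  have 2: "?S (x - 1) = ?R + ?S x" using assms scale_sum_step[of "x - 1" N e a] by simp
  have "1 + e x > 0" using assms(1)[of x] by linarith
  then have "1 + e x \<noteq> 0" by simp
  then show ?thesis unfolding walk_gen_odds[OF assms(1)] nonzero_divide_eq_eq[OF \<open>1 + e x \<noteq> 0\<close>] 2 1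
    by (simp add: algebra_simps)
qed

context
  fixes e w :: "int \<Rightarrow> real"
  assumes e: "\<And>i. 0 \<le> e i" and w: "w = (\<lambda>i. 1 / (1 + e i))"
begin

lemma step_prob_bounds: "0 \<le> w i" "w i \<le> 1"
proof -
  have "1 + e i \<ge> 1" using e[of i] by linarith
  then show "0 \<le> w i" "w i \<le> 1" unfolding w by (simp_all add: field_simps)
qed

lemma walk_gen_funpow_le_1:
  "(walk_gen w ^^ k) (\<lambda>x. of_bool (x < m)) x \<le> 1"
proof (induction k arbitrary: x)
  case (Suc k)
  have "walk_gen w ((walk_gen w ^^ k) (\<lambda>x. of_bool (x < m))) x \<le> walk_gen w (\<lambda>_. 1) x"
    using step_prob_bounds Suc by (intro walk_gen_mono) auto
  also have "\<dots> = 1" by (simp add: walk_gen_def)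
  finally show ?case by simp
qed simp

text \<open>Comparison principle on a finite horizon: \<open>scale_sum e m N\<close> is at least 1
  on and below \<open>m\<close>, nonnegative everywhere and harmonic above \<open>m\<close> up to
  \<open>N\<close>. The condition \<open>x + int k \<le> N\<close> keeps the remaining steps inside
  this range.\<close>

lemma walk_gen_funpow_backtrack:
  assumes "m \<le> N" "x + int k \<le> N"
  shows "(walk_gen w ^^ k) (\<lambda>x. of_bool (x < m)) x \<le> scale_sum e m N x"
  using assms(2)
proof (induction k arbitrary: x)
  case 0
  then show ?case
    using scale_sum_ge_1[of e x m N, OF e] scale_sum_nonneg[of e m N x, OF e] assms by auto
next
  case (Suc k)
  show ?case
  proof (cases "x \<le> m")
    case True
    then show ?thesis
      using scale_sum_ge_1[of e x m N, OF e] walk_gen_funpow_le_1[of "Suc k" m x] assms by linarith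
  next
    case False
    have "walk_gen w ((walk_gen w ^^ k) (\<lambda>x. of_bool (x < m))) x \<le> walk_gen w (scale_sum e m N) x"
      using step_prob_bounds Suc by (intro walk_gen_mono Suc.IH) auto
    also have "\<dots> = scale_sum e m N x"
      unfolding w using False Suc.prems e by (intro scale_sum_harmonic) auto
    finally show ?thesis by simp
  qed
qed

end

text \<open>Expected time to pass from a site to its right neighbour, for the walk reflected at the
  left end of a window of sites with odds ratios \<open>f 0, f 1, \<dots>\<close> to the right of that end.\<close>

primrec cross :: "(nat \<Rightarrow> real) \<Rightarrow> nat \<Rightarrow> real" where
  "cross f 0 = 1"
| "cross f (Suc k) = 1 + f k * (1 + cross f k)"

lemma cross_ge_1: "(\<And>k. 0 \<le> f k) \<Longrightarrow> 1 \<le> cross f k"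
proof (induction k)
  case (Suc k)
  then have "0 \<le> f k * (1 + cross f k)" by (intro mult_nonneg_nonneg) (auto intro: add_nonneg_nonneg order_trans[of 0 1])
  then show ?case by simp
qed simp

text \<open>
  The right-hand side is a supersolution of the backward equation at the origin: its three terms
  account for lingering in the window \<open>(- m, 2 m)\<close>, leaving it on the left, and returning to
  \<open>m\<close> after leaving it on the right.
\<close>

lemma walk_gen_funpow_upper:
  fixes e :: "int \<Rightarrow> real" and m n :: nat
  defines "w \<equiv> \<lambda>i. 1 / (1 + e i)"
  defines "A \<equiv> (\<Sum>k<3 * m. cross (\<lambda>k. e (int k + 1 - int m)) k)"
  assumes e: "\<And>i. 0 \<le> e i" and m: "m \<ge> 1"
  shows "(walk_gen w ^^ n) (\<lambda>x. of_bool (x < int m)) 0 \<le> 2 * (1 - 1 / (2 * A)) ^ n +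
    scale_sum e (- int m) (2 * int m) 0 + scale_sum e (int m) (2 * int m + int n) (2 * int m)"
proof -
  define U where "U = cross (\<lambda>k. e (int k + 1 - int m))"
  \<comment> \<open>\<open>U k\<close> is the mean time from site \<open>k - m\<close> to the next
    one under reflection at \<open>- m\<close>, so \<open>T x\<close> is the mean time from
    \<open>x\<close> to \<open>2 * m\<close>.\<close>
  define T where "T x = (\<Sum>k\<in>{nat (x + int m)..<3 * m}. U k)" for x
  define \<psi> where "\<psi> x = 1 + T x / A" for x
  define q where "q = 1 - 1 / (2 * A)"
  define G where "G = scale_sum e (- int m) (2 * int m)"
  define B where "B = scale_sum e (int m) (2 * int m + int n) (2 * int m)"
  define v where "v k = (walk_gen w ^^ k) (\<lambda>x. of_bool (x < int m))" for k
  have U1: "1 \<le> U k" for k unfolding U_def using e by (intro cross_ge_1)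
  have U0: "0 \<le> U k" for k using U1[of k] by linarith
  have A: "1 \<le> A"
  proof -
    have "U 0 \<le> sum U {..<3*m}" using m U0 by (intro member_le_sum) auto
    then show ?thesis using U1[of 0] by (simp add: A_def U_def)
  qed
  have q: "0 \<le> q" "q \<le> 1" using A by (auto simp: q_def field_simps)
  have T_le: "T x \<le> A" "0 \<le> T x" for x
    unfolding T_def A_def U_def[symmetric] using U0 by (auto intro!: sum_mono2 sum_nonneg)
  have \<psi>: "1 \<le> \<psi> x" "\<psi> x \<le> 2" for x
    using T_le[of x] A by (auto simp: \<psi>_def field_simps)
  have wb: "0 \<le> w i" "w i \<le> 1" for i using step_prob_bounds[OF e w_def[THEN meta_eq_to_obj_eq]] by auto
  have T_gen: "walk_gen w T x = T x - 1" if x: "- int m < x" "x < 2 * int m" for x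
  proof -
    obtain k where k: "x = int k + 1 - int m" "Suc k < 3 * m"
      using x that by (intro that[of "nat (x + int m) - 1"]) auto
    have n: "nat (x + int m) = Suc k" "nat (x + 1 + int m) = Suc (Suc k)" "nat (x - 1 + int m) = k"
      using k by auto
    have 1: "T x = U (Suc k) + T (x + 1)"
      unfolding T_def n using k by (simp add: sum.atLeast_Suc_lessThan)
    have 2: "T (x - 1) = U k + T x"
      unfolding T_def n using k by (simp add: sum.atLeast_Suc_lessThan)
    have 3: "U (Suc k) = 1 + e x * (1 + U k)" by (simp add: U_def k)
    have "1 + e x > 0" using e[of x] by linarith
    then have *: "1 + e x \<noteq> 0" by simp
    show ?thesis unfolding w_def walk_gen_odds[OF e] nonzero_divide_eq_eq[OF *] 2 1 3
      by (simp add: algebra_simps)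
  qed
  have B0: "0 \<le> B" and G0: "0 \<le> G x" for x unfolding B_def G_def by (intro scale_sum_nonneg e)+
  have main: "v k x \<le> \<psi> x * q ^ k + G x + B" if "k \<le> n" "- int m \<le> x" "x \<le> 2 * int m" for k x
    using that
  proof (induction k arbitrary: x)
    case 0
    have "v 0 x \<le> 1" by (simp add: v_def)
    then show ?case using \<psi>(1)[of x] B0 G0[of x] by simp
  next
    case (Suc k)
    consider "x = - int m" | "x = 2 * int m" | "- int m < x" "x < 2 * int m"
      using Suc.prems by linarith
    then show ?case
    proof cases
      case 1
      have "1 \<le> G x" unfolding G_def 1 using m by (intro scale_sum_ge_1 e) auto
      moreover have "v (Suc k) x \<le> 1"
        unfolding v_def by (rule walk_gen_funpow_le_1[OF e]) (simp add: w_def)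
      moreover have "0 \<le> \<psi> x * q ^ Suc k" using \<psi>(1)[of x] q by (intro mult_nonneg_nonneg) auto
      ultimately show ?thesis using B0 by linarith
    next
      case 2
      \<comment> \<open>From \<open>2 * m\<close> at most \<open>n\<close> steps remain, so the
        horizon \<open>2 * m + n\<close> in \<open>B\<close> covers them.\<close>
      have "v (Suc k) x \<le> B"
        unfolding v_def B_def 2 using m Suc.prems
        by (intro walk_gen_funpow_backtrack[OF e]) (auto simp: w_def)
      moreover have "0 \<le> \<psi> x * q ^ Suc k" using \<psi>(1)[of x] q by (intro mult_nonneg_nonneg) auto
      ultimately show ?thesis using G0[of x] by linarith
    next
      case 3
      have "v (Suc k) x = walk_gen w (v k) x" by (simp add: v_def)
      also have "\<dots> \<le> walk_gen w (\<lambda>x. \<psi> x * q ^ k + G x + B) x"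
        using 3 Suc by (intro walk_gen_mono wb Suc.IH) auto
      also have "\<dots> = (1 + walk_gen w T x / A) * q ^ k + walk_gen w G x + B"
        by (simp add: walk_gen_def \<psi>_def algebra_simps add_divide_distrib diff_divide_distrib)
      also have "walk_gen w G x = G x"
        unfolding G_def w_def using 3 e by (intro scale_sum_harmonic) auto
      \<comment> \<open>\<open>T\<close> decreases by 1 per step in the mean, so
        \<open>\<psi>\<close> decreases by \<open>1 / A\<close>; since
        \<open>\<psi> \<le> 2\<close>, this is at least the fraction \<open>1 / (2 * A)\<close> of
        \<open>\<psi>\<close>.\<close>
      also have "(1 + walk_gen w T x / A) * q ^ k \<le> (\<psi> x * q) * q ^ k"
      proof (rule mult_right_mono)
        have "1 + walk_gen w T x / A = \<psi> x - 1 / A"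
          unfolding T_gen[OF 3] by (simp add: \<psi>_def diff_divide_distrib)
        also have "\<dots> \<le> \<psi> x * q"
          using \<psi>(2)[of x] A by (simp add: q_def field_simps)
        finally show "1 + walk_gen w T x / A \<le> \<psi> x * q" .
      qed (use q in auto)
      finally show ?thesis by (simp add: mult.assoc)
    qed
  qed
  have "v n 0 \<le> \<psi> 0 * q ^ n + G 0 + B" using main[of n 0] m by auto
  also have "\<psi> 0 * q ^ n \<le> 2 * q ^ n" using \<psi>(2)[of 0] q by (intro mult_right_mono) auto
  finally show ?thesis by (simp add: v_def q_def G_def B_def)
qed

text \<open>Leaving the trap to the right requires a passage from \<open>a\<close> to
  \<open>b + 1\<close> without return, which succeeds with probability at most
  \<open>1 / odds_prod e a b\<close> per visit to \<open>a\<close>. The proof counts steps instead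
  of visits, through a function of the position whose drift is at most that probability.\<close>

lemma quenched_escape:
  fixes e :: "int \<Rightarrow> real" and a b :: int
  defines "w \<equiv> \<lambda>i. 1 / (1 + e i)"
  assumes e: "\<And>i. 0 \<le> e i" and ab: "0 \<le> a" "a \<le> b" and R: "0 < odds_prod e a b"
  shows "measure (quenched_law w) {X. \<forall>k\<le>n. X k \<le> b} \<ge> 1 - real n / odds_prod e a b"
proof -
  define Z where "Z = (\<Sum>j\<in>{a..b}. odds_prod e a j)"
  \<comment> \<open>the probability of hitting \<open>b + 1\<close> before \<open>a\<close>; it fails to be superharmonic only at \<open>a\<close>\<close>
  define H where "H x = (if x \<le> a then 0 else if x \<le> b then (\<Sum>j\<in>{a..<x}. odds_prod e a j) / Z else 1)" for x
  define p where "p = 1 / odds_prod e a b"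
  let ?Q = "quenched_law w"
  interpret prob_space ?Q by (rule prob_space_quenched_law)
  define S where "S k = {X::nat \<Rightarrow> int. \<forall>i\<le>k. X i \<le> b}" for k
  have wb: "0 \<le> w i" "w i \<le> 1" for i using step_prob_bounds[OF e w_def[THEN meta_eq_to_obj_eq]] by auto
  have R0: "0 \<le> odds_prod e a j" for j by (intro odds_prod_nonneg e)
  have Z: "odds_prod e a b \<le> Z"
    unfolding Z_def using ab R0 by (intro member_le_sum) auto
  then have Z0: "Z > 0" using R by linarith
  have H0: "0 \<le> H x" for x
    using Z0 R0 by (auto simp: H_def intro!: divide_nonneg_nonneg sum_nonneg)
  have p0: "0 \<le> p" using R by (simp add: p_def)
  \<comment> \<open>The branches of \<open>H\<close> join up: the sum is empty up to
    \<open>a\<close> and equals \<open>Z\<close> at \<open>b + 1\<close>, so one formula covers the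
    interior and the exit point.\<close>
  have H_eq: "H x = (\<Sum>j\<in>{a..<x}. odds_prod e a j) / Z" if "x \<le> b + 1" for x
  proof -
    have "{a..b} = {a..<b + 1}" by auto
    then have "x = b + 1 \<Longrightarrow> (\<Sum>j\<in>{a..<x}. odds_prod e a j) = Z" by (simp add: Z_def)
    then show ?thesis using that Z0 ab by (cases "x = b + 1") (auto simp: H_def)
  qed
  have H_step: "H (x + 1) = H x + odds_prod e a x / Z" if "a \<le> x" "x \<le> b" for x
  proof -
    have "{a..<x + 1} = insert x {a..<x}" using that by auto
    then show ?thesis using that by (simp add: H_eq add_divide_distrib)
  qed
  have gen: "walk_gen w H x \<le> H x + p" if "x \<le> b" for x
  proof -
    consider "x < a" | "x = a" | "a < x" by linarith
    then show ?thesis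
    proof cases
      case 1
      then show ?thesis using p0 by (simp add: walk_gen_def H_def)
    next
      case 2
      have "H (x + 1) = 1 / Z" using H_step[of x] that 2 by (simp add: H_def)
      also have "\<dots> \<le> p" unfolding p_def using Z R by (intro divide_left_mono) auto
      finally have "w x * H (x + 1) \<le> 1 * p" using wb H0 by (intro mult_mono) auto
      then show ?thesis using 2 by (simp add: walk_gen_def H_def)
    next
      case 3
      have 1: "H (x + 1) = H x + e x * odds_prod e a (x - 1) / Z"
        using H_step[of x] that 3 odds_prod_step[of a x e] by simp
      have 2: "H x = H (x - 1) + odds_prod e a (x - 1) / Z"
        using H_step[of "x - 1"] that 3 by simp
      have "1 + e x > 0" using e[of x] by linarith
      then have *: "1 + e x \<noteq> 0" by simp
      have "walk_gen w H x = H x"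
        unfolding w_def walk_gen_odds[OF e] nonzero_divide_eq_eq[OF *] 1 2
        by (simp add: algebra_simps add_divide_distrib)
      then show ?thesis using p0 by simp
    qed
  qed
  have S_sets: "S k \<in> sets path_space" for k
  proof -
    have "S k = {X \<in> space path_space. \<forall>i\<in>{..k}. X i \<le> b}" by (auto simp: S_def space_PiM)
    also have "\<dots> \<in> sets path_space" by measurable
    finally show ?thesis .
  qed
  \<comment> \<open>The exit probability by time \<open>k\<close> plus the integral of
    \<open>H\<close> over the paths still inside starts at 0 and grows by at most \<open>p\<close>
    per step.\<close>
  have *: "emeasure ?Q (- S k) + (\<integral>\<^sup>+X\<in>S k. ennreal (H (X k)) \<partial>?Q) \<le> ennreal (real k * p)" for k
  proof (induction k)
    case 0
    have ae: "AE X in ?Q. X \<in> S 0 \<and> H (X 0) = 0"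
      using AE_quenched_start by eventually_elim (use ab in \<open>auto simp: S_def H_def\<close>)
    have "emeasure ?Q (- S 0) = 0"
    proof (subst AE_iff_measurable[symmetric, where P="\<lambda>X. X \<in> S 0"])
      show "- S 0 \<in> sets ?Q"
        using sets.compl_sets[of "S 0" ?Q] S_sets[of 0] by (simp add: Compl_eq_Diff_UNIV)
      show "AE X in ?Q. X \<in> S 0" using ae by eventually_elim simp
    qed auto
    moreover have "(\<integral>\<^sup>+X\<in>S 0. ennreal (H (X 0)) \<partial>?Q) = (\<integral>\<^sup>+X. 0 \<partial>?Q)"
      using ae by (intro nn_integral_cong_AE) auto
    ultimately show ?case by simp
  next
    case (Suc k)
    have S_Suc: "S (Suc k) = S k \<inter> {X. X (Suc k) \<le> b}" by (auto simp: S_def le_Suc_eq)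
    \<comment> \<open>Paths that leave at this step sit where \<open>H\<close> is 1, so they
      contribute exactly their probability.\<close>
    have "(\<integral>\<^sup>+X\<in>S k. ennreal (H (X (Suc k))) \<partial>?Q) =
        (\<integral>\<^sup>+X. indicator (S k - S (Suc k)) X + ennreal (H (X (Suc k))) * indicator (S (Suc k)) X \<partial>?Q)"
      using ab by (intro nn_integral_cong) (auto simp: S_Suc H_def split: split_indicator)
    also have "\<dots> = emeasure ?Q (S k - S (Suc k)) + (\<integral>\<^sup>+X\<in>S (Suc k). ennreal (H (X (Suc k))) \<partial>?Q)"
      using S_sets[of k] S_sets[of "Suc k"] by (subst nn_integral_add) auto
    finally have 1: "(\<integral>\<^sup>+X\<in>S k. ennreal (H (X (Suc k))) \<partial>?Q) = \<dots>" .
    have "- S (Suc k) = - S k \<union> (S k - S (Suc k))" by (auto simp: S_Suc)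
    moreover have "- S k \<in> sets ?Q"
      using sets.compl_sets[of "S k" ?Q] S_sets[of k] by (simp add: Compl_eq_Diff_UNIV)
    then have "emeasure ?Q (- S k) + emeasure ?Q (S k - S (Suc k)) = emeasure ?Q (- S k \<union> (S k - S (Suc k)))"
      using S_sets[of k] S_sets[of "Suc k"] by (intro plus_emeasure) auto
    ultimately have "emeasure ?Q (- S (Suc k)) = emeasure ?Q (- S k) + emeasure ?Q (S k - S (Suc k))"
      by simp
    then have "emeasure ?Q (- S (Suc k)) + (\<integral>\<^sup>+X\<in>S (Suc k). ennreal (H (X (Suc k))) \<partial>?Q) =
        emeasure ?Q (- S k) + (\<integral>\<^sup>+X\<in>S k. ennreal (H (X (Suc k))) \<partial>?Q)"
      unfolding 1 by (simp add: add.assoc)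
    also have "(\<integral>\<^sup>+X\<in>S k. ennreal (H (X (Suc k))) \<partial>?Q) = (\<integral>\<^sup>+X\<in>S k. ennreal (walk_gen w H (X k)) \<partial>?Q)"
      using S_sets by (intro quenched_Markov wb H0) (auto simp: S_def)
    also have "\<dots> \<le> (\<integral>\<^sup>+X. ennreal (H (X k)) * indicator (S k) X + ennreal p \<partial>?Q)"
    proof (rule nn_integral_mono)
      fix X
      show "ennreal (walk_gen w H (X k)) * indicator (S k) X \<le> ennreal (H (X k)) * indicator (S k) X + ennreal p"
      proof (cases "X \<in> S k")
        case True
        then have "X k \<le> b" by (simp add: S_def)
        then have "ennreal (walk_gen w H (X k)) \<le> ennreal (H (X k) + p)" by (intro ennreal_leI gen)
        also have "\<dots> = ennreal (H (X k)) + ennreal p" using H0 p0 by (intro ennreal_plus)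
        finally show ?thesis using True by simp
      qed simp
    qed
    also have "\<dots> = (\<integral>\<^sup>+X\<in>S k. ennreal (H (X k)) \<partial>?Q) + ennreal p"
      using S_sets[of k] emeasure_space_1 by (subst nn_integral_add) auto
    finally have "emeasure ?Q (- S (Suc k)) + (\<integral>\<^sup>+X\<in>S (Suc k). ennreal (H (X (Suc k))) \<partial>?Q) \<le>
        emeasure ?Q (- S k) + ((\<integral>\<^sup>+X\<in>S k. ennreal (H (X k)) \<partial>?Q) + ennreal p)"
      by (simp add: add_left_mono)
    also have "emeasure ?Q (- S k) + ((\<integral>\<^sup>+X\<in>S k. ennreal (H (X k)) \<partial>?Q) + ennreal p) \<le>
        ennreal (real k * p) + ennreal p"
      unfolding add.assoc[symmetric] by (intro add_mono Suc.IH order_refl)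
    also have "\<dots> = ennreal (real (Suc k) * p)"
    proof -
      have "real (Suc k) * p = real k * p + p" by (simp add: algebra_simps)
      then show ?thesis using p0 by (simp only: ennreal_plus mult_nonneg_nonneg of_nat_0_le_iff)
    qed
    finally show ?case .
  qed
  have "emeasure ?Q (- S n) \<le> ennreal (real n * p)"
    using order_trans[OF _ *[of n], of "emeasure ?Q (- S n)"] by simp
  then have "prob (- S n) \<le> real n * p"
    using p0 by (simp add: emeasure_eq_measure ennreal_le_iff)
  moreover have "prob (- S n) = 1 - prob (S n)"
    using prob_compl[of "S n"] S_sets by (simp add: Compl_eq_Diff_UNIV)
  ultimately show ?thesis by (simp add: S_def p_def)
qed

section \<open>Hitting times compared with positions\<close>

lemma hitting_time_gt_iff: "enat n < hitting_time a X \<longleftrightarrow> (\<forall>k\<le>n. X k \<noteq> a)"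
proof
  assume "enat n < hitting_time a X"
  then show "\<forall>k\<le>n. X k \<noteq> a"
    unfolding hitting_time_def by (auto dest!: less_INF_D)
next
  assume *: "\<forall>k\<le>n. X k \<noteq> a"
  have "enat (Suc n) \<le> hitting_time a X"
    unfolding hitting_time_def
  proof (rule INF_greatest)
    fix i assume "i \<in> {k. X k = a}"
    then have "\<not> i \<le> n" using * by auto
    then show "enat (Suc n) \<le> enat i" by simp
  qed
  moreover have "enat n < enat (Suc n)" by simp
  ultimately show "enat n < hitting_time a X" by (rule less_le_trans[rotated])
qed

text \<open>Steps have size one and the walk starts below \<open>m\<close>, so it cannot pass above
  \<open>m\<close> without visiting it.\<close>

lemma AE_quenched_below_unvisited:
  assumes w: "\<And>x. 0 \<le> w x" "\<And>x. w x \<le> 1" and m: "1 \<le> m"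
  shows "AE X in quenched_law w. (\<forall>j\<le>k. X j \<noteq> m) \<longrightarrow> X k < m"
proof (induction k)
  case 0
  show ?case using AE_quenched_start[of w] by eventually_elim (use m in auto)
next
  case (Suc k)
  \<comment> \<open>\<open>g\<close> detects positions above \<open>m\<close>;
    \<open>walk_gen w g\<close> vanishes at the sites below \<open>m\<close>, where the induction
    hypothesis puts the path.\<close>
  define g where "g x = (of_bool (m < x) :: real)" for x
  define A where "A = {X::nat \<Rightarrow> int. \<forall>j\<le>k. X j \<noteq> m}"
  have A_sets: "A \<in> sets path_space" unfolding A_def by (rule measurable_past_event)
  have "(\<integral>\<^sup>+X\<in>A. ennreal (g (X (Suc k))) \<partial>quenched_law w) = (\<integral>\<^sup>+X\<in>A. ennreal (walk_gen w g (X k)) \<partial>quenched_law w)"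
    using A_sets by (intro quenched_Markov w) (auto simp: g_def A_def)
  also have "\<dots> = (\<integral>\<^sup>+X. 0 \<partial>quenched_law w)"
  proof (rule nn_integral_cong_AE)
    show "AE X in quenched_law w. ennreal (walk_gen w g (X k)) * indicator A X = 0"
      using Suc by eventually_elim (auto simp: A_def g_def walk_gen_def split: split_indicator)
  qed
  finally have "(\<integral>\<^sup>+X. ennreal (g (X (Suc k))) * indicator A X \<partial>quenched_law w) = 0" by simp
  moreover have "(\<lambda>X. ennreal (g (X (Suc k))) * indicator A X) \<in> borel_measurable (quenched_law w)"
    using A_sets by measurable
  ultimately have "AE X in quenched_law w. ennreal (g (X (Suc k))) * indicator A X = 0"
    by (simp add: nn_integral_0_iff_AE)
  then show ?case
  proof eventually_elim
    case (elim X)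
    show ?case
    proof
      assume *: "\<forall>j\<le>Suc k. X j \<noteq> m"
      then have "X \<in> A" by (auto simp: A_def)
      then have "g (X (Suc k)) = 0" using elim by (simp add: g_def)
      then have "\<not> m < X (Suc k)" by (simp add: g_def)
      moreover have "X (Suc k) \<noteq> m" using * by blast
      ultimately show "X (Suc k) < m" by linarith
    qed
  qed
qed

lemma quenched_unvisited_le:
  assumes w: "\<And>x. 0 \<le> w x" "\<And>x. w x \<le> 1" and m: "1 \<le> m"
  shows "measure (quenched_law w) {X. \<forall>k\<le>n. X k \<noteq> m} \<le> measure (quenched_law w) {X. X n < m}"
proof -
  interpret prob_space "quenched_law w" by (rule prob_space_quenched_law)
  show ?thesis
    by (rule finite_measure_mono_AE) (use AE_quenched_below_unvisited[OF w m, of n] in auto)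
qed

section \<open>Moments and large deviations of the odds ratios\<close>

lemma exp_le_second_order: "exp (y::real) \<le> 1 + y + y\<^sup>2 * exp \<bar>y\<bar>"
proof -
  have 1: "exp y - 1 \<le> y * exp y"
    using mult_right_mono[OF exp_ge_add_one_self[of "- y"], of "exp y"]
    by (simp add: algebra_simps exp_add[symmetric])
  have "y * (exp y - 1) \<le> y\<^sup>2 * exp \<bar>y\<bar>"
  proof (cases "0 \<le> y")
    case True
    then show ?thesis using mult_left_mono[OF 1 True] by (simp add: power2_eq_square mult.assoc)
  next
    case False
    have "y * (exp y - 1) = (- y) * (1 - exp y)" by (simp add: algebra_simps)
    also have "\<dots> \<le> (- y) * (- y)" using False exp_ge_add_one_self[of y] by (intro mult_left_mono) linarith+
    also have "\<dots> \<le> y\<^sup>2 * exp \<bar>y\<bar>"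
      using mult_left_mono[of 1 "exp \<bar>y\<bar>" "y\<^sup>2"] by (simp add: power2_eq_square)
    finally show ?thesis .
  qed
  then show ?thesis using 1 by (simp add: algebra_simps)
qed

lemma powr_le_add_endpoints:
  fixes x :: real
  assumes "0 \<le> x" "a \<le> s" "s \<le> b"
  shows "x powr s \<le> x powr a + x powr b"
proof (cases "1 \<le> x")
  case True
  then have "x powr s \<le> x powr b" using assms by (intro powr_mono) auto
  then show ?thesis using powr_ge_zero[of x a] by linarith
next
  case False
  then have "x powr s \<le> x powr a" using assms by (intro powr_mono') auto
  then show ?thesis using powr_ge_zero[of x b] by linarith
qed

text \<open>The square of the logarithm is dominated by \<open>exp\<close> of a small multiple of
  \<open>\<bar>ln x\<bar>\<close>, that is, by a small shift of the exponent; adding both shifts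
  covers both signs of \<open>ln x\<close>. After integration only moments remain.\<close>

lemma powr_mult_ln_square_le:
  fixes x h :: real
  assumes x: "0 < x" and h: "0 < h"
  shows "x powr s * ((ln x)\<^sup>2 * exp (h * \<bar>ln x\<bar>)) \<le> 2 / h\<^sup>2 * (x powr (s + 2 * h) + x powr (s - 2 * h))"
proof -
  define z where "z = h * \<bar>ln x\<bar>"
  have z: "0 \<le> z" using h by (simp add: z_def)
  have "z\<^sup>2 / 2 \<le> exp z" using exp_lower_Taylor_quadratic[OF z] z by simp
  then have 1: "(ln x)\<^sup>2 \<le> 2 / h\<^sup>2 * exp z"
    using h by (simp add: z_def power_mult_distrib field_simps)
  have "(ln x)\<^sup>2 * exp z \<le> (2 / h\<^sup>2 * exp z) * exp z" by (intro mult_right_mono 1) auto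
  also have "\<dots> = 2 / h\<^sup>2 * exp (2 * z)" by (simp add: exp_add[symmetric])
  also have "\<dots> \<le> 2 / h\<^sup>2 * (x powr (2 * h) + x powr (- 2 * h))"
    using x by (intro mult_left_mono) (auto simp: powr_def z_def abs_if mult.assoc)
  finally have "x powr s * ((ln x)\<^sup>2 * exp z) \<le> x powr s * (2 / h\<^sup>2 * (x powr (2 * h) + x powr (- 2 * h)))"
    by (intro mult_left_mono) auto
  also have "\<dots> = 2 / h\<^sup>2 * (x powr (s + 2 * h) + x powr (s - 2 * h))"
    by (simp add: powr_add[symmetric] algebra_simps)
  finally show ?thesis by (simp add: z_def)
qed

text \<open>Convexity of the power in its exponent: the graph lies above its tangent at
  \<open>s\<close>.\<close>

lemma powr_ge_tangent:
  fixes x :: real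
  assumes "0 < x"
  shows "x powr s - x powr s0 \<le> (s - s0) * (x powr s * ln x)"
proof -
  have "1 + (s0 - s) * ln x \<le> exp ((s0 - s) * ln x)" by (rule exp_ge_add_one_self)
  then have "x powr s * (1 + (s0 - s) * ln x) \<le> x powr s * x powr (s0 - s)"
    using assms by (intro mult_left_mono) (auto simp: powr_def)
  also have "\<dots> = x powr s0" by (simp add: powr_add[symmetric])
  finally show ?thesis by (simp add: algebra_simps)
qed

text \<open>Expansion in the exponent with a remainder that is uniform for all \<open>h\<close> up
  to \<open>\<eta>\<close> and expressed through powers, so that it can be integrated over the
  environment.\<close>

lemma powr_second_order:
  fixes x h \<eta> :: real
  assumes x: "0 < x" and h: "\<bar>h\<bar> \<le> \<eta>" "0 < \<eta>"
  shows "x powr (s + h) \<le> x powr s + h * (x powr s * ln x) +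
    h\<^sup>2 * (2 / \<eta>\<^sup>2 * (x powr (s + 2 * \<eta>) + x powr (s - 2 * \<eta>)))"
proof -
  have "x powr h \<le> 1 + h * ln x + (h * ln x)\<^sup>2 * exp \<bar>h * ln x\<bar>"
    using x exp_le_second_order[of "h * ln x"] by (simp add: powr_def)
  also have "\<dots> \<le> 1 + h * ln x + (h * ln x)\<^sup>2 * exp (\<eta> * \<bar>ln x\<bar>)"
    using h by (intro add_left_mono mult_left_mono) (auto simp: abs_mult intro!: mult_right_mono)
  finally have "x powr s * x powr h \<le> x powr s * (1 + h * ln x + (h * ln x)\<^sup>2 * exp (\<eta> * \<bar>ln x\<bar>))"
    by (intro mult_left_mono) auto
  then have "x powr (s + h) \<le> x powr s + h * (x powr s * ln x) + h\<^sup>2 * (x powr s * ((ln x)\<^sup>2 * exp (\<eta> * \<bar>ln x\<bar>)))"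
    by (simp add: powr_add algebra_simps power_mult_distrib)
  also have "\<dots> \<le> x powr s + h * (x powr s * ln x) +
    h\<^sup>2 * (2 / \<eta>\<^sup>2 * (x powr (s + 2 * \<eta>) + x powr (s - 2 * \<eta>)))"
    using powr_mult_ln_square_le[OF x h(2)] by (intro add_left_mono mult_left_mono) auto
  finally show ?thesis .
qed

text \<open>Weighted AM-GM for \<open>x powr \<kappa>\<close> and 1, with its equality case. Both
  come from the tangent inequalities at \<open>s\<close> towards \<open>\<kappa>\<close> and towards
  0.\<close>

lemma weighted_powr_le:
  fixes x :: real
  assumes x: "0 < x" and s: "0 < s" "s < \<kappa>"
  shows "x powr s \<le> (s / \<kappa>) * x powr \<kappa> + (1 - s / \<kappa>)"
    and "x powr s = (s / \<kappa>) * x powr \<kappa> + (1 - s / \<kappa>) \<Longrightarrow> x = 1"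
proof -
  define y where "y = x powr s"
  have y: "0 < y" using x by (simp add: y_def)
  have 1: "y + (\<kappa> - s) * (y * ln x) \<le> x powr \<kappa>"
    using powr_ge_tangent[OF x, of s \<kappa>] by (simp add: y_def algebra_simps)
  have 2: "y - s * (y * ln x) \<le> 1"
    using powr_ge_tangent[OF x, of s 0] x by (simp add: y_def algebra_simps)
  have \<kappa>: "0 < \<kappa>" using s by simp
  \<comment> \<open>These weights cancel the terms in \<open>ln x\<close>.\<close>
  have comb: "\<kappa> * y = s * (y + (\<kappa> - s) * (y * ln x)) + (\<kappa> - s) * (y - s * (y * ln x))"
    by (simp add: algebra_simps)
  have 3: "s * (y + (\<kappa> - s) * (y * ln x)) \<le> s * x powr \<kappa>" using 1 s by (intro mult_left_mono) auto
  have 4: "(\<kappa> - s) * (y - s * (y * ln x)) \<le> (\<kappa> - s) * 1" using 2 s by (intro mult_left_mono) auto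
  have rhs: "(s / \<kappa>) * x powr \<kappa> + (1 - s / \<kappa>) = (s * x powr \<kappa> + (\<kappa> - s) * 1) / \<kappa>"
    using \<kappa> by (simp add: field_simps)
  have "y * \<kappa> \<le> s * x powr \<kappa> + (\<kappa> - s) * 1" using comb 3 4 by (simp add: mult.commute)
  then show "x powr s \<le> (s / \<kappa>) * x powr \<kappa> + (1 - s / \<kappa>)"
    unfolding rhs y_def[symmetric] using \<kappa> by (simp add: le_divide_eq)
  assume "x powr s = (s / \<kappa>) * x powr \<kappa> + (1 - s / \<kappa>)"
  then have "\<kappa> * y = s * x powr \<kappa> + (\<kappa> - s) * 1"
    unfolding rhs y_def[symmetric] using \<kappa> by (simp add: eq_divide_eq mult.commute)
  \<comment> \<open>Equality makes the tangent bound towards 0 tight, so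
    \<open>y * (1 - s * ln x) = 1\<close>; then \<open>z = 1 - s * ln x\<close> satisfies
    \<open>ln z = z - 1\<close>, which forces \<open>z = 1\<close>.\<close>
  then have "(\<kappa> - s) * (y - s * (y * ln x)) = (\<kappa> - s) * 1" using comb 3 4 by linarith
  then have "y - s * (y * ln x) = 1" using s by (simp del: right_diff_distrib' left_diff_distrib')
  then have eq: "y * (1 - s * ln x) = 1" by (simp add: algebra_simps)
  have "ln (1 - s * ln x) = - (s * ln x)"
  proof -
    have "1 - s * ln x = 1 / y" using eq y by (simp add: field_simps)
    then show ?thesis using x y by (simp add: ln_div y_def ln_powr)
  qed
  moreover have "1 - s * ln x > 0"
    using eq y zero_less_mult_pos[of y "1 - s * ln x"] by simp
  ultimately have "- (s * ln x) = 0"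
    using ln_eq_minus_one[of "1 - s * ln x"] by simp
  then show "x = 1" using s x by simp
qed

section \<open>Moments of the odds ratio and a Cramer-type lower bound\<close>

locale iid_odds = prob_space M for M :: "'s measure" +
  fixes e :: "int \<Rightarrow> 's \<Rightarrow> real" and \<kappa> :: real
  assumes indep: "indep_vars (\<lambda>_. borel) e UNIV"
    and same_distr: "\<And>i. distr M borel (e i) = distr M borel (e 0)"
    and pos: "\<And>i s. s \<in> space M \<Longrightarrow> 0 < e i s"
    and ln_neg: "integrable M (\<lambda>x. ln (e 0 x))" "expectation (\<lambda>x. ln (e 0 x)) < 0"
    and \<kappa>_pos: "0 < \<kappa>"
    and \<kappa>_int: "integrable M (\<lambda>x. e 0 x powr \<kappa>)"
    and \<kappa>_eq: "expectation (\<lambda>x. e 0 x powr \<kappa>) = 1"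
begin

definition mom :: "real \<Rightarrow> real" where
  "mom s = expectation (\<lambda>x. e 0 x powr s)"

lemma e_meas [measurable]: "e i \<in> borel_measurable M"
  using indep by (auto simp: indep_vars_def)

lemma e_nonneg: "x \<in> space M \<Longrightarrow> 0 \<le> e i x"
  using pos[of x i] by simp

lemma integrable_powr: "0 \<le> s \<Longrightarrow> s \<le> \<kappa> \<Longrightarrow> integrable M (\<lambda>x. e 0 x powr s)"
proof (rule Bochner_Integration.integrable_bound)
  show "integrable M (\<lambda>x. 1 + e 0 x powr \<kappa>)" using \<kappa>_int by simp
  assume s: "0 \<le> s" "s \<le> \<kappa>"
  show "AE x in M. norm (e 0 x powr s) \<le> norm (1 + e 0 x powr \<kappa>)"
  proof (rule AE_I2)
    fix x assume "x \<in> space M"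
    then show "norm (e 0 x powr s) \<le> norm (1 + e 0 x powr \<kappa>)"
      using powr_le_add_endpoints[of "e 0 x" 0 s \<kappa>] s pos[of x 0] by simp
  qed
qed simp

lemma mom_nonneg: "0 \<le> mom s"
  by (simp add: mom_def)

text \<open>Integrating weighted AM-GM gives at most 1. Equality would force \<open>e 0 = 1\<close>
  almost surely, against the strictly negative mean of the logarithm.\<close>

lemma mom_less_1:
  assumes s: "0 < s" "s < \<kappa>" shows "mom s < 1"
proof (rule ccontr)
  define g where "g x = (s / \<kappa>) * e 0 x powr \<kappa> + (1 - s / \<kappa>) - e 0 x powr s" for x
  have int: "integrable M (\<lambda>x. e 0 x powr s)" using s by (intro integrable_powr) auto
  have g_int: "integrable M g" unfolding g_def using int \<kappa>_int by simp
  have g_nonneg: "AE x in M. 0 \<le> g x"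
    using weighted_powr_le(1)[OF pos s] by (intro AE_I2) (auto simp: g_def)
  have "expectation g = 1 - mom s"
    unfolding g_def using int \<kappa>_int by (simp add: \<kappa>_eq mom_def prob_space)
  moreover assume "\<not> mom s < 1"
  moreover have "0 \<le> expectation g" using g_nonneg by (rule integral_nonneg_AE)
  ultimately have "expectation g = 0" by simp
  then have "AE x in M. g x = 0" using integral_nonneg_eq_0_iff_AE[OF g_int g_nonneg] by simp
  moreover have "g x = 0 \<Longrightarrow> e 0 x = 1" if "x \<in> space M" for x
    using weighted_powr_le(2)[OF pos[OF that] s] by (simp add: g_def)
  ultimately have "AE x in M. ln (e 0 x) = 0" by (auto elim!: AE_mp)
  then have "expectation (\<lambda>x. ln (e 0 x)) = expectation (\<lambda>x. 0)" by (intro integral_cong_AE) auto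
  then show False using ln_neg by simp
qed

lemma mom_pos: "0 \<le> s \<Longrightarrow> s \<le> \<kappa> \<Longrightarrow> 0 < mom s"
proof (rule ccontr)
  assume s: "0 \<le> s" "s \<le> \<kappa>"
  assume "\<not> 0 < mom s"
  then have "mom s = 0" using mom_nonneg[of s] by simp
  then have "AE x in M. e 0 x powr s = 0"
    using integral_nonneg_eq_0_iff_AE[OF integrable_powr[OF s]] by (simp add: mom_def)
  then have "AE x in M. False"
    by (rule AE_mp) (auto intro!: AE_I2 dest: pos[of _ 0])
  then show False by simp
qed

text \<open>Dominated convergence makes \<open>mom\<close> continuous from the left at
  \<open>\<kappa>\<close>, where it equals 1. This supplies a tilting exponent strictly below
  \<open>\<kappa>\<close>, which leaves room for moments on both sides.\<close>

lemma mom_near_\<kappa>: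
  assumes "\<epsilon> > 0"
  shows "\<exists>s. \<kappa> / 2 < s \<and> s < \<kappa> \<and> \<kappa> - s < \<epsilon> \<and> 1 - \<epsilon> < mom s"
proof -
  \<comment> \<open>The shift by 3 keeps every \<open>t n\<close> above
    \<open>\<kappa> / 2\<close>.\<close>
  define t where "t n = \<kappa> - \<kappa> / real (n + 3)" for n
  have t_lim: "t \<longlonglongrightarrow> \<kappa>"
  proof -
    have "(\<lambda>n. \<kappa> / real (n + 3)) \<longlonglongrightarrow> 0"
      by (intro LIMSEQ_ignore_initial_segment lim_const_over_n)
    then show ?thesis unfolding t_def using tendsto_diff[OF tendsto_const[of \<kappa>]] by fastforce
  qed
  have t: "\<kappa> / 2 < t n" "t n < \<kappa>" "0 \<le> t n" for n
    using \<kappa>_pos by (auto simp: t_def field_simps intro!: add_pos_nonneg)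
  have "(\<lambda>n. mom (t n)) \<longlonglongrightarrow> expectation (\<lambda>x. e 0 x powr \<kappa>)"
    unfolding mom_def
  proof (rule integral_dominated_convergence[where w="\<lambda>x. 1 + e 0 x powr \<kappa>"])
    show "AE x in M. (\<lambda>n. e 0 x powr t n) \<longlonglongrightarrow> e 0 x powr \<kappa>"
    proof (rule AE_I2)
      fix x assume "x \<in> space M"
      then show "(\<lambda>n. e 0 x powr t n) \<longlonglongrightarrow> e 0 x powr \<kappa>"
        using pos[of x 0] by (intro tendsto_powr tendsto_const t_lim) auto
    qed
    show "AE x in M. norm (e 0 x powr t n) \<le> 1 + e 0 x powr \<kappa>" for n
    proof (rule AE_I2)
      fix x assume "x \<in> space M"
      then show "norm (e 0 x powr t n) \<le> 1 + e 0 x powr \<kappa>"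
        using powr_le_add_endpoints[of "e 0 x" 0 "t n" \<kappa>] t[of n] pos[of x 0] by simp
    qed
  qed (use \<kappa>_int in auto)
  then have "(\<lambda>n. mom (t n)) \<longlonglongrightarrow> 1" by (simp add: \<kappa>_eq)
  then have "\<forall>\<^sub>F n in sequentially. 1 - \<epsilon> < mom (t n)"
    using assms by (intro order_tendstoD) auto
  moreover have "\<forall>\<^sub>F n in sequentially. \<kappa> - \<epsilon> < t n"
    using t_lim assms by (intro order_tendstoD) auto
  ultimately have "\<forall>\<^sub>F n in sequentially. 1 - \<epsilon> < mom (t n) \<and> \<kappa> - \<epsilon> < t n" by eventually_elim simp
  then obtain n where "1 - \<epsilon> < mom (t n)" "\<kappa> - \<epsilon> < t n"
    using eventually_happens by fastforce
  then show ?thesis using t by (intro exI[of _ "t n"]) auto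
qed

lemma nn_integral_powr:
  assumes "0 \<le> s" "s \<le> \<kappa>"
  shows "(\<integral>\<^sup>+x. ennreal (e i x powr s) \<partial>M) = ennreal (mom s)"
proof -
  have "(\<integral>\<^sup>+x. ennreal (e i x powr s) \<partial>M) = (\<integral>\<^sup>+y. ennreal (y powr s) \<partial>distr M borel (e i))"
    by (simp add: nn_integral_distr)
  also have "\<dots> = (\<integral>\<^sup>+x. ennreal (e 0 x powr s) \<partial>M)"
    unfolding same_distr[of i] by (simp add: nn_integral_distr)
  also have "\<dots> = ennreal (mom s)"
    unfolding mom_def using integrable_powr[OF assms] by (intro nn_integral_eq_integral) auto
  finally show ?thesis .
qed

lemma nn_integral_prod_powr:
  assumes s: "0 \<le> s" "s \<le> \<kappa>" and I: "finite I"
  shows "(\<integral>\<^sup>+x. ennreal ((\<Prod>i\<in>I. e i x) powr s) \<partial>M) = ennreal (mom s ^ card I)"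
proof -
  have "(\<integral>\<^sup>+x. ennreal ((\<Prod>i\<in>I. e i x) powr s) \<partial>M) = (\<integral>\<^sup>+x. (\<Prod>i\<in>I. ennreal (e i x powr s)) \<partial>M)"
    by (intro nn_integral_cong) (auto simp: prod_powr_distrib prod_ennreal e_nonneg)
  also have "\<dots> = (\<Prod>i\<in>I. \<integral>\<^sup>+x. ennreal (e i x powr s) \<partial>M)"
    by (intro indep_vars_nn_integral I indep_vars_compose2[OF indep_vars_subset[OF indep]]) auto
  also have "\<dots> = ennreal (mom s ^ card I)"
    by (simp add: nn_integral_powr[OF s] mom_nonneg ennreal_power)
  finally show ?thesis .
qed

lemma integrable_prod_powr:
  assumes s: "0 \<le> s" "s \<le> \<kappa>" and I: "finite I"
  shows "integrable M (\<lambda>x. (\<Prod>i\<in>I. e i x) powr s)" "expectation (\<lambda>x. (\<Prod>i\<in>I. e i x) powr s) = mom s ^ card I"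
  using nn_integral_prod_powr[OF assms] mom_nonneg[of s]
  by (auto intro!: integrableI_nonneg simp: integral_eq_nn_integral)

text \<open>\<open>b\<close> is the derivative of \<open>mom\<close> at \<open>s\<close>. The
  quadratic bound will control exponential moments near \<open>s\<close>, and the tangent bound will
  keep \<open>b\<close> away from 0; both are integrated pointwise inequalities.\<close>

lemma mom_second_order:
  assumes \<eta>: "0 < \<eta>" "2 * \<eta> \<le> s" "s + 2 * \<eta> \<le> \<kappa>"
  defines "b \<equiv> expectation (\<lambda>x. e 0 x powr s * ln (e 0 x))"
  shows "\<exists>C>0. \<forall>h. \<bar>h\<bar> \<le> \<eta> \<longrightarrow> mom (s + h) \<le> mom s + h * b + h\<^sup>2 * C"
    and "0 \<le> s0 \<Longrightarrow> s0 \<le> \<kappa> \<Longrightarrow> mom s - mom s0 \<le> (s - s0) * b"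
proof -
  define g where "g x = 2 / \<eta>\<^sup>2 * (e 0 x powr (s + 2 * \<eta>) + e 0 x powr (s - 2 * \<eta>))" for x
  have s_int: "integrable M (\<lambda>x. e 0 x powr s)" using \<eta> by (intro integrable_powr) auto
  have g_int: "integrable M g"
    unfolding g_def using \<eta> by (intro integrable_mult_right Bochner_Integration.integrable_add integrable_powr) auto
  have b_int: "integrable M (\<lambda>x. e 0 x powr s * ln (e 0 x))"
  proof (rule Bochner_Integration.integrable_bound)
    show "integrable M (\<lambda>x. e 0 x powr s + g x)" using s_int g_int by (rule Bochner_Integration.integrable_add)
    show "AE x in M. norm (e 0 x powr s * ln (e 0 x)) \<le> norm (e 0 x powr s + g x)"
    proof (rule AE_I2)
      fix x assume x: "x \<in> space M"
      define y where "y = e 0 x"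
      have y: "0 < y" using pos[OF x] by (simp add: y_def)
      have "\<bar>ln y\<bar> \<le> 1 + (ln y)\<^sup>2 * exp (\<eta> * \<bar>ln y\<bar>)"
      proof -
        have "0 \<le> (\<bar>ln y\<bar> - 1)\<^sup>2 + 1 + \<bar>ln y\<bar>\<^sup>2" by simp
        then have "\<bar>ln y\<bar> \<le> 1 + (ln y)\<^sup>2" by (simp add: power2_diff)
        also have "(ln y)\<^sup>2 \<le> (ln y)\<^sup>2 * exp (\<eta> * \<bar>ln y\<bar>)"
          using mult_left_mono[of 1 "exp (\<eta> * \<bar>ln y\<bar>)" "(ln y)\<^sup>2"] \<eta> by simp
        finally show ?thesis by simp
      qed
      then have "y powr s * \<bar>ln y\<bar> \<le> y powr s * (1 + (ln y)\<^sup>2 * exp (\<eta> * \<bar>ln y\<bar>))"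
        by (intro mult_left_mono) auto
      also have "\<dots> \<le> y powr s + 2 / \<eta>\<^sup>2 * (y powr (s + 2 * \<eta>) + y powr (s - 2 * \<eta>))"
        using powr_mult_ln_square_le[OF y \<eta>(1), of s] by (simp add: distrib_left)
      finally show "norm (e 0 x powr s * ln (e 0 x)) \<le> norm (e 0 x powr s + g x)"
        unfolding y_def g_def by (simp add: abs_mult)
    qed
  qed simp
  have "mom (s + h) \<le> mom s + h * b + h\<^sup>2 * expectation g" if h: "\<bar>h\<bar> \<le> \<eta>" for h
  proof -
    have "mom (s + h) \<le> expectation (\<lambda>x. e 0 x powr s + h * (e 0 x powr s * ln (e 0 x)) + h\<^sup>2 * g x)"
      unfolding mom_def
    proof (rule integral_mono)
      show "integrable M (\<lambda>x. e 0 x powr (s + h))" using \<eta> h by (intro integrable_powr) auto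
      show "integrable M (\<lambda>x. e 0 x powr s + h * (e 0 x powr s * ln (e 0 x)) + h\<^sup>2 * g x)"
        by (intro Bochner_Integration.integrable_add integrable_mult_right s_int b_int g_int)
    qed (use powr_second_order[OF pos h \<eta>(1)] in \<open>simp add: g_def\<close>)
    also have "\<dots> = mom s + h * b + h\<^sup>2 * expectation g"
      unfolding mom_def b_def
      using s_int b_int g_int by simp
    finally show ?thesis .
  qed
  moreover have "h\<^sup>2 * expectation g \<le> h\<^sup>2 * (expectation g + 1)" for h :: real by (intro mult_left_mono) auto
  moreover have "0 \<le> expectation g" by (intro Bochner_Integration.integral_nonneg) (auto simp: g_def)
  ultimately show "\<exists>C>0. \<forall>h. \<bar>h\<bar> \<le> \<eta> \<longrightarrow> mom (s + h) \<le> mom s + h * b + h\<^sup>2 * C"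
    by (intro exI[of _ "expectation g + 1"] conjI allI impI)
      (auto intro: order_trans[OF _ add_left_mono])
  assume s0: "0 \<le> s0" "s0 \<le> \<kappa>"
  have "mom s - mom s0 = expectation (\<lambda>x. e 0 x powr s - e 0 x powr s0)"
    unfolding mom_def using s_int integrable_powr[OF s0] by simp
  also have "\<dots> \<le> expectation (\<lambda>x. (s - s0) * (e 0 x powr s * ln (e 0 x)))"
    using s_int integrable_powr[OF s0] b_int
    by (intro integral_mono integrable_mult_right Bochner_Integration.integrable_diff powr_ge_tangent pos) auto
  also have "\<dots> = (s - s0) * b" by (simp add: b_def)
  finally show "mom s - mom s0 \<le> (s - s0) * b" .
qed

text \<open>Exponential tilting without a tilted law: the environment is weighted by the product
  \<open>P\<close> to the power \<open>s\<close>. Under the normalised weight \<open>ln P\<close>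
  has mean \<open>l * \<mu>\<close>, and \<open>l\<close> is chosen so that at least half of the
  weight sits where \<open>ln P\<close> is between \<open>t\<close> and
  \<open>(1 + 3 * \<delta>) * t\<close>. There the weight is bounded, which bounds the true
  probability from below.\<close>

lemma cramer_lower:
  assumes \<delta>: "0 < \<delta>" "\<delta> \<le> 1"
  shows "\<exists>K>0. \<forall>\<^sub>F t in at_top. \<exists>l\<ge>1. real l \<le> K * t \<and> (\<forall>I. finite I \<longrightarrow> card I = l \<longrightarrow>
    exp (- (\<kappa> + (3 * \<kappa> + 3) * \<delta>) * t) \<le> prob {x \<in> space M. exp t \<le> (\<Prod>i\<in>I. e i x)})"
proof -
  \<comment> \<open>Half the slope of the chord of \<open>mom\<close> from
    \<open>\<kappa> / 2\<close> to \<open>\<kappa>\<close>: a lower bound for the derivative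
    \<open>b\<close> that does not depend on \<open>s\<close>.\<close>
  define c where "c = (1 - mom (\<kappa> / 2)) / \<kappa>"
  have c: "0 < c" using mom_less_1[of "\<kappa> / 2"] \<kappa>_pos by (simp add: c_def)
  \<comment> \<open>the tilting parameter \<open>s\<close>: close enough to \<open>\<kappa>\<close> that \<open>mom s\<close> raised to the block length is at least \<open>exp (- 3 * \<delta> * t)\<close>\<close>
  define \<epsilon> where "\<epsilon> = min ((1 - mom (\<kappa> / 2)) / 2) (1 - exp (- (\<delta> * c / 2)))"
  have "0 < \<epsilon>" using mom_less_1[of "\<kappa> / 2"] \<kappa>_pos c \<delta> by (simp add: \<epsilon>_def)
  from mom_near_\<kappa>[OF this] obtain s where s: "\<kappa> / 2 < s" "s < \<kappa>" "1 - \<epsilon> < mom s" by auto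
  define f where "f = mom s"
  have f: "0 < f" "f < 1" using mom_pos[of s] mom_less_1[of s] s \<kappa>_pos by (auto simp: f_def)
  have f_ln: "- (\<delta> * c / 2) \<le> ln f"
  proof -
    have "exp (- (\<delta> * c / 2)) \<le> 1 - \<epsilon>" by (simp add: \<epsilon>_def)
    also have "\<dots> \<le> f" using s by (simp add: f_def)
    finally show ?thesis using f by (simp add: ln_ge_iff)
  qed
  define b where "b = expectation (\<lambda>x. e 0 x powr s * ln (e 0 x))"
  define \<eta> where "\<eta> = min (s / 2) ((\<kappa> - s) / 2)"
  have \<eta>: "0 < \<eta>" "2 * \<eta> \<le> s" "s + 2 * \<eta> \<le> \<kappa>"
  proof -
    have 1: "\<eta> \<le> s / 2" "\<eta> \<le> (\<kappa> - s) / 2"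
      unfolding \<eta>_def by (rule min.cobounded1, rule min.cobounded2)
    show "0 < \<eta>" using s \<kappa>_pos by (auto simp: \<eta>_def)
    show "2 * \<eta> \<le> s" using 1 by linarith
    show "s + 2 * \<eta> \<le> \<kappa>" using 1 by (simp add: field_simps)
  qed
  obtain C where C: "0 < C" "\<And>h. \<bar>h\<bar> \<le> \<eta> \<Longrightarrow> mom (s + h) \<le> f + h * b + h\<^sup>2 * C"
    using mom_second_order(1)[OF \<eta>] unfolding f_def b_def by auto
  \<comment> \<open>The mean of \<open>ln (e 0 x)\<close> under the normalised weight
    \<open>e 0 x powr s\<close>.\<close>
  define \<mu> where "\<mu> = b / f"
  have b_ge: "c \<le> b"
  proof -
    have "(1 - mom (\<kappa> / 2)) / 2 \<le> f - mom (\<kappa> / 2)"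
    proof -
      have "\<epsilon> \<le> (1 - mom (\<kappa> / 2)) / 2" unfolding \<epsilon>_def by (rule min.cobounded1)
      then have "1 - (1 - mom (\<kappa> / 2)) / 2 \<le> f" using s(3) unfolding f_def by linarith
      then show ?thesis by (simp add: field_simps)
    qed
    also have "\<dots> \<le> (s - \<kappa> / 2) * b"
      using mom_second_order(2)[OF \<eta>, of "\<kappa> / 2"] \<kappa>_pos by (simp add: f_def b_def)
    finally have 1: "(1 - mom (\<kappa> / 2)) / 2 \<le> (s - \<kappa> / 2) * b" .
    have "0 < (s - \<kappa> / 2) * b" using 1 mom_less_1[of "\<kappa> / 2"] \<kappa>_pos by simp
    then have "0 < b" using s by (simp add: zero_less_mult_iff)
    then have "(s - \<kappa> / 2) * b \<le> (\<kappa> / 2) * b" using s by (intro mult_right_mono) auto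
    then show ?thesis using 1 \<kappa>_pos by (simp add: c_def field_simps)
  qed
  have \<mu>: "c \<le> \<mu>" "0 < \<mu>"
  proof -
    have "b \<le> b / f" using f b_ge c by (simp add: le_divide_eq mult_left_le)
    then show "c \<le> \<mu>" using b_ge by (simp add: \<mu>_def)
    then show "0 < \<mu>" using c by simp
  qed
  \<comment> \<open>Small enough that the quadratic error \<open>h\<^sup>2 * C / f\<close> is at
    most \<open>h * \<mu> * \<delta> / 4\<close>.\<close>
  define h where "h = min \<eta> (\<mu> * \<delta> * f / (4 * C))"
  have h: "0 < h" "h \<le> \<eta>" "h * (C / f) \<le> \<mu> * \<delta> / 4"
  proof -
    show "0 < h" "h \<le> \<eta>" using \<eta> \<mu> \<delta> f C by (auto simp: h_def)
    have "h * (C / f) \<le> (\<mu> * \<delta> * f / (4 * C)) * (C / f)" using C f by (intro mult_right_mono) (auto simp: h_def)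
    also have "\<dots> = \<mu> * \<delta> / 4" using C f by (simp add: field_simps)
    finally show "h * (C / f) \<le> \<mu> * \<delta> / 4" .
  qed
  have mom_exp: "mom (s + g) \<le> f * exp (g * \<mu> + h * (\<mu> * \<delta> / 4))" if "\<bar>g\<bar> = h" for g
  proof -
    have g2: "g\<^sup>2 = h\<^sup>2" using that h by (metis power2_abs)
    have "mom (s + g) \<le> f + g * b + g\<^sup>2 * C" using that h by (intro C) auto
    also have "\<dots> = f * (1 + (g * \<mu> + h * (h * (C / f))))"
      using f unfolding g2 by (simp add: \<mu>_def field_simps power2_eq_square)
    also have "\<dots> \<le> f * exp (g * \<mu> + h * (h * (C / f)))"
      using f by (intro mult_left_mono exp_ge_add_one_self) auto
    also have "\<dots> \<le> f * exp (g * \<mu> + h * (\<mu> * \<delta> / 4))"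
    proof -
      have "h * (h * (C / f)) \<le> h * (\<mu> * \<delta> / 4)" using h by (intro mult_left_mono) auto
      then show ?thesis using f by (intro mult_left_mono) (simp_all only: exp_le_cancel_iff add_left_mono less_imp_le)
    qed
    finally show ?thesis .
  qed
  define K where "K = (2 + \<mu>) / \<mu>"
  have "\<forall>\<^sub>F t in at_top. exp (- (h * \<delta> / 2 * t)) \<le> (1::real) / 4"
    using h \<delta> by real_asymp
  moreover have "\<forall>\<^sub>F t in at_top. exp (h * (2 * \<mu> - \<delta> * t)) \<le> (1::real) / 4"
    using h \<delta> by real_asymp
  moreover have "\<forall>\<^sub>F t in at_top. exp (- (2 * \<delta> * t)) \<le> f / (2::real)"
    using f \<delta> by real_asymp
  moreover have "\<forall>\<^sub>F t in at_top. 1 \<le> (t::real)" by (rule eventually_ge_at_top)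
  ultimately have "\<forall>\<^sub>F t in at_top. \<exists>l\<ge>1. real l \<le> K * t \<and> (\<forall>I. finite I \<longrightarrow> card I = l \<longrightarrow>
    exp (- (\<kappa> + (3 * \<kappa> + 3) * \<delta>) * t) \<le> prob {x \<in> space M. exp t \<le> (\<Prod>i\<in>I. e i x)})"
  proof eventually_elim
    case (elim t)
    \<comment> \<open>The block length at which the tilted mean \<open>l * \<mu>\<close> reaches
      \<open>(1 + \<delta>) * t\<close>, rounded up.\<close>
    define l where "l = nat \<lceil>(1 + \<delta>) * t / \<mu>\<rceil>"
    have tpos: "0 < (1 + \<delta>) * t / \<mu>" using elim \<delta> \<mu> by simp
    have l: "(1 + \<delta>) * t / \<mu> \<le> real l" "real l \<le> (1 + \<delta>) * t / \<mu> + 1"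
      unfolding l_def using tpos by linarith+
    have l1: "1 \<le> l" using l tpos by (cases l) auto
    have l\<mu>: "(1 + \<delta>) * t \<le> real l * \<mu>" "real l * \<mu> \<le> (1 + \<delta>) * t + \<mu>"
      using l \<mu> by (simp_all add: field_simps)
    define t' where "t' = (1 + 3 * \<delta>) * t"
    have lK: "real l \<le> 2 * t / \<mu> + 1"
    proof -
      have "(1 + \<delta>) * t / \<mu> \<le> 2 * t / \<mu>"
        using \<delta> \<mu> elim by (intro divide_right_mono mult_right_mono) auto
      then show ?thesis using l by linarith
    qed
    have "K * t = 2 * t / \<mu> + t" using \<mu> by (simp add: K_def field_simps)
    then have "real l \<le> K * t" using lK elim by linarith
    moreover have "exp (- (\<kappa> + (3 * \<kappa> + 3) * \<delta>) * t) \<le> prob {x \<in> space M. exp t \<le> (\<Prod>i\<in>I. e i x)}"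
      if I: "finite I" "card I = l" for I
    proof -
      define P where "P x = (\<Prod>i\<in>I. e i x)" for x
      have P_pos: "0 < P x" if "x \<in> space M" for x
        unfolding P_def using pos[OF that] by (intro prod_pos) auto
      have P_meas [measurable]: "P \<in> borel_measurable M" unfolding P_def by measurable
      define p where "p = prob {x \<in> space M. exp t \<le> P x}"
      have int_ind: "integrable M (indicator {x \<in> space M. exp t \<le> P x} :: _ \<Rightarrow> real)"
        by (rule integrable_const_bound[where B=1]) (auto split: split_indicator)
      have intP: "integrable M (\<lambda>x. P x powr q)" "expectation (\<lambda>x. P x powr q) = mom q ^ l"
        if "0 \<le> q" "q \<le> \<kappa>" for q
        using integrable_prod_powr[OF that I(1)] I(2) by (simp_all add: P_def)
      have powb: "mom (s + g) ^ l \<le> f ^ l * exp (real l * (g * \<mu> + h * (\<mu> * \<delta> / 4)))" if "\<bar>g\<bar> = h" for g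
        using power_mono[OF mom_exp[OF that] mom_nonneg, of l]
        by (simp add: power_mult_distrib exp_of_nat_mult)
      have "f ^ l = expectation (\<lambda>x. P x powr s)" using intP[of s] s \<kappa>_pos by (simp add: f_def)
      \<comment> \<open>The log-product is below \<open>t\<close>, above \<open>t'\<close> or in
        between: the first two cases are Chernoff bounds with exponents \<open>s - h\<close> and
        \<open>s + h\<close>, the third uses \<open>P x powr s \<le> exp (s * t')\<close>.\<close>
      also have "\<dots> \<le> expectation (\<lambda>x. exp (h * t) * P x powr (s - h) + exp (- (h * t')) * P x powr (s + h)
          + exp (s * t') * indicator {x \<in> space M. exp t \<le> P x} x)"
      proof (rule integral_mono)
        fix x assume x: "x \<in> space M"
        define z where "z = ln (P x)"
        have pw: "P x powr q = exp (q * z)" for q using P_pos[OF x] by (simp add: powr_def z_def)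
        have Pz: "P x = exp z" using P_pos[OF x] by (simp add: z_def)
        consider "z < t" | "t' < z" | "t \<le> z" "z \<le> t'" by linarith
        then show "P x powr s \<le> exp (h * t) * P x powr (s - h) + exp (- (h * t')) * P x powr (s + h)
          + exp (s * t') * indicator {x \<in> space M. exp t \<le> P x} x"
        proof cases
          case 1
          have "h * z \<le> h * t" using 1 h by (intro mult_left_mono) auto
          then have "exp (s * z) \<le> exp (h * t) * exp ((s - h) * z)"
            unfolding exp_add[symmetric] by (simp add: algebra_simps)
          then show ?thesis unfolding pw
            by (intro order_trans[OF _ add_increasing2[OF _ add_increasing2]]) auto
        next
          case 2
          have "h * t' \<le> h * z" using 2 h by (intro mult_left_mono) auto
          then have "exp (s * z) \<le> exp (- (h * t')) * exp ((s + h) * z)"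
            unfolding exp_add[symmetric] by (simp add: algebra_simps)
          then show ?thesis unfolding pw
            by (intro order_trans[OF _ add_increasing2[OF _ add_increasing]]) auto
        next
          case 3
          have "s * z \<le> s * t'" using 3 s \<kappa>_pos by (intro mult_left_mono) auto
          then have "exp (s * z) \<le> exp (s * t') * indicator {x \<in> space M. exp t \<le> P x} x"
            using 3 x by (simp add: Pz)
          then show ?thesis unfolding pw by (intro add_increasing) auto
        qed
      qed (use int_ind intP[of s] intP[of "s - h"] intP[of "s + h"] h \<eta> in \<open>auto intro!: Bochner_Integration.integrable_add\<close>)
      also have "\<dots> = exp (h * t) * mom (s - h) ^ l + exp (- (h * t')) * mom (s + h) ^ l + exp (s * t') * p"
        using int_ind intP[of "s - h"] intP[of "s + h"] h \<eta> by (simp add: p_def)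
      also have "exp (h * t) * mom (s - h) ^ l \<le> f ^ l * (1 / 4)"
      proof -
        have "exp (h * t) * mom (s - h) ^ l \<le> exp (h * t) * (f ^ l * exp (real l * (- h * \<mu> + h * (\<mu> * \<delta> / 4))))"
          using powb[of "- h"] h by (intro mult_left_mono) auto
        also have "\<dots> = f ^ l * exp (h * (t - (real l * \<mu>) * (1 - \<delta> / 4)))"
          by (simp add: exp_add[symmetric] algebra_simps)
        also have "h * (t - (real l * \<mu>) * (1 - \<delta> / 4)) \<le> - (h * \<delta> / 2 * t)"
        proof -
          have "t * (1 + \<delta> / 2) \<le> t * (1 + \<delta> / 2 + \<delta> * (1 - \<delta>) / 4)"
            using \<delta> elim by (intro mult_left_mono) auto
          also have "\<dots> = ((1 + \<delta>) * t) * (1 - \<delta> / 4)" by (simp add: field_simps)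
          also have "\<dots> \<le> (real l * \<mu>) * (1 - \<delta> / 4)"
            using l\<mu> \<delta> by (intro mult_right_mono) auto
          finally have "t - (real l * \<mu>) * (1 - \<delta> / 4) \<le> t - t * (1 + \<delta> / 2)" by linarith
          also have "\<dots> = - (\<delta> / 2 * t)" by (simp add: algebra_simps)
          finally have "t - (real l * \<mu>) * (1 - \<delta> / 4) \<le> - (\<delta> / 2 * t)" .
          then have "h * (t - (real l * \<mu>) * (1 - \<delta> / 4)) \<le> h * (- (\<delta> / 2 * t))"
            using h by (intro mult_left_mono) auto
          then show ?thesis by simp
        qed
        also have "f ^ l * exp (- (h * \<delta> / 2 * t)) \<le> f ^ l * (1 / 4)" using elim f by (intro mult_left_mono) auto
        finally show ?thesis using f by simp
      qed
      also have "exp (- (h * t')) * mom (s + h) ^ l \<le> f ^ l * (1 / 4)"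
      proof -
        have "exp (- (h * t')) * mom (s + h) ^ l \<le> exp (- (h * t')) * (f ^ l * exp (real l * (h * \<mu> + h * (\<mu> * \<delta> / 4))))"
          using powb[of h] h by (intro mult_left_mono) auto
        also have "\<dots> = f ^ l * exp (h * ((real l * \<mu>) * (1 + \<delta> / 4) - t'))"
          by (simp add: exp_add[symmetric] algebra_simps)
        also have "h * ((real l * \<mu>) * (1 + \<delta> / 4) - t') \<le> h * (2 * \<mu> - \<delta> * t)"
        proof -
          have "(real l * \<mu>) * (1 + \<delta> / 4) \<le> ((1 + \<delta>) * t + \<mu>) * (1 + \<delta> / 4)"
            using l\<mu> \<delta> by (intro mult_right_mono) auto
          also have "\<dots> = (1 + \<delta>) * (1 + \<delta> / 4) * t + \<mu> * (1 + \<delta> / 4)" by (simp add: algebra_simps)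
          also have "\<dots> \<le> (1 + 2 * \<delta>) * t + \<mu> * 2"
          proof (intro add_mono mult_right_mono mult_left_mono)
            have "\<delta> * \<delta> \<le> \<delta> * 3" using \<delta> by (intro mult_left_mono) auto
            then show "(1 + \<delta>) * (1 + \<delta> / 4) \<le> 1 + 2 * \<delta>" by (simp add: field_simps)
          qed (use \<delta> \<mu> elim in auto)
          finally have "(real l * \<mu>) * (1 + \<delta> / 4) - t' \<le> 2 * \<mu> - \<delta> * t" by (simp add: t'_def algebra_simps)
          then show ?thesis using h by (intro mult_left_mono) auto
        qed
        also have "f ^ l * exp (h * (2 * \<mu> - \<delta> * t)) \<le> f ^ l * (1 / 4)" using elim f by (intro mult_left_mono) auto
        finally show ?thesis using f by simp
      qed
      \<comment> \<open>Each tail carries at most a quarter of \<open>f ^ l\<close>, so the middle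
        range keeps half of it.\<close>
      finally have "f ^ l / 2 \<le> exp (s * t') * p" by simp
      then have p_ge: "f ^ l / 2 * exp (- (s * t')) \<le> p" by (simp add: exp_minus field_simps)
      \<comment> \<open>The exponent splits into \<open>\<kappa> * t'\<close>,
        \<open>\<delta> * t\<close> and \<open>2 * \<delta> * t\<close>: the second part pays for
        \<open>f ^ (l - 1)\<close>, the third for the remaining \<open>f / 2\<close>.\<close>
      have "exp (- (\<kappa> + (3 * \<kappa> + 3) * \<delta>) * t) = (exp (- (\<delta> * t)) * exp (- (2 * \<delta> * t))) * exp (- (\<kappa> * t'))"
        by (simp add: exp_add[symmetric] t'_def algebra_simps)
      also have "\<dots> \<le> (f ^ (l - 1) * (f / 2)) * exp (- (s * t'))"
      proof (intro mult_mono)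
        have "- (\<delta> * t) \<le> real (l - 1) * ln f"
        proof -
          have "real (l - 1) \<le> 2 * t / \<mu>" using lK l1 by (simp add: of_nat_diff)
          also have "\<dots> \<le> 2 * t / c" using c \<mu> elim by (intro divide_left_mono) auto
          finally have "real (l - 1) * (\<delta> * c / 2) \<le> (2 * t / c) * (\<delta> * c / 2)"
            using \<delta> c by (intro mult_right_mono) auto
          also have "\<dots> = \<delta> * t" using c by simp
          finally have "- (\<delta> * t) \<le> real (l - 1) * (- (\<delta> * c / 2))" by simp
          also have "\<dots> \<le> real (l - 1) * ln f" using f_ln by (intro mult_left_mono) auto
          finally show ?thesis .
        qed
        then have "exp (- (\<delta> * t)) \<le> exp (real (l - 1) * ln f)" by simp
        also have "\<dots> = f ^ (l - 1)" using f by (simp add: exp_of_nat_mult)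
        finally show "exp (- (\<delta> * t)) \<le> f ^ (l - 1)" .
        have "s * t' \<le> \<kappa> * t'" using s elim \<delta> by (intro mult_right_mono) (auto simp: t'_def)
        then show "exp (- (\<kappa> * t')) \<le> exp (- (s * t'))" by simp
      qed (use elim f in auto)
      also have "f ^ (l - 1) * (f / 2) = f ^ l / 2" using l1 by (cases l) auto
      also note p_ge
      finally show ?thesis by (simp add: p_def P_def)
    qed
    ultimately show ?case using l1 by blast
  qed
  moreover have "0 < K" using \<mu> by (simp add: K_def)
  ultimately show ?thesis by blast
qed

end

section \<open>Crossing times in the random environment\<close>

lemma powr_add_le_add_powr:
  fixes x y :: real
  assumes "0 \<le> x" "0 \<le> y" "0 < \<theta>" "\<theta> \<le> 1"
  shows "(x + y) powr \<theta> \<le> x powr \<theta> + y powr \<theta>"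
proof (cases "x + y = 0")
  case True
  then show ?thesis using assms by simp
next
  case False
  then have xy: "0 < x + y" using assms by linarith
  \<comment> \<open>Fractions of \<open>x + y\<close> lie in the unit interval, where lowering the
    exponent from 1 to \<open>\<theta>\<close> cannot decrease them.\<close>
  have le: "z / (x + y) \<le> (z / (x + y)) powr \<theta>" if "0 \<le> z" "z \<le> x + y" for z
  proof (cases "z = 0")
    case False
    then have "(z / (x + y)) powr 1 \<le> (z / (x + y)) powr \<theta>"
      using that xy assms by (intro powr_mono') auto
    then show ?thesis using that xy by simp
  qed simp
  have "1 = x / (x + y) + y / (x + y)" using xy by (simp add: add_divide_distrib[symmetric])
  also have "\<dots> \<le> (x / (x + y)) powr \<theta> + (y / (x + y)) powr \<theta>"
    using assms by (intro add_mono le) auto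
  also have "\<dots> = (x powr \<theta> + y powr \<theta>) / (x + y) powr \<theta>"
    using assms xy by (simp add: powr_divide add_divide_distrib)
  finally show ?thesis using xy by (simp add: le_divide_eq)
qed

lemma powr_sum_le_sum_powr:
  fixes a :: "'a \<Rightarrow> real"
  assumes "finite I" "\<And>i. i \<in> I \<Longrightarrow> 0 \<le> a i" "0 < \<theta>" "\<theta> \<le> 1"
  shows "(\<Sum>i\<in>I. a i) powr \<theta> \<le> (\<Sum>i\<in>I. a i powr \<theta>)"
  using assms(1,2)
proof (induction I rule: finite_induct)
  case (insert i I)
  have "(a i + sum a I) powr \<theta> \<le> a i powr \<theta> + sum a I powr \<theta>"
    using insert assms by (intro powr_add_le_add_powr sum_nonneg) auto
  then show ?case using insert by simp
qed simp

text \<open>For large \<open>x\<close> the first term suffices, since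
  \<open>1 + x \<le> (1 + \<eta>) powr (1 / s) * x\<close>; for small \<open>x\<close> the constant
  does. This takes the place of subadditivity when \<open>s > 1\<close>, and a factor close to 1
  preserves the contraction by \<open>mom s < 1\<close>.\<close>

lemma one_plus_powr_le:
  fixes s \<eta> :: real
  assumes s: "0 < s" and \<eta>: "0 < \<eta>"
  shows "\<exists>C\<ge>0. \<forall>x\<ge>0. (1 + x) powr s \<le> (1 + \<eta>) * x powr s + C"
proof -
  define g where "g = (1 + \<eta>) powr (1 / s)"
  have g: "1 < g" unfolding g_def using s \<eta> by (intro gr_one_powr) auto
  define x0 where "x0 = 1 / (g - 1)"
  have x0: "0 < x0" using g by (simp add: x0_def)
  have "(1 + x) powr s \<le> (1 + \<eta>) * x powr s + (1 + x0) powr s" if x: "0 \<le> x" for x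
  proof (cases "x0 \<le> x")
    case True
    then have xp: "0 < x" using x0 by simp
    have "1 / x \<le> 1 / x0" using True x0 by (intro divide_left_mono) auto
    also have "1 / x0 = g - 1" by (simp add: x0_def)
    finally have "1 + x \<le> g * x" using xp by (simp add: field_simps)
    then have "(1 + x) powr s \<le> (g * x) powr s" using x s by (intro powr_mono2) auto
    also have "\<dots> = (1 + \<eta>) * x powr s"
      using g xp s \<eta> by (simp add: powr_mult) (simp add: g_def powr_powr)
    finally show ?thesis using powr_ge_zero[of "1 + x0" s] by linarith
  next
    case False
    then have "(1 + x) powr s \<le> (1 + x0) powr s" using x s by (intro powr_mono2) auto
    moreover have "0 \<le> (1 + \<eta>) * x powr s" using \<eta> by simp
    ultimately show ?thesis by linarith
  qed
  then show ?thesis by (intro exI[of _ "(1 + x0) powr s"]) auto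
qed

lemma cross_cong: "(\<And>j. j < k \<Longrightarrow> f j = g j) \<Longrightarrow> cross f k = cross g k"
  by (induction k) auto

lemma cross_mono: "(\<And>k. 0 \<le> f k) \<Longrightarrow> (\<And>k. f k \<le> g k) \<Longrightarrow> cross f k \<le> cross g k"
proof (induction k)
  case (Suc k)
  have "f k * (1 + cross f k) \<le> g k * (1 + cross g k)"
    using Suc order_trans[of 0 1 "cross f k"] cross_ge_1[of f k] order_trans[of 0 "f k" "g k"]
    by (intro mult_mono add_mono) auto
  then show ?case by simp
qed simp

text \<open>Only sites strictly left of \<open>a + int k\<close> enter, which makes the crossing
  time independent of the odds ratio at \<open>a + int k\<close>, the one met in the next recursion
  step.\<close>

lemma cross_window_cong:
  assumes "\<And>i. i \<in> {a..<a + int k} \<Longrightarrow> u i = v i" "j \<le> k"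
  shows "cross (\<lambda>j. u (a + int j)) j = cross (\<lambda>j. v (a + int j)) j"
  using assms by (intro cross_cong) auto

abbreviation env_space :: "(int \<Rightarrow> real) measure" where
  "env_space \<equiv> (\<Pi>\<^sub>M i\<in>(UNIV::int set). (borel :: real measure))"

lemma measurable_env_coord [measurable]: "(\<lambda>u. u i) \<in> env_space \<rightarrow>\<^sub>M borel"
  by (rule measurable_component_singleton) simp

lemma measurable_cross [measurable]: "(\<lambda>u. cross (\<lambda>j. u (a + int j)) k) \<in> borel_measurable env_space"
  by (induction k) (simp_all, measurable)

section \<open>Polynomial and truncated exponential moments of crossing times\<close>

context iid_odds
begin

abbreviation env :: "'s \<Rightarrow> int \<Rightarrow> real" where
  "env x \<equiv> \<lambda>i. e i x"

lemma measurable_env [measurable]: "env \<in> M \<rightarrow>\<^sub>M env_space"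
  by (rule measurable_PiM_single') (auto simp: space_PiM)

text \<open>The two functionals factor through the restrictions of the environment to
  \<open>J\<close> and to its complement, which are independent.\<close>

lemma nn_integral_indep_split:
  fixes H K :: "(int \<Rightarrow> real) \<Rightarrow> ennreal"
  assumes [measurable]: "H \<in> borel_measurable env_space" "K \<in> borel_measurable env_space"
    and H: "\<And>u v. (\<And>i. i \<in> J \<Longrightarrow> u i = v i) \<Longrightarrow> H u = H v"
    and K: "\<And>u v. (\<And>i. i \<notin> J \<Longrightarrow> u i = v i) \<Longrightarrow> K u = K v"
  shows "(\<integral>\<^sup>+x. H (env x) * K (env x) \<partial>M) = (\<integral>\<^sup>+x. H (env x) \<partial>M) * (\<integral>\<^sup>+x. K (env x) \<partial>M)"
proof -
  \<comment> \<open>Padding with 0 turns a restricted environment into a full one, so that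
    \<open>H\<close> and \<open>K\<close> become functions of the restrictions.\<close>
  define ext where "ext A u = (\<lambda>i. if i \<in> A then u i else (0::real))" for A :: "int set" and u
  have ext_meas: "ext A \<in> (\<Pi>\<^sub>M i\<in>A. borel) \<rightarrow>\<^sub>M env_space" for A
  proof (rule measurable_PiM_single')
    show "(\<lambda>u. ext A u i) \<in> (\<Pi>\<^sub>M i\<in>A. borel) \<rightarrow>\<^sub>M borel" for i
      by (cases "i \<in> A") (auto simp: ext_def intro!: measurable_component_singleton)
  qed (auto simp: ext_def)
  let ?X = "\<lambda>A x. restrict (env x) A"
  have "indep_var (PiM J (\<lambda>_. borel)) (?X J) (PiM (- J) (\<lambda>_. borel)) (?X (- J))"
    by (intro indep_var_restrict[OF indep]) auto
  then have iv: "indep_var borel ((H \<circ> ext J) \<circ> ?X J) borel ((K \<circ> ext (- J)) \<circ> ?X (- J))"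
    by (rule indep_var_compose) (auto simp: comp_def intro!: measurable_compose[OF ext_meas])
  have H_eq: "(H \<circ> ext J) \<circ> ?X J = (\<lambda>x. H (env x))"
    by (auto simp: fun_eq_iff ext_def intro!: H)
  have K_eq: "(K \<circ> ext (- J)) \<circ> ?X (- J) = (\<lambda>x. K (env x))"
    by (auto simp: fun_eq_iff ext_def intro!: K)
  have "indep_vars (\<lambda>_. borel) (case_bool (\<lambda>x. H (env x)) (\<lambda>x. K (env x))) UNIV"
  proof -
    have "case_bool borel borel = (\<lambda>_. borel :: ennreal measure)" by (auto simp: fun_eq_iff split: bool.split)
    then show ?thesis using iv unfolding H_eq K_eq indep_var_def by simp
  qed
  from indep_vars_nn_integral[OF _ this] show ?thesis by (simp add: UNIV_bool mult.commute)
qed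

text \<open>Mean time from site \<open>a + k - 1\<close> to \<open>a + k\<close> for the walk
  reflected at \<open>a - 1\<close>.\<close>

abbreviation U :: "int \<Rightarrow> nat \<Rightarrow> 's \<Rightarrow> real" where
  "U a k x \<equiv> cross (\<lambda>j. e (a + int j) x) k"

lemma U_meas [measurable]: "U a k \<in> borel_measurable M"
  using measurable_compose[OF measurable_env measurable_cross] by simp

lemma U_ge_1: "x \<in> space M \<Longrightarrow> 1 \<le> U a k x"
  by (intro cross_ge_1 e_nonneg)

text \<open>The recursion multiplies the previous value by an independent factor whose
  \<open>s\<close>-th moment is below 1, so the \<open>s\<close>-th moments obey an affine
  contraction, uniformly in the window.\<close>

lemma U_moment_bound:
  assumes s: "0 < s" "s < \<kappa>"
  shows "\<exists>C>0. \<forall>a k. (\<integral>\<^sup>+x. ennreal (U a k x powr s) \<partial>M) \<le> ennreal C"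
proof -
  define r where "r = mom s"
  have r: "0 < r" "r < 1" using mom_pos[of s] mom_less_1[of s] s by (auto simp: r_def)
  \<comment> \<open>The inequality for \<open>(1 + x) powr s\<close> is used twice, at the cost of a
    factor \<open>1 + \<eta>\<close> each time; this choice keeps the product \<open>q\<close> at
    most \<open>1 - (1 - r)\<^sup>2\<close>.\<close>
  define \<eta> where "\<eta> = (1 - r) / 3"
  have \<eta>: "0 < \<eta>" "\<eta> \<le> 1 / 3" using r by (auto simp: \<eta>_def)
  define q where "q = (1 + \<eta>) * (1 + \<eta>) * r"
  have q: "0 < q" "q < 1"
  proof -
    have "\<eta> * \<eta> \<le> \<eta> * (1 / 3)" using \<eta> by (intro mult_left_mono) auto
    then have "(1 + \<eta>) * (1 + \<eta>) \<le> 1 + 3 * \<eta>" using \<eta> by (simp add: algebra_simps)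
    then have "q \<le> (1 + 3 * \<eta>) * r" unfolding q_def using r by (intro mult_right_mono) auto
    also have "\<dots> = (2 - r) * r" by (simp add: \<eta>_def)
    also have "\<dots> = 1 - (1 - r)\<^sup>2" by (simp add: power2_eq_square algebra_simps)
    also have "\<dots> < 1" using r by simp
    finally show "q < 1" .
    show "0 < q" using \<eta> r by (simp add: q_def)
  qed
  obtain C1 where C1: "0 \<le> C1" "\<And>x. 0 \<le> x \<Longrightarrow> (1 + x) powr s \<le> (1 + \<eta>) * x powr s + C1"
    using one_plus_powr_le[OF s(1) \<eta>(1)] by blast
  define D where "D = (1 + \<eta>) * C1 * r + C1"
  \<comment> \<open>Large enough to cover the initial value 1 and to be preserved by the recursion
    with factor \<open>q\<close> and offset \<open>D\<close>.\<close>
  define C where "C = 1 + D / (1 - q)"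
  have D: "0 \<le> D" using C1 \<eta> r by (simp add: D_def)
  have C: "0 < C" "1 \<le> C" "q * C + D \<le> C"
  proof -
    have "0 \<le> D / (1 - q)" using D q by simp
    then show "0 < C" "1 \<le> C" by (simp_all add: C_def)
    have "C - (q * C + D) = (1 - q) * C - D" by (simp add: algebra_simps)
    also have "\<dots> = 1 - q" using q by (simp add: C_def distrib_left)
    finally show "q * C + D \<le> C" using q by simp
  qed
  have "(\<integral>\<^sup>+x. ennreal (U a k x powr s) \<partial>M) \<le> ennreal C" for a k
  proof (induction k)
    case 0
    then show ?case using C by (simp add: emeasure_space_1)
  next
    case (Suc k)
    have "(\<integral>\<^sup>+x. ennreal (U a (Suc k) x powr s) \<partial>M) \<le>
        (\<integral>\<^sup>+x. ennreal ((1 + \<eta>) * (1 + \<eta>)) * (ennreal (U a k x powr s) * ennreal (e (a + int k) x powr s))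
          + ennreal ((1 + \<eta>) * C1) * ennreal (e (a + int k) x powr s) + ennreal C1 \<partial>M)"
    proof (rule nn_integral_mono)
      fix x assume x: "x \<in> space M"
      define \<rho> where "\<rho> = e (a + int k) x"
      define V where "V = U a k x"
      have \<rho>: "0 \<le> \<rho>" and V: "0 \<le> V" using e_nonneg[OF x] U_ge_1[OF x, of a k] by (auto simp: \<rho>_def V_def)
      have "U a (Suc k) x powr s = (1 + \<rho> * (1 + V)) powr s" by (simp add: \<rho>_def V_def)
      also have "\<dots> \<le> (1 + \<eta>) * (\<rho> * (1 + V)) powr s + C1" using \<rho> V by (intro C1) auto
      also have "(\<rho> * (1 + V)) powr s = \<rho> powr s * (1 + V) powr s" using \<rho> V by (simp add: powr_mult)
      also have "(1 + \<eta>) * (\<rho> powr s * (1 + V) powr s) \<le> (1 + \<eta>) * (\<rho> powr s * ((1 + \<eta>) * V powr s + C1))"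
        using \<eta> V by (intro mult_left_mono C1) auto
      finally have "U a (Suc k) x powr s \<le>
          ((1 + \<eta>) * (1 + \<eta>)) * (V powr s * \<rho> powr s) + ((1 + \<eta>) * C1) * \<rho> powr s + C1"
        by (simp add: algebra_simps)
      then have "ennreal (U a (Suc k) x powr s) \<le> ennreal \<dots>" by (rule ennreal_leI)
      also have "\<dots> = ennreal ((1 + \<eta>) * (1 + \<eta>)) * (ennreal (V powr s) * ennreal (\<rho> powr s))
          + ennreal ((1 + \<eta>) * C1) * ennreal (\<rho> powr s) + ennreal C1"
        using \<eta> C1 by (simp add: ennreal_plus ennreal_mult)
      finally show "ennreal (U a (Suc k) x powr s) \<le>
        ennreal ((1 + \<eta>) * (1 + \<eta>)) * (ennreal (U a k x powr s) * ennreal (e (a + int k) x powr s))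
          + ennreal ((1 + \<eta>) * C1) * ennreal (e (a + int k) x powr s) + ennreal C1"
        by (simp add: V_def \<rho>_def)
    qed
    also have "\<dots> = ennreal ((1 + \<eta>) * (1 + \<eta>)) * (\<integral>\<^sup>+x. ennreal (U a k x powr s) * ennreal (e (a + int k) x powr s) \<partial>M)
          + ennreal ((1 + \<eta>) * C1) * (\<integral>\<^sup>+x. ennreal (e (a + int k) x powr s) \<partial>M) + ennreal C1"
      by (simp add: nn_integral_add nn_integral_cmult emeasure_space_1)
    also have "(\<integral>\<^sup>+x. ennreal (U a k x powr s) * ennreal (e (a + int k) x powr s) \<partial>M) =
        (\<integral>\<^sup>+x. ennreal (U a k x powr s) \<partial>M) * (\<integral>\<^sup>+x. ennreal (e (a + int k) x powr s) \<partial>M)"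
    proof (rule nn_integral_indep_split[where J="{a..<a + int k}"
            and H="\<lambda>u. ennreal (cross (\<lambda>j. u (a + int j)) k powr s)" and K="\<lambda>u. ennreal (u (a + int k) powr s)"])
      fix u v :: "int \<Rightarrow> real" assume "\<And>i. i \<in> {a..<a + int k} \<Longrightarrow> u i = v i"
      then show "ennreal (cross (\<lambda>j. u (a + int j)) k powr s) = ennreal (cross (\<lambda>j. v (a + int j)) k powr s)"
        using cross_window_cong[of a k u v k] by simp
    qed auto
    also have "(\<integral>\<^sup>+x. ennreal (e (a + int k) x powr s) \<partial>M) = ennreal r"
      using s by (simp add: nn_integral_powr r_def)
    also have "ennreal ((1 + \<eta>) * (1 + \<eta>)) * ((\<integral>\<^sup>+x. ennreal (U a k x powr s) \<partial>M) * ennreal r) +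
        ennreal ((1 + \<eta>) * C1) * ennreal r + ennreal C1 \<le>
        ennreal ((1 + \<eta>) * (1 + \<eta>)) * (ennreal C * ennreal r) + ennreal ((1 + \<eta>) * C1) * ennreal r + ennreal C1"
      by (intro add_mono mult_left_mono mult_right_mono Suc.IH order_refl) auto
    also have "\<dots> = ennreal (q * C + D)"
      using \<eta> r C C1 by (simp add: ennreal_plus[symmetric] ennreal_mult'[symmetric] q_def D_def algebra_simps del: ennreal_plus)
    also have "\<dots> \<le> ennreal C" using C by (intro ennreal_leI) auto
    finally show ?case .
  qed
  then show ?thesis using C by blast
qed

text \<open>
  The proof adds \<open>c * U a k x powr \<theta>\<close> to the sum, where \<open>c\<close> is chosen so that the resulting
  exponential grows by at most a constant factor per step.
\<close>

lemma U_exp_bound: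
  assumes \<theta>: "0 < \<theta>" "\<theta> < \<kappa>" "\<theta> \<le> 1"
  shows "\<exists>C>0. \<exists>l>0. \<forall>a k. \<forall>L\<ge>1. (\<integral>\<^sup>+x. ennreal (exp (l / L powr \<theta> * (\<Sum>j\<le>k. U a j x powr \<theta>)) *
     of_bool (\<forall>j\<le>k. U a j x \<le> L)) \<partial>M) \<le> ennreal (exp (l / L powr \<theta> * C * real (Suc k)))"
proof -
  define r where "r = mom \<theta>"
  have r: "0 < r" "r < 1" using mom_pos[of \<theta>] mom_less_1[of \<theta>] \<theta> by (auto simp: r_def)
  define \<eta> where "\<eta> = 1 - r"
  define q where "q = (1 + \<eta>) * r"
  \<comment> \<open>Solution of \<open>q * (1 + c) = c\<close>: the extra weight \<open>c\<close> on
    the newest crossing time, together with its unit weight in the sum, passes to the weight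
    \<open>c\<close> on the previous one.\<close>
  define c where "c = q / (1 - q)"
  have \<eta>: "0 < \<eta>" "\<eta> \<le> 1" using r by (auto simp: \<eta>_def)
  have q: "0 < q" "q < 1"
  proof -
    show "0 < q" using \<eta> r by (simp add: q_def)
    have "q = 1 - (1 - r)\<^sup>2" by (simp add: q_def \<eta>_def power2_eq_square algebra_simps)
    then show "q < 1" using r by simp
  qed
  have c: "0 < c" "q * (1 + c) = c" using q by (auto simp: c_def field_simps)
  \<comment> \<open>While crossing times stay below \<open>L\<close>, this keeps the exponent
    \<open>y\<close> gained in one step at most \<open>\<eta>\<close>, so that
    \<open>exp y \<le> 1 + (1 + \<eta>) * y\<close>.\<close>
  define l where "l = \<eta> / (1 + c)"
  have l: "0 < l" using \<eta> c by (simp add: l_def)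
  define C where "C = (1 + \<eta>) * (1 + c) * (1 + r)"
  have C: "0 < C" "1 + c \<le> C"
  proof -
    have "1 * (1 + c) * 1 \<le> (1 + \<eta>) * (1 + c) * (1 + r)" using \<eta> c r by (intro mult_mono) auto
    then show "1 + c \<le> C" by (simp add: C_def)
    then show "0 < C" using c by simp
  qed
  have "(\<integral>\<^sup>+x. ennreal (exp (l / L powr \<theta> * (\<Sum>j\<le>k. U a j x powr \<theta>)) *
     of_bool (\<forall>j\<le>k. U a j x \<le> L)) \<partial>M) \<le> ennreal (exp (l / L powr \<theta> * C * real (Suc k)))"
    if L: "1 \<le> L" for a k L
  proof -
    define \<beta> where "\<beta> = l / L powr \<theta>"
    have L\<theta>: "0 < L powr \<theta>" using L by simp
    have \<beta>: "0 < \<beta>" using l L\<theta> by (simp add: \<beta>_def)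
    define \<alpha> where "\<alpha> = (1 + \<eta>) * (\<beta> * (1 + c))"
    have \<alpha>: "0 < \<alpha>" "\<alpha> * r = \<beta> * c" "\<alpha> * (1 + r) = \<beta> * C"
    proof -
      show "0 < \<alpha>" using \<eta> \<beta> c by (simp add: \<alpha>_def)
      have "\<alpha> * r = \<beta> * (q * (1 + c))" by (simp add: \<alpha>_def q_def mult_ac)
      then show "\<alpha> * r = \<beta> * c" by (simp add: c)
      show "\<alpha> * (1 + r) = \<beta> * C" by (simp add: \<alpha>_def C_def mult_ac)
    qed
    define A where "A k u = exp (\<beta> * (\<Sum>j\<le>k. cross (\<lambda>j. u (a + int j)) j powr \<theta>)) *
       of_bool (\<forall>j\<in>{..k}. cross (\<lambda>j. u (a + int j)) j \<le> L)" for k and u :: "int \<Rightarrow> real"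
    have A_meas [measurable]: "A k \<in> borel_measurable env_space" for k
      unfolding A_def by measurable
    have A0: "0 \<le> A k u" for k u by (simp add: A_def)
    have A_cong: "A k u = A k v" if "\<And>i. i \<in> {a..<a + int k} \<Longrightarrow> u i = v i" for k u v
    proof -
      have c: "cross (\<lambda>j. u (a + int j)) j = cross (\<lambda>j. v (a + int j)) j" if "j \<in> {..k}" for j
        using cross_window_cong[OF \<open>\<And>i. i \<in> {a..<a + int k} \<Longrightarrow> u i = v i\<close>, of a k "\<lambda>i. i" j] that by simp
      then have "(\<Sum>j\<le>k. cross (\<lambda>j. u (a + int j)) j powr \<theta>) = (\<Sum>j\<le>k. cross (\<lambda>j. v (a + int j)) j powr \<theta>)"
        by (intro sum.cong refl) simp
      with c show ?thesis by (simp add: A_def)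
    qed
    have main: "(\<integral>\<^sup>+x. ennreal (A k (env x)) * ennreal (exp (\<beta> * c * U a k x powr \<theta>)) \<partial>M) \<le>
       ennreal (exp (\<beta> * C * real (Suc k)))" for k
    proof (induction k)
      case 0
      have "A 0 u \<le> exp \<beta>" for u using \<beta> by (auto simp: A_def)
      then have "(\<integral>\<^sup>+x. ennreal (A 0 (env x)) * ennreal (exp (\<beta> * c * U a 0 x powr \<theta>)) \<partial>M) \<le>
          (\<integral>\<^sup>+x. ennreal (exp \<beta>) * ennreal (exp (\<beta> * c)) \<partial>M)"
        by (intro nn_integral_mono mult_mono ennreal_leI) auto
      also have "\<dots> = ennreal (exp (\<beta> * (1 + c)))"
        by (simp add: emeasure_space_1 ennreal_mult'[symmetric] exp_add[symmetric] algebra_simps)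
      also have "\<dots> \<le> ennreal (exp (\<beta> * C * real (Suc 0)))" using C \<beta> by (intro ennreal_leI) simp
      finally show ?case .
    next
      case (Suc k)
      have "(\<integral>\<^sup>+x. ennreal (A (Suc k) (env x)) * ennreal (exp (\<beta> * c * U a (Suc k) x powr \<theta>)) \<partial>M) \<le>
        (\<integral>\<^sup>+x. ennreal (1 + \<alpha>) * ennreal (A k (env x)) +
          ennreal \<alpha> * ((ennreal (A k (env x)) * ennreal (1 + U a k x powr \<theta>)) * ennreal (e (a + int k) x powr \<theta>)) \<partial>M)"
      proof (rule nn_integral_mono)
        fix x assume x: "x \<in> space M"
        define \<rho> where "\<rho> = e (a + int k) x"
        define V where "V = U a k x"
        define W where "W = U a (Suc k) x"
        have \<rho>: "0 \<le> \<rho>" and V: "1 \<le> V" and W: "1 \<le> W"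
          using e_nonneg[OF x] U_ge_1[OF x, of a k] U_ge_1[OF x, of a "Suc k"] by (auto simp: \<rho>_def V_def W_def)
        have W_eq: "W = 1 + \<rho> * (1 + V)" by (simp add: W_def V_def \<rho>_def)
        have W\<theta>: "W powr \<theta> \<le> 1 + \<rho> powr \<theta> * (1 + V powr \<theta>)"
        proof -
          have "W powr \<theta> \<le> 1 powr \<theta> + (\<rho> * (1 + V)) powr \<theta>"
            unfolding W_eq using \<rho> V \<theta> by (intro powr_add_le_add_powr) auto
          also have "(\<rho> * (1 + V)) powr \<theta> = \<rho> powr \<theta> * (1 + V) powr \<theta>" using \<rho> V by (simp add: powr_mult)
          also have "(1 + V) powr \<theta> \<le> 1 powr \<theta> + V powr \<theta>"
            using V \<theta> by (intro powr_add_le_add_powr) auto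
          finally show ?thesis using \<rho> by (simp add: mult_left_mono)
        qed
        have A_Suc: "A (Suc k) (env x) = A k (env x) * exp (\<beta> * W powr \<theta>) * of_bool (W \<le> L)"
          by (auto simp: A_def W_def atMost_Suc exp_add distrib_left mult_ac simp del: cross.simps)
        have "A (Suc k) (env x) * exp (\<beta> * c * W powr \<theta>) \<le>
          A k (env x) * (1 + \<alpha> * (1 + \<rho> powr \<theta> * (1 + V powr \<theta>)))"
        proof (cases "W \<le> L")
          case True
          define y where "y = \<beta> * (1 + c) * W powr \<theta>"
          have "y \<le> \<beta> * (1 + c) * L powr \<theta>"
            unfolding y_def using True W \<theta> \<beta> c by (intro mult_left_mono powr_mono2) auto
          also have "\<dots> = \<eta>" using L\<theta> c by (simp add: \<beta>_def l_def)
          finally have y: "0 \<le> y" "y \<le> \<eta>" using \<beta> c by (auto simp: y_def)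
          have "A (Suc k) (env x) * exp (\<beta> * c * W powr \<theta>) = A k (env x) * exp y"
            using True by (simp add: A_Suc y_def exp_add[symmetric] algebra_simps)
          also have "exp y \<le> 1 + y + y\<^sup>2" using y \<eta> by (intro exp_bound) auto
          also have "y\<^sup>2 \<le> \<eta> * y" unfolding power2_eq_square using y by (intro mult_right_mono) auto
          also have "1 + y + \<eta> * y = 1 + \<alpha> * W powr \<theta>" by (simp add: \<alpha>_def y_def algebra_simps)
          also have "\<alpha> * W powr \<theta> \<le> \<alpha> * (1 + \<rho> powr \<theta> * (1 + V powr \<theta>))"
            using \<alpha> W\<theta> by (intro mult_left_mono) auto
          finally show ?thesis using A0 by (simp add: mult_left_mono)
        next
          case False
          then have "A (Suc k) (env x) = 0" by (simp add: A_Suc)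
          then show ?thesis using A0 \<alpha> by simp
        qed
        then have "ennreal (A (Suc k) (env x) * exp (\<beta> * c * W powr \<theta>)) \<le>
          ennreal ((1 + \<alpha>) * A k (env x) + \<alpha> * ((A k (env x) * (1 + V powr \<theta>)) * \<rho> powr \<theta>))"
          by (intro ennreal_leI) (simp add: algebra_simps)
        also have "\<dots> = ennreal (1 + \<alpha>) * ennreal (A k (env x)) +
          ennreal \<alpha> * ((ennreal (A k (env x)) * ennreal (1 + V powr \<theta>)) * ennreal (\<rho> powr \<theta>))"
          using less_imp_le[OF \<alpha>(1)] A0[of k "env x"] by (simp add: ennreal_mult)
        finally show "ennreal (A (Suc k) (env x)) * ennreal (exp (\<beta> * c * U a (Suc k) x powr \<theta>)) \<le>
          ennreal (1 + \<alpha>) * ennreal (A k (env x)) +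
          ennreal \<alpha> * ((ennreal (A k (env x)) * ennreal (1 + U a k x powr \<theta>)) * ennreal (e (a + int k) x powr \<theta>))"
          using A0 by (simp add: V_def \<rho>_def W_def ennreal_mult)
      qed
      also have "\<dots> = ennreal (1 + \<alpha>) * (\<integral>\<^sup>+x. ennreal (A k (env x)) \<partial>M) +
          ennreal \<alpha> * (\<integral>\<^sup>+x. (ennreal (A k (env x)) * ennreal (1 + U a k x powr \<theta>)) * ennreal (e (a + int k) x powr \<theta>) \<partial>M)"
        by (subst nn_integral_add) (auto simp: nn_integral_cmult)
      \<comment> \<open>\<open>A k\<close> and \<open>U a k\<close> involve only sites left of
        \<open>a + k\<close>, so the fresh odds ratio averages out to
        \<open>r = mom \<theta>\<close>.\<close>
      also have "(\<integral>\<^sup>+x. (ennreal (A k (env x)) * ennreal (1 + U a k x powr \<theta>)) * ennreal (e (a + int k) x powr \<theta>) \<partial>M) =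
          (\<integral>\<^sup>+x. ennreal (A k (env x)) * ennreal (1 + U a k x powr \<theta>) \<partial>M) * (\<integral>\<^sup>+x. ennreal (e (a + int k) x powr \<theta>) \<partial>M)"
      proof (rule nn_integral_indep_split[where J="{a..<a + int k}"
            and H="\<lambda>u. ennreal (A k u) * ennreal (1 + cross (\<lambda>j. u (a + int j)) k powr \<theta>)"
            and K="\<lambda>u. ennreal (u (a + int k) powr \<theta>)"])
        fix u v :: "int \<Rightarrow> real" assume "\<And>i. i \<in> {a..<a + int k} \<Longrightarrow> u i = v i"
        then have "A k u = A k v" "cross (\<lambda>j. u (a + int j)) k = cross (\<lambda>j. v (a + int j)) k"
          using A_cong[of k u v] cross_window_cong[of a k u v k] by auto
        then show "ennreal (A k u) * ennreal (1 + cross (\<lambda>j. u (a + int j)) k powr \<theta>) =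
          ennreal (A k v) * ennreal (1 + cross (\<lambda>j. v (a + int j)) k powr \<theta>)" by simp
      qed auto
      also have "(\<integral>\<^sup>+x. ennreal (e (a + int k) x powr \<theta>) \<partial>M) = ennreal r"
        using \<theta> by (simp add: nn_integral_powr r_def)
      also have "ennreal (1 + \<alpha>) * (\<integral>\<^sup>+x. ennreal (A k (env x)) \<partial>M) +
          ennreal \<alpha> * ((\<integral>\<^sup>+x. ennreal (A k (env x)) * ennreal (1 + U a k x powr \<theta>) \<partial>M) * ennreal r) =
          (\<integral>\<^sup>+x. ennreal (1 + \<alpha>) * ennreal (A k (env x)) +
            ennreal (\<alpha> * r) * (ennreal (A k (env x)) * ennreal (1 + U a k x powr \<theta>)) \<partial>M)"
      proof -
        have "ennreal (\<alpha> * r) = ennreal \<alpha> * ennreal r" using \<alpha>(1) r by (simp add: ennreal_mult)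
        then show ?thesis by (subst nn_integral_add) (auto simp: nn_integral_cmult mult_ac)
      qed
      also have "\<dots> \<le> (\<integral>\<^sup>+x. ennreal (exp (\<beta> * C)) * (ennreal (A k (env x)) * ennreal (exp (\<beta> * c * U a k x powr \<theta>))) \<partial>M)"
      proof (rule nn_integral_mono)
        fix x assume x: "x \<in> space M"
        define V where "V = U a k x"
        \<comment> \<open>The linear bound becomes an exponential again through
          \<open>1 + z \<le> exp z\<close>; by the identities for \<open>\<alpha>\<close> the weight
          on the crossing time is \<open>\<beta> * c\<close> as before, at the price of a factor
          \<open>exp (\<beta> * C)\<close>.\<close>
        have "(1 + \<alpha>) + (\<alpha> * r) * (1 + V powr \<theta>) = 1 + (\<alpha> * (1 + r) + (\<alpha> * r) * V powr \<theta>)" by (simp add: algebra_simps)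
        also have "\<dots> \<le> exp (\<alpha> * (1 + r) + (\<alpha> * r) * V powr \<theta>)" by (rule exp_ge_add_one_self)
        also have "\<dots> = exp (\<beta> * C) * exp (\<beta> * c * V powr \<theta>)" unfolding \<alpha> by (simp add: exp_add)
        finally have "A k (env x) * ((1 + \<alpha>) + (\<alpha> * r) * (1 + V powr \<theta>)) \<le>
          A k (env x) * (exp (\<beta> * C) * exp (\<beta> * c * V powr \<theta>))" using A0 by (intro mult_left_mono)
        then have "ennreal ((1 + \<alpha>) * A k (env x) + (\<alpha> * r) * (A k (env x) * (1 + V powr \<theta>))) \<le>
          ennreal (exp (\<beta> * C) * (A k (env x) * exp (\<beta> * c * V powr \<theta>)))"
          by (intro ennreal_leI) (simp add: algebra_simps)
        moreover have "0 \<le> \<alpha> * r" "0 \<le> 1 + \<alpha>" using \<alpha>(1) r by auto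
        ultimately show "ennreal (1 + \<alpha>) * ennreal (A k (env x)) +
            ennreal (\<alpha> * r) * (ennreal (A k (env x)) * ennreal (1 + U a k x powr \<theta>)) \<le>
            ennreal (exp (\<beta> * C)) * (ennreal (A k (env x)) * ennreal (exp (\<beta> * c * U a k x powr \<theta>)))"
          unfolding V_def using A0[of k "env x"] by (simp add: ennreal_mult del: \<alpha>)
      qed
      also have "\<dots> = ennreal (exp (\<beta> * C)) * (\<integral>\<^sup>+x. ennreal (A k (env x)) * ennreal (exp (\<beta> * c * U a k x powr \<theta>)) \<partial>M)"
        by (rule nn_integral_cmult) measurable
      also have "\<dots> \<le> ennreal (exp (\<beta> * C)) * ennreal (exp (\<beta> * C * real (Suc k)))"
        by (intro mult_left_mono Suc.IH) auto
      also have "\<dots> = ennreal (exp (\<beta> * C * real (Suc (Suc k))))"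
        by (simp add: ennreal_mult'[symmetric] exp_add[symmetric] algebra_simps)
      finally show ?case .
    qed
    have "(\<integral>\<^sup>+x. ennreal (exp (l / L powr \<theta> * (\<Sum>j\<le>k. U a j x powr \<theta>)) *
       of_bool (\<forall>j\<le>k. U a j x \<le> L)) \<partial>M) = (\<integral>\<^sup>+x. ennreal (A k (env x)) \<partial>M)"
      by (simp add: A_def \<beta>_def Ball_def)
    also have "\<dots> \<le> (\<integral>\<^sup>+x. ennreal (A k (env x)) * ennreal (exp (\<beta> * c * U a k x powr \<theta>)) \<partial>M)"
    proof (intro nn_integral_mono)
      fix x
      have "A k (env x) * 1 \<le> A k (env x) * exp (\<beta> * c * U a k x powr \<theta>)"
        using A0 \<beta> c by (intro mult_left_mono) auto
      then show "ennreal (A k (env x)) \<le> ennreal (A k (env x)) * ennreal (exp (\<beta> * c * U a k x powr \<theta>))"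
        using A0 by (simp add: ennreal_mult'[symmetric] ennreal_leI)
    qed
    also note main[of k]
    finally show ?thesis by (simp add: \<beta>_def)
  qed
  then show ?thesis using C l by blast
qed

end

section \<open>Annealed upper bound\<close>

lemma odds_prod_mono:
  assumes "\<And>i. 0 \<le> e' i" "\<And>i. e' i \<le> e i"
  shows "odds_prod e' a j \<le> odds_prod e a j"
  unfolding odds_prod_def using assms by (intro prod_mono) auto

lemma scale_sum_mono:
  assumes "\<And>i. 0 \<le> e' i" "\<And>i. e' i \<le> e i"
  shows "scale_sum e' a N x \<le> scale_sum e a N x"
  unfolding scale_sum_def using assms by (intro sum_mono odds_prod_mono)

text \<open>All error terms increase with the odds ratios, so the environment \<open>e\<close>
  controls every walk with smaller odds, reflected ones included. As a probability is at most 1,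
  each scale term may be truncated at 1, which later makes fractional moments sufficient.\<close>

lemma quenched_upper:
  fixes e e' :: "int \<Rightarrow> real" and m n :: nat
  assumes e: "\<And>i. 0 \<le> e' i" "\<And>i. e' i \<le> e i" and m: "1 \<le> m" and y: "1 \<le> y"
  defines "A \<equiv> (\<Sum>k<3 * m. cross (\<lambda>k. e (1 - int m + int k)) k)"
  shows "measure (quenched_law (\<lambda>i. 1 / (1 + e' i))) {X. X n < int m} \<le>
    of_bool (y < A) + 2 * (1 - 1 / (2 * y)) ^ n + min 1 (scale_sum e (- int m) (2 * int m) 0)
     + min 1 (scale_sum e (int m) (2 * int m + int n) (2 * int m))"
proof -
  define A' where "A' = (\<Sum>k<3 * m. cross (\<lambda>k. e' (1 - int m + int k)) k)"
  have e0: "0 \<le> e i" for i using order_trans[OF e] .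
  have "A' \<le> A" unfolding A_def A'_def using e by (intro sum_mono cross_mono)
  have A': "1 \<le> A'"
  proof -
    have c: "1 \<le> cross (\<lambda>k. e' (1 - int m + int k)) k" for k by (intro cross_ge_1 e)
    have "cross (\<lambda>k. e' (1 - int m + int k)) 0 \<le> A'" unfolding A'_def using m
      by (intro member_le_sum) (auto intro: order_trans[OF _ c])
    then show ?thesis by simp
  qed
  define v where "v = measure (quenched_law (\<lambda>i. 1 / (1 + e' i))) {X. X n < int m}"
  define G where "G = scale_sum e (- int m) (2 * int m) 0"
  define B where "B = scale_sum e (int m) (2 * int m + int n) (2 * int m)"
  have GB: "0 \<le> G" "0 \<le> B" unfolding G_def B_def by (intro scale_sum_nonneg e0)+
  have v1: "v \<le> 1" unfolding v_def
    using prob_space.prob_le_1[OF prob_space_quenched_law] by blast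
  have v: "v \<le> 2 * (1 - 1 / (2 * A')) ^ n + G + B"
  proof -
    have "v = (walk_gen (\<lambda>i. 1 / (1 + e' i)) ^^ n) (\<lambda>x. of_bool (x < int m)) 0"
      unfolding v_def using step_prob_bounds[of e' "\<lambda>i. 1 / (1 + e' i)"] e by (intro quenched_position_prob) auto
    also have "\<dots> \<le> 2 * (1 - 1 / (2 * A')) ^ n + scale_sum e' (- int m) (2 * int m) 0 +
        scale_sum e' (int m) (2 * int m + int n) (2 * int m)"
      using walk_gen_funpow_upper[of e' m n] e m unfolding A'_def by (simp add: algebra_simps)
    also have "\<dots> \<le> 2 * (1 - 1 / (2 * A')) ^ n + G + B"
      unfolding G_def B_def using e by (intro add_mono scale_sum_mono order_refl)
    finally show ?thesis .
  qed
  have "0 \<le> 1 - 1 / (2 * y)" using y by (simp add: field_simps)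
  then have q0: "0 \<le> (1 - 1 / (2 * y)) ^ n" by simp
  have q: "(1 - 1 / (2 * A')) ^ n \<le> (1 - 1 / (2 * y)) ^ n" if "A \<le> y"
  proof (rule power_mono)
    have "1 / (2 * y) \<le> 1 / (2 * A')" using that \<open>A' \<le> A\<close> A' by (intro divide_left_mono) auto
    then show "1 - 1 / (2 * A') \<le> 1 - 1 / (2 * y)" by simp
    show "0 \<le> 1 - 1 / (2 * A')" using A' by (simp add: field_simps)
  qed
  have "v \<le> of_bool (y < A) + 2 * (1 - 1 / (2 * y)) ^ n + min 1 G + min 1 B"
  proof (cases "y < A \<or> 1 \<le> G \<or> 1 \<le> B")
    case True
    then show ?thesis using v1 q0 GB by (auto simp: min_def)
  next
    case False
    then show ?thesis using v q by (simp add: min_def)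
  qed
  then show ?thesis by (simp add: v_def G_def B_def)
qed

lemma geometric_sum_int_le:
  fixes r :: real
  assumes r: "0 \<le> r" "r < 1" and "a \<le> y"
  shows "(\<Sum>j\<in>{y..N}. r ^ nat (j - a)) \<le> r ^ nat (y - a) / (1 - r)"
proof -
  have "(\<Sum>j\<in>{y..N}. r ^ nat (j - a)) = (\<Sum>k<nat (N + 1 - y). r ^ nat (y - a) * r ^ k)"
    using \<open>a \<le> y\<close> by (intro sum.reindex_bij_witness[of _ "\<lambda>k. y + int k" "\<lambda>j. nat (j - y)"])
      (auto simp: power_add[symmetric] nat_add_distrib[symmetric] intro!: arg_cong[where f="\<lambda>k. r ^ k"])
  also have "\<dots> = r ^ nat (y - a) * (\<Sum>k<nat (N + 1 - y). r ^ k)" by (simp add: sum_distrib_left)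
  also have "(\<Sum>k<nat (N + 1 - y). r ^ k) \<le> 1 / (1 - r)"
    using r by (simp add: sum_gp_strict divide_right_mono)
  finally show ?thesis using r by (simp add: mult_left_mono)
qed

context iid_odds
begin

lemma odds_prod_meas [measurable]: "(\<lambda>x. odds_prod (env x) a j) \<in> borel_measurable M"
  unfolding odds_prod_def by measurable

lemma scale_sum_meas [measurable]: "(\<lambda>x. scale_sum (env x) a N y) \<in> borel_measurable M"
  unfolding scale_sum_def by measurable

text \<open>First moments may be too large, but \<open>min 1 S \<le> S powr s\<close> for
  \<open>s \<le> 1\<close>, and such powers are subadditive; each summand then contributes
  \<open>mom s\<close> to the number of its factors, a geometric series.\<close>

lemma nn_integral_scale_sum:
  assumes s: "0 < s" "s < \<kappa>" "s \<le> 1" and a: "a \<le> y"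
  shows "(\<integral>\<^sup>+x. ennreal (min 1 (scale_sum (env x) a N y)) \<partial>M) \<le>
    ennreal (mom s ^ nat (y - a) / (1 - mom s))"
proof -
  have r: "0 \<le> mom s" "mom s < 1" using mom_nonneg[of s] mom_less_1[of s] s by auto
  have "(\<integral>\<^sup>+x. ennreal (min 1 (scale_sum (env x) a N y)) \<partial>M) \<le>
    (\<integral>\<^sup>+x. (\<Sum>j\<in>{y..N}. ennreal ((\<Prod>i\<in>{a<..j}. e i x) powr s)) \<partial>M)"
  proof (rule nn_integral_mono)
    fix x assume x: "x \<in> space M"
    define S where "S = scale_sum (env x) a N y"
    have S0: "0 \<le> S" unfolding S_def by (intro scale_sum_nonneg e_nonneg x)
    have "min 1 S \<le> S powr s"
    proof (cases "1 \<le> S")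
      case True
      then show ?thesis using s ge_one_powr_ge_zero[of S s] by simp
    next
      case False
      then have "S powr 1 \<le> S powr s" using S0 s by (intro powr_mono') auto
      then show ?thesis using S0 by simp
    qed
    also have "S powr s \<le> (\<Sum>j\<in>{y..N}. odds_prod (env x) a j powr s)"
      unfolding S_def scale_sum_def using s x
      by (intro powr_sum_le_sum_powr odds_prod_nonneg e_nonneg) auto
    finally have "ennreal (min 1 S) \<le> ennreal (\<Sum>j\<in>{y..N}. odds_prod (env x) a j powr s)" by (rule ennreal_leI)
    then show "ennreal (min 1 (scale_sum (env x) a N y)) \<le>
        (\<Sum>j\<in>{y..N}. ennreal ((\<Prod>i\<in>{a<..j}. e i x) powr s))"
      by (simp add: S_def odds_prod_def)
  qed
  also have "\<dots> = (\<Sum>j\<in>{y..N}. ennreal (mom s ^ nat (j - a)))"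
    using s a by (subst nn_integral_sum) (auto simp: nn_integral_prod_powr)
  also have "\<dots> = ennreal (\<Sum>j\<in>{y..N}. mom s ^ nat (j - a))"
    using r by (intro sum_ennreal) auto
  also have "\<dots> \<le> ennreal (mom s ^ nat (y - a) / (1 - mom s))"
    by (intro ennreal_leI geometric_sum_int_le r a)
  finally show ?thesis .
qed

text \<open>Either some crossing time exceeds \<open>L\<close>, treated by Markov's inequality for
  the \<open>s\<close>-th moment and a union bound, or none does, treated by the truncated
  exponential moment. Subadditivity of \<open>\<theta>\<close>-th powers carries the latter over to
  the sum.\<close>

lemma cross_sum_tail:
  assumes \<theta>: "0 < \<theta>" "\<theta> < \<kappa>" "\<theta> \<le> 1" and s: "0 < s" "s < \<kappa>"
  shows "\<exists>C>0. \<exists>l>0. \<forall>a. \<forall>N\<ge>1. \<forall>L\<ge>1. \<forall>y>0.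
    prob {x \<in> space M. y < (\<Sum>j<N. U a j x)} \<le>
      C * real N * L powr (- s) + exp (l * L powr (- \<theta>) * (C * real N - y powr \<theta>))"
proof -
  obtain C1 where C1: "0 < C1" "\<And>a k. (\<integral>\<^sup>+x. ennreal (U a k x powr s) \<partial>M) \<le> ennreal C1"
    using U_moment_bound[OF s] by blast
  obtain C2 l where C2: "0 < C2" "0 < l"
    "\<And>a k L. 1 \<le> L \<Longrightarrow> (\<integral>\<^sup>+x. ennreal (exp (l / L powr \<theta> * (\<Sum>j\<le>k. U a j x powr \<theta>)) *
     of_bool (\<forall>j\<le>k. U a j x \<le> L)) \<partial>M) \<le> ennreal (exp (l / L powr \<theta> * C2 * real (Suc k)))"
    using U_exp_bound[OF \<theta>] by blast
  define C where "C = max C1 C2"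
  have "prob {x \<in> space M. y < (\<Sum>j<N. U a j x)} \<le>
      C * real N * L powr (- s) + exp (l * L powr (- \<theta>) * (C * real N - y powr \<theta>))"
    if N: "1 \<le> N" and L: "1 \<le> L" and y: "0 < y" for a N and L y :: real
  proof -
    define \<beta> where "\<beta> = l / L powr \<theta>"
    have \<beta>: "0 < \<beta>" "l * L powr (- \<theta>) = \<beta>"
      using C2 L by (simp_all add: \<beta>_def powr_minus_divide)
    define E1 where "E1 j = {x \<in> space M. L < U a j x}" for j
    define E2 where "E2 = {x \<in> space M. y < (\<Sum>j<N. U a j x) \<and> (\<forall>j\<in>{..<N}. U a j x \<le> L)}"
    have [measurable]: "E1 j \<in> sets M" for j unfolding E1_def by measurable
    have [measurable]: "E2 \<in> sets M" unfolding E2_def by measurable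
    have p1: "prob (E1 j) \<le> C1 * L powr (- s)" for j
    proof -
      have "ennreal (L powr s) * emeasure M (E1 j) = (\<integral>\<^sup>+x. ennreal (L powr s) * indicator (E1 j) x \<partial>M)"
        by (simp add: nn_integral_cmult_indicator)
      also have "\<dots> \<le> (\<integral>\<^sup>+x. ennreal (U a j x powr s) \<partial>M)"
        using L s by (intro nn_integral_mono) (auto simp: E1_def split: split_indicator intro!: ennreal_leI powr_mono2)
      also have "\<dots> \<le> ennreal C1" by (rule C1)
      finally have "ennreal (L powr s * prob (E1 j)) \<le> ennreal C1"
        by (simp add: emeasure_eq_measure ennreal_mult')
      then have "L powr s * prob (E1 j) \<le> C1" using C1 by (simp add: ennreal_le_iff)
      then show ?thesis using L by (simp add: powr_minus_divide field_simps)
    qed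
    have p2: "prob E2 \<le> exp (\<beta> * (C2 * real N - y powr \<theta>))"
    proof -
      obtain k where k: "N = Suc k" using N by (cases N) auto
      have "ennreal (exp (\<beta> * y powr \<theta>)) * emeasure M E2 = (\<integral>\<^sup>+x. ennreal (exp (\<beta> * y powr \<theta>)) * indicator E2 x \<partial>M)"
        by (simp add: nn_integral_cmult_indicator)
      also have "\<dots> \<le> (\<integral>\<^sup>+x. ennreal (exp (l / L powr \<theta> * (\<Sum>j\<le>k. U a j x powr \<theta>)) *
         of_bool (\<forall>j\<le>k. U a j x \<le> L)) \<partial>M)"
      proof (rule nn_integral_mono)
        fix x assume x: "x \<in> space M"
        show "ennreal (exp (\<beta> * y powr \<theta>)) * indicator E2 x \<le>
          ennreal (exp (l / L powr \<theta> * (\<Sum>j\<le>k. U a j x powr \<theta>)) * of_bool (\<forall>j\<le>k. U a j x \<le> L))"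
        proof (cases "x \<in> E2")
          case True
          then have E: "y < (\<Sum>j<N. U a j x)" "\<forall>j\<le>k. U a j x \<le> L" by (auto simp: E2_def k)
          have "y powr \<theta> \<le> (\<Sum>j<N. U a j x) powr \<theta>" using E y \<theta> by (intro powr_mono2) auto
          also have "\<dots> \<le> (\<Sum>j<N. U a j x powr \<theta>)"
            using \<theta> order_trans[OF zero_le_one U_ge_1[OF x]] by (intro powr_sum_le_sum_powr) auto
          finally have "\<beta> * y powr \<theta> \<le> \<beta> * (\<Sum>j\<le>k. U a j x powr \<theta>)"
            using \<beta> by (intro mult_left_mono) (auto simp: k lessThan_Suc_atMost)
          then show ?thesis using True E by (simp add: \<beta>_def ennreal_leI)
        qed simp
      qed
      also have "\<dots> \<le> ennreal (exp (\<beta> * C2 * real N))" unfolding \<beta>_def k by (rule C2(3)[OF L])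
      finally have "ennreal (exp (\<beta> * y powr \<theta>) * prob E2) \<le> ennreal (exp (\<beta> * C2 * real N))"
        by (simp add: emeasure_eq_measure ennreal_mult')
      then have "exp (\<beta> * y powr \<theta>) * prob E2 \<le> exp (\<beta> * C2 * real N)" by (simp add: ennreal_le_iff)
      then have "prob E2 \<le> exp (\<beta> * C2 * real N) / exp (\<beta> * y powr \<theta>)" by (simp add: field_simps)
      then show ?thesis by (simp add: exp_diff[symmetric] algebra_simps)
    qed
    have "prob {x \<in> space M. y < (\<Sum>j<N. U a j x)} \<le> prob ((\<Union>j\<in>{..<N}. E1 j) \<union> E2)"
      by (intro finite_measure_mono) (auto simp: E1_def E2_def not_le)
    also have "\<dots> \<le> prob (\<Union>j\<in>{..<N}. E1 j) + prob E2" by (rule measure_Un_le) auto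
    also have "prob (\<Union>j\<in>{..<N}. E1 j) \<le> (\<Sum>j\<in>{..<N}. prob (E1 j))"
      by (rule finite_measure_subadditive_finite) auto
    also have "\<dots> \<le> (\<Sum>j\<in>{..<N}. C1 * L powr (- s))" by (intro sum_mono p1)
    also have "\<dots> = C1 * real N * L powr (- s)" by simp
    also have "\<dots> \<le> C * real N * L powr (- s)" by (intro mult_right_mono) (auto simp: C_def)
    also have "prob E2 \<le> exp (\<beta> * (C * real N - y powr \<theta>))"
    proof -
      have "C2 * real N \<le> C * real N" by (intro mult_right_mono) (auto simp: C_def)
      then have "\<beta> * (C2 * real N - y powr \<theta>) \<le> \<beta> * (C * real N - y powr \<theta>)"
        using \<beta> by (intro mult_left_mono) auto
      then show ?thesis using p2 by (meson exp_le_cancel_iff order_trans)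
    qed
    finally show ?thesis unfolding \<beta> by simp
  qed
  moreover have "0 < C" using C1 by (simp add: C_def)
  ultimately show ?thesis using C2 by blast
qed

text \<open>Both scale terms start at distance \<open>m\<close> from their anchor, hence the two
  equal contributions with \<open>mom s ^ m\<close>.\<close>

lemma annealed_upper:
  assumes e': "\<And>i x. x \<in> space M \<Longrightarrow> 0 \<le> e' i x \<and> e' i x \<le> e i x"
    and m: "1 \<le> m" and y: "1 \<le> y" and s: "0 < s" "s < \<kappa>" "s \<le> 1"
  shows "(\<integral>\<^sup>+x. ennreal (measure (quenched_law (\<lambda>i. 1 / (1 + e' i x))) {X. X n < int m}) \<partial>M) \<le>
    ennreal (prob {x \<in> space M. y < (\<Sum>k<3 * m. U (1 - int m) k x)} + 2 * (1 - 1 / (2 * y)) ^ n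
      + 2 * (mom s ^ m / (1 - mom s)))"
proof -
  define E where "E = {x \<in> space M. y < (\<Sum>k<3 * m. U (1 - int m) k x)}"
  have [measurable]: "E \<in> sets M" unfolding E_def by measurable
  have y2: "0 \<le> 1 - 1 / (2 * y)" using y by (simp add: field_simps)
  have r: "0 \<le> mom s ^ m / (1 - mom s)" using mom_nonneg[of s] mom_less_1[of s] s by simp
  have "(\<integral>\<^sup>+x. ennreal (measure (quenched_law (\<lambda>i. 1 / (1 + e' i x))) {X. X n < int m}) \<partial>M) \<le>
    (\<integral>\<^sup>+x. indicator E x + ennreal (2 * (1 - 1 / (2 * y)) ^ n) +
      ennreal (min 1 (scale_sum (env x) (- int m) (2 * int m) 0)) +
      ennreal (min 1 (scale_sum (env x) (int m) (2 * int m + int n) (2 * int m))) \<partial>M)"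
  proof (rule nn_integral_mono)
    fix x assume x: "x \<in> space M"
    have "ennreal (measure (quenched_law (\<lambda>i. 1 / (1 + e' i x))) {X. X n < int m}) \<le>
      ennreal (of_bool (y < (\<Sum>k<3 * m. U (1 - int m) k x)) + 2 * (1 - 1 / (2 * y)) ^ n +
       min 1 (scale_sum (env x) (- int m) (2 * int m) 0)
     + min 1 (scale_sum (env x) (int m) (2 * int m + int n) (2 * int m)))"
      using e'[OF x] m y by (intro ennreal_leI quenched_upper) auto
    also have "\<dots> = indicator E x + ennreal (2 * (1 - 1 / (2 * y)) ^ n) +
      ennreal (min 1 (scale_sum (env x) (- int m) (2 * int m) 0)) +
      ennreal (min 1 (scale_sum (env x) (int m) (2 * int m + int n) (2 * int m)))"
      using y2 scale_sum_nonneg[of "env x", OF e_nonneg[OF x]] x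
      by (subst ennreal_plus | simp add: E_def del: ennreal_plus split: split_indicator)+
    finally show "ennreal (measure (quenched_law (\<lambda>i. 1 / (1 + e' i x))) {X. X n < int m}) \<le> \<dots>" .
  qed
  also have "\<dots> = emeasure M E + ennreal (2 * (1 - 1 / (2 * y)) ^ n) +
      (\<integral>\<^sup>+x. ennreal (min 1 (scale_sum (env x) (- int m) (2 * int m) 0)) \<partial>M) +
      (\<integral>\<^sup>+x. ennreal (min 1 (scale_sum (env x) (int m) (2 * int m + int n) (2 * int m))) \<partial>M)"
    by (simp add: nn_integral_add emeasure_space_1)
  also have "\<dots> \<le> ennreal (prob E) + ennreal (2 * (1 - 1 / (2 * y)) ^ n) +
    ennreal (mom s ^ nat (0 - (- int m)) / (1 - mom s)) + ennreal (mom s ^ nat (2 * int m - int m) / (1 - mom s))"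
    using s by (intro add_mono nn_integral_scale_sum order_refl) (auto simp: emeasure_eq_measure)
  also have "\<dots> = ennreal (prob E + 2 * (1 - 1 / (2 * y)) ^ n + 2 * (mom s ^ m / (1 - mom s)))"
    using y2 r by (simp add: ennreal_plus[symmetric] del: ennreal_plus)
  finally show ?thesis by (simp add: E_def)
qed

end

section \<open>Polynomial rates of the annealed probabilities\<close>

lemma eventually_exp_le_powr:
  fixes K c \<alpha> \<gamma> \<epsilon> :: real
  assumes "0 < c" "0 < \<alpha>" "0 < \<epsilon>" "0 < K"
  shows "\<forall>\<^sub>F n::nat in sequentially. K * exp (- (c * real n powr \<alpha>)) \<le> \<epsilon> * real n powr (- \<gamma>)"
  using assms by real_asymp

lemma eventually_powr_le_powr:
  fixes K \<beta> \<gamma> \<epsilon> :: real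
  assumes "\<gamma> < \<beta>" "0 < \<epsilon>" "0 < K"
  shows "\<forall>\<^sub>F n::nat in sequentially. K * real n powr (- \<beta>) \<le> \<epsilon> * real n powr (- \<gamma>)"
  using assms by real_asymp

context iid_odds
begin

text \<open>Truncation at \<open>L = n powr \<zeta>\<close> with \<open>\<zeta> < 1\<close> gives a
  union bound of order \<open>n powr (\<nu> - \<zeta> * s)\<close>, the price of one deep trap; the
  other terms are stretched exponentially small. The threshold for \<open>n\<close> is uniform in
  \<open>e'\<close>.\<close>

lemma annealed_upper_rate:
  assumes \<nu>: "0 < \<nu>" "\<nu> < min 1 \<kappa>" and \<gamma>: "\<gamma> < \<kappa> - \<nu>"
  shows "\<forall>\<^sub>F n in sequentially. \<forall>e'. (\<forall>x\<in>space M. \<forall>i. 0 \<le> e' i x \<and> e' i x \<le> e i x) \<longrightarrow>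
    (\<integral>\<^sup>+x. ennreal (measure (quenched_law (\<lambda>i. 1 / (1 + e' i x))) {X. X n < int (nat \<lceil>real n powr \<nu>\<rceil>)}) \<partial>M)
      \<le> ennreal (real n powr (- \<gamma>))"
proof -
  define \<theta> where "\<theta> = (\<nu> + min 1 \<kappa>) / 2"
  have \<theta>: "0 < \<theta>" "\<nu> < \<theta>" "\<theta> < \<kappa>" "\<theta> \<le> 1" using \<nu> by (auto simp: \<theta>_def)
  define s where "s = (max (\<gamma> + \<nu>) 0 + \<kappa>) / 2"
  have s: "0 < s" "\<gamma> + \<nu> < s" "s < \<kappa>" using \<gamma> \<kappa>_pos by (auto simp: s_def)
  \<comment> \<open>Collects the lower bounds on \<open>\<zeta>\<close>: the first gives
    \<open>\<gamma> < \<zeta> * s - \<nu>\<close> for the trap term, the second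
    \<open>\<nu> < \<zeta> * \<theta>\<close> for the exponential term.\<close>
  define v where "v = max (max ((\<gamma> + \<nu>) / s) (\<nu> / \<theta>)) 0"
  define \<zeta> where "\<zeta> = (v + 1) / 2"
  have \<zeta>_aux: "(\<gamma> + \<nu>) / s < 1" "\<nu> / \<theta> < 1" using s \<theta> by auto
  have \<zeta>: "0 < \<zeta>" "\<zeta> < 1" "(\<gamma> + \<nu>) / s < \<zeta>" "\<nu> / \<theta> < \<zeta>"
  proof -
    have v: "0 \<le> v" "v < 1" "(\<gamma> + \<nu>) / s \<le> v" "\<nu> / \<theta> \<le> v"
      using \<zeta>_aux by (auto simp: v_def le_max_iff_disj)
    show "0 < \<zeta>" "\<zeta> < 1" using v by (auto simp: \<zeta>_def)
    have "v < \<zeta>" using v by (simp add: \<zeta>_def)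
    then show "(\<gamma> + \<nu>) / s < \<zeta>" "\<nu> / \<theta> < \<zeta>" using v by (auto intro: le_less_trans)
  qed
  then have \<zeta>s: "\<gamma> < \<zeta> * s - \<nu>" and \<zeta>\<theta>: "\<nu> < \<zeta> * \<theta>"
    using s \<theta> by (auto simp: divide_less_eq)
  define r where "r = mom \<theta>"
  have r: "0 < r" "r < 1" using mom_pos[of \<theta>] mom_less_1[of \<theta>] \<theta> by (auto simp: r_def)
  obtain C l where C: "0 < C" "0 < l" "\<And>a N L y. 1 \<le> N \<Longrightarrow> 1 \<le> L \<Longrightarrow> 0 < y \<Longrightarrow>
    prob {x \<in> space M. y < (\<Sum>j<N. U a j x)} \<le>
      C * real N * L powr (- s) + exp (l * L powr (- \<theta>) * (C * real N - y powr \<theta>))"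
    using cross_sum_tail[OF \<theta>(1,3,4) s(1,3)] by blast
  have "\<forall>\<^sub>F n::nat in sequentially. 6 * C * real n powr (- (\<zeta> * s - \<nu>)) \<le> 1 / 4 * real n powr (- \<gamma>)"
    using \<zeta>s C by (intro eventually_powr_le_powr) auto
  moreover have "\<forall>\<^sub>F n::nat in sequentially. exp (6 * l * C) * exp (- (l * real n powr (\<theta> * (1 - \<zeta>) / 2)))
      \<le> 1 / 4 * real n powr (- \<gamma>)"
    using C \<theta> \<zeta> by (intro eventually_exp_le_powr) auto
  moreover have "\<forall>\<^sub>F n::nat in sequentially. 2 * exp (- (1 / 2 * real n powr ((1 - \<zeta>) / 2))) \<le> 1 / 4 * real n powr (- \<gamma>)"
    using \<zeta> by (intro eventually_exp_le_powr) auto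
  moreover have "\<forall>\<^sub>F n::nat in sequentially. 2 / (1 - r) * exp (- (- ln r * real n powr \<nu>)) \<le> 1 / 4 * real n powr (- \<gamma>)"
    using r \<nu> by (intro eventually_exp_le_powr) auto
  moreover have "\<forall>\<^sub>F n::nat in sequentially. 1 \<le> n" by (rule eventually_ge_at_top)
  ultimately show ?thesis
  proof eventually_elim
    case (elim n)
    define m where "m = nat \<lceil>real n powr \<nu>\<rceil>"
    have n: "1 \<le> real n" using elim by simp
    have n\<nu>: "1 \<le> real n powr \<nu>" using n \<nu> by (intro ge_one_powr_ge_zero) auto
    have m: "1 \<le> m" "real n powr \<nu> \<le> real m" "real m \<le> 2 * real n powr \<nu>"
      unfolding m_def using n\<nu> by linarith+
    define L where "L = real n powr \<zeta>"
    \<comment> \<open>Polynomially larger than \<open>L\<close>, so that the exponential bound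
      bites, and polynomially smaller than \<open>n\<close>, so that the geometric decay over
      \<open>n\<close> steps does.\<close>
    define y where "y = real n powr ((1 + \<zeta>) / 2)"
    have L: "1 \<le> L" unfolding L_def using n \<zeta> by (intro ge_one_powr_ge_zero) auto
    have y: "1 \<le> y" unfolding y_def using n \<zeta> by (intro ge_one_powr_ge_zero) auto
    have N: "C * real (3 * m) \<le> 6 * C * real n powr \<nu>" using m C by simp
    have T1: "C * real (3 * m) * L powr (- s) \<le> 1 / 4 * real n powr (- \<gamma>)"
    proof -
      have "C * real (3 * m) * L powr (- s) \<le> 6 * C * real n powr \<nu> * L powr (- s)"
        by (intro mult_right_mono N) auto
      also have "\<dots> = 6 * C * real n powr (- (\<zeta> * s - \<nu>))"
        by (simp add: L_def powr_powr powr_add[symmetric])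
      finally show ?thesis using elim by linarith
    qed
    have T2: "exp (l * L powr (- \<theta>) * (C * real (3 * m) - y powr \<theta>)) \<le> 1 / 4 * real n powr (- \<gamma>)"
    proof -
      have "l * L powr (- \<theta>) * (C * real (3 * m) - y powr \<theta>) \<le>
          l * L powr (- \<theta>) * (6 * C * real n powr \<nu> - y powr \<theta>)"
        using N C by (intro mult_left_mono diff_right_mono) auto
      also have "\<dots> = 6 * l * C * (L powr (- \<theta>) * real n powr \<nu>) - l * (L powr (- \<theta>) * y powr \<theta>)"
        by (simp add: algebra_simps)
      also have "L powr (- \<theta>) * real n powr \<nu> = real n powr (\<nu> - \<zeta> * \<theta>)"
        by (simp add: L_def powr_powr powr_add[symmetric])
      also have "L powr (- \<theta>) * y powr \<theta> = real n powr (\<theta> * (1 - \<zeta>) / 2)"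
      proof -
        have "\<zeta> * - \<theta> + (1 + \<zeta>) / 2 * \<theta> = \<theta> * (1 - \<zeta>) / 2" by (simp add: field_simps)
        then show ?thesis by (simp only: L_def y_def powr_powr powr_add[symmetric])
      qed
      also have "6 * l * C * real n powr (\<nu> - \<zeta> * \<theta>) \<le> 6 * l * C * 1"
      proof (intro mult_left_mono)
        have "real n powr (\<nu> - \<zeta> * \<theta>) \<le> real n powr 0" using n \<zeta>\<theta> by (intro powr_mono) auto
        then show "real n powr (\<nu> - \<zeta> * \<theta>) \<le> 1" using n by simp
      qed (use C in auto)
      finally have "exp (l * L powr (- \<theta>) * (C * real (3 * m) - y powr \<theta>)) \<le>
          exp (6 * l * C + - (l * real n powr (\<theta> * (1 - \<zeta>) / 2)))" by simp
      also have "\<dots> = exp (6 * l * C) * exp (- (l * real n powr (\<theta> * (1 - \<zeta>) / 2)))" by (rule exp_add)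
      finally show ?thesis using elim by linarith
    qed
    have T3: "2 * (1 - 1 / (2 * y)) ^ n \<le> 1 / 4 * real n powr (- \<gamma>)"
    proof -
      have "(1 - 1 / (2 * y)) ^ n \<le> exp (- (1 / (2 * y))) ^ n"
        using y exp_ge_add_one_self[of "- (1 / (2 * y))"] by (intro power_mono) (auto simp: field_simps)
      also have "\<dots> = exp (- (1 / 2 * (real n / y)))" by (simp add: exp_of_nat_mult[symmetric])
      also have "real n / y = real n powr ((1 - \<zeta>) / 2)"
      proof -
        have *: "1 - (1 + \<zeta>) / 2 = (1 - \<zeta>) / 2" by (simp add: field_simps)
        show ?thesis using n powr_diff[of "real n" 1 "(1 + \<zeta>) / 2"] unfolding * by (simp add: y_def)
      qed
      finally show ?thesis using elim by linarith
    qed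
    have T4: "2 * (r ^ m / (1 - r)) \<le> 1 / 4 * real n powr (- \<gamma>)"
    proof -
      have "r ^ m = exp (real m * ln r)" using r by (simp add: exp_of_nat_mult)
      also have "\<dots> \<le> exp (- (- ln r * real n powr \<nu>))"
        using mult_right_mono_neg[of "real n powr \<nu>" "real m" "ln r"] m r by (simp add: mult.commute)
      finally have "2 / (1 - r) * r ^ m \<le> 2 / (1 - r) * exp (- (- ln r * real n powr \<nu>))"
        using r by (intro mult_left_mono) auto
      then show ?thesis using elim by simp
    qed
    show ?case
    proof (intro allI impI)
      fix e' assume e': "\<forall>x\<in>space M. \<forall>i. 0 \<le> e' i x \<and> e' i x \<le> e i x"
      have "(\<integral>\<^sup>+x. ennreal (measure (quenched_law (\<lambda>i. 1 / (1 + e' i x))) {X. X n < int m}) \<partial>M) \<le>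
        ennreal (prob {x \<in> space M. y < (\<Sum>k<3 * m. U (1 - int m) k x)} + 2 * (1 - 1 / (2 * y)) ^ n
        + 2 * (r ^ m / (1 - r)))"
        unfolding r_def using e' m y \<theta> by (intro annealed_upper) auto
      also have "\<dots> \<le> ennreal (real n powr (- \<gamma>))"
        using C(3)[of "3 * m" L y "1 - int m"] T1 T2 T3 T4 m L y by (intro ennreal_leI) simp
      finally show "(\<integral>\<^sup>+x. ennreal (measure (quenched_law (\<lambda>i. 1 / (1 + e' i x)))
         {X. X n < int (nat \<lceil>real n powr \<nu>\<rceil>)}) \<partial>M) \<le> ennreal (real n powr (- \<gamma>))" by (simp add: m_def)
    qed
  qed
qed

section \<open>Annealed lower bound\<close>

lemma odds_prod_env_meas [measurable]: "(\<lambda>u. odds_prod u a j) \<in> borel_measurable env_space"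
  unfolding odds_prod_def by measurable

text \<open>Consecutive blocks of \<open>l\<close> sites are disjoint, hence independent; the
  induction splits the environment at \<open>B * l\<close>, the right end of the first
  \<open>B\<close> blocks.\<close>

lemma blocks_all_small:
  assumes q: "0 \<le> q" "\<And>I. finite I \<Longrightarrow> card I = l \<Longrightarrow> q \<le> prob {x \<in> space M. c \<le> (\<Prod>i\<in>I. e i x)}"
  shows "prob {x \<in> space M. \<forall>b\<in>{..<B}. odds_prod (env x) (int (b * l)) (int (Suc b * l)) < c} \<le> (1 - q) ^ B"
proof (induction B)
  case (Suc B)
  define H where "H u = (of_bool (\<forall>b\<in>{..<B}. odds_prod u (int (b * l)) (int (Suc b * l)) < c) :: ennreal)" for u
  define K where "K u = (of_bool (odds_prod u (int (B * l)) (int (Suc B * l)) < c) :: ennreal)" for u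
  have [measurable]: "H \<in> borel_measurable env_space" "K \<in> borel_measurable env_space"
    unfolding H_def K_def by measurable
  have op_cong: "odds_prod u a j = odds_prod v a j" if "\<And>i. a < i \<Longrightarrow> i \<le> j \<Longrightarrow> u i = v i" for u v a j
    unfolding odds_prod_def using that by (intro prod.cong) auto
  have H_cong: "H u = H v" if uv: "\<And>i. i \<in> {..int (B * l)} \<Longrightarrow> u i = v i" for u v
  proof -
    have "odds_prod u (int (b * l)) (int (Suc b * l)) = odds_prod v (int (b * l)) (int (Suc b * l))" if "b < B" for b
    proof (rule op_cong)
      fix i assume "int (b * l) < i" "i \<le> int (Suc b * l)"
      moreover have "int (Suc b * l) \<le> int (B * l)" using that unfolding of_nat_le_iff by (intro mult_right_mono) auto
      ultimately have "i \<le> int (B * l)" by (blast intro: order_trans)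
      then show "u i = v i" by (intro uv) (simp only: atMost_iff)
    qed
    then show ?thesis by (simp add: H_def)
  qed
  have K_cong: "K u = K v" if uv: "\<And>i. i \<notin> {..int (B * l)} \<Longrightarrow> u i = v i" for u v
  proof -
    have "odds_prod u (int (B * l)) (int (Suc B * l)) = odds_prod v (int (B * l)) (int (Suc B * l))"
      by (intro op_cong uv) auto
    then show ?thesis by (simp add: K_def)
  qed
  have int_ind: "(\<integral>\<^sup>+x. of_bool (P x) \<partial>M) = ennreal (prob {x \<in> space M. P x})" if [measurable]: "Measurable.pred M P" for P
  proof -
    have "(\<integral>\<^sup>+x. of_bool (P x) \<partial>M) = (\<integral>\<^sup>+x. indicator {x \<in> space M. P x} x \<partial>M)"
      by (intro nn_integral_cong) (auto split: split_indicator)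
    then show ?thesis by (simp add: emeasure_eq_measure)
  qed
  have "ennreal (prob {x \<in> space M. \<forall>b\<in>{..<Suc B}. odds_prod (env x) (int (b * l)) (int (Suc b * l)) < c}) =
    (\<integral>\<^sup>+x. H (env x) * K (env x) \<partial>M)"
    by (subst int_ind[symmetric]) (auto simp: H_def K_def lessThan_Suc intro!: nn_integral_cong)
  also have "\<dots> = (\<integral>\<^sup>+x. H (env x) \<partial>M) * (\<integral>\<^sup>+x. K (env x) \<partial>M)"
  proof (rule nn_integral_indep_split[where J="{..int (B * l)}"])
    show "H u = H v" if "\<And>i. i \<in> {..int (B * l)} \<Longrightarrow> u i = v i" for u v using that by (rule H_cong)
    show "K u = K v" if "\<And>i. i \<notin> {..int (B * l)} \<Longrightarrow> u i = v i" for u v using that by (rule K_cong)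
  qed measurable
  also have "(\<integral>\<^sup>+x. H (env x) \<partial>M) =
      ennreal (prob {x \<in> space M. \<forall>b\<in>{..<B}. odds_prod (env x) (int (b * l)) (int (Suc b * l)) < c})"
    unfolding H_def by (rule int_ind) measurable
  also have "(\<integral>\<^sup>+x. K (env x) \<partial>M) = ennreal (prob {x \<in> space M. odds_prod (env x) (int (B * l)) (int (Suc B * l)) < c})"
    unfolding K_def by (rule int_ind) measurable
  also have "prob {x \<in> space M. odds_prod (env x) (int (B * l)) (int (Suc B * l)) < c} =
      1 - prob {x \<in> space M. c \<le> odds_prod (env x) (int (B * l)) (int (Suc B * l))}"
    by (subst prob_compl[symmetric]) (auto intro!: arg_cong[where f=prob])
  also have "ennreal (prob {x \<in> space M. \<forall>b\<in>{..<B}. odds_prod (env x) (int (b * l)) (int (Suc b * l)) < c}) * ennreal \<dots> \<le>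
      ennreal ((1 - q) ^ B) * ennreal (1 - q)"
  proof (intro mult_mono ennreal_leI Suc.IH)
    have "card {int (B * l)<..int (Suc B * l)} = l" by simp
    then have "q \<le> prob {x \<in> space M. c \<le> odds_prod (env x) (int (B * l)) (int (Suc B * l))}"
      unfolding odds_prod_def by (intro q) auto
    then show "1 - prob {x \<in> space M. c \<le> odds_prod (env x) (int (B * l)) (int (Suc B * l))} \<le> 1 - q" by simp
  qed auto
  also have "\<dots> = ennreal ((1 - q) ^ Suc B)"
  proof -
    have "q \<le> 1" using q(2)[of "{1..int l}"] prob_le_1 order_trans by (metis card_atLeastAtMost_int diff_add_cancel finite_atLeastAtMost_int nat_int)
    then show ?thesis by (simp add: ennreal_mult[symmetric] mult.commute)
  qed
  finally have *: "ennreal (prob {x \<in> space M. \<forall>b\<in>{..<Suc B}. odds_prod (env x) (int (b * l)) (int (Suc b * l)) < c})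
    \<le> ennreal ((1 - q) ^ Suc B)" .
  have "q \<le> 1" using q(2)[of "{1..int l}"] prob_le_1 order_trans by (metis card_atLeastAtMost_int diff_add_cancel finite_atLeastAtMost_int nat_int)
  then have "0 \<le> (1 - q) ^ Suc B" by (intro zero_le_power) simp
  then show ?case using * by (subst (asm) ennreal_le_iff) auto
qed (simp add: prob_space)

text \<open>A block with product at least \<open>2 * n\<close> confines the walk with quenched
  probability at least a half. All blocks consist of positive sites, where \<open>e'\<close> and
  \<open>e\<close> agree, so reflection is covered.\<close>

lemma annealed_lower:
  assumes q: "0 \<le> q" "\<And>I. finite I \<Longrightarrow> card I = l \<Longrightarrow> q \<le> prob {x \<in> space M. 2 * real n \<le> (\<Prod>i\<in>I. e i x)}"
    and n: "1 \<le> n" and l: "1 \<le> l"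
    and e': "\<And>i x. x \<in> space M \<Longrightarrow> 0 \<le> e' i x" "\<And>i x. x \<in> space M \<Longrightarrow> 1 \<le> i \<Longrightarrow> e' i x = e i x"
  shows "ennreal (1 / 2 * (1 - (1 - q) ^ B)) \<le>
    (\<integral>\<^sup>+x. ennreal (measure (quenched_law (\<lambda>i. 1 / (1 + e' i x))) {X. \<forall>k\<le>n. X k \<le> int (B * l)}) \<partial>M)"
proof -
  define E where "E = {x \<in> space M. \<not> (\<forall>b\<in>{..<B}. odds_prod (env x) (int (b * l)) (int (Suc b * l)) < 2 * real n)}"
  have E_meas [measurable]: "E \<in> sets M" unfolding E_def by measurable
  have "1 - (1 - q) ^ B \<le> prob E"
  proof -
    have "prob E = 1 - prob {x \<in> space M. \<forall>b\<in>{..<B}. odds_prod (env x) (int (b * l)) (int (Suc b * l)) < 2 * real n}"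
      unfolding E_def by (subst prob_compl[symmetric]) (auto intro!: arg_cong[where f=prob])
    then show ?thesis using blocks_all_small[of q l "2 * real n" B, OF q] by simp
  qed
  then have "ennreal (1 / 2 * (1 - (1 - q) ^ B)) \<le> ennreal (1 / 2) * emeasure M E"
    by (simp add: emeasure_eq_measure ennreal_mult'[symmetric] ennreal_leI del: ennreal_half)
  also have "\<dots> = (\<integral>\<^sup>+x. ennreal (1 / 2) * indicator E x \<partial>M)" by (simp add: nn_integral_cmult_indicator)
  also have "\<dots> \<le> (\<integral>\<^sup>+x. ennreal (measure (quenched_law (\<lambda>i. 1 / (1 + e' i x))) {X. \<forall>k\<le>n. X k \<le> int (B * l)}) \<partial>M)"
  proof (rule nn_integral_mono)
    fix x assume x: "x \<in> space M"
    interpret Q: prob_space "quenched_law (\<lambda>i. 1 / (1 + e' i x))" by (rule prob_space_quenched_law)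
    have "1 / 2 \<le> Q.prob {X. \<forall>k\<le>n. X k \<le> int (B * l)}" if xE: "x \<in> E"
    proof -
      obtain b where b: "b < B" "2 * real n \<le> odds_prod (env x) (int (b * l)) (int (Suc b * l))"
        using xE unfolding E_def mem_Collect_eq by (meson lessThan_iff linorder_not_less)
      have "odds_prod (env x) (int (b * l)) (int (Suc b * l)) = odds_prod (\<lambda>i. e' i x) (int (b * l)) (int (Suc b * l))"
        unfolding odds_prod_def
      proof (intro prod.cong refl e'(2)[symmetric] x)
        fix i assume "i \<in> {int (b * l)<..int (Suc b * l)}"
        moreover have "0 \<le> int (b * l)" by (rule of_nat_0_le_iff)
        ultimately show "1 \<le> i" unfolding greaterThanAtMost_iff by linarith
      qed
      then have R: "2 * real n \<le> odds_prod (\<lambda>i. e' i x) (int (b * l)) (int (Suc b * l))" using b by simp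
      have "1 / 2 \<le> 1 - real n / odds_prod (\<lambda>i. e' i x) (int (b * l)) (int (Suc b * l))"
        using R n by (simp add: field_simps)
      also have "\<dots> \<le> Q.prob {X. \<forall>k\<le>n. X k \<le> int (Suc b * l)}"
        using R n e'(1)[OF x] by (intro quenched_escape) auto
      also have "\<dots> \<le> Q.prob {X. \<forall>k\<le>n. X k \<le> int (B * l)}"
      proof (rule Q.finite_measure_mono)
        have "int (Suc b * l) \<le> int (B * l)" unfolding of_nat_le_iff using b by (intro mult_right_mono) auto
        then show "{X. \<forall>k\<le>n. X k \<le> int (Suc b * l)} \<subseteq> {X. \<forall>k\<le>n. X k \<le> int (B * l)}"
          by (blast intro: order_trans)
      qed simp
      finally show ?thesis .
    qed
    then show "ennreal (1 / 2) * indicator E x \<le> ennreal (Q.prob {X. \<forall>k\<le>n. X k \<le> int (B * l)})"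
      by (auto simp del: ennreal_half intro: ennreal_leI split: split_indicator)
  qed
  finally show ?thesis .
qed

text \<open>The window holds at least of order \<open>n powr \<nu> / ln n\<close> blocks, each deep
  with probability at least \<open>q = (2 * n) powr (- k)\<close>, where
  \<open>\<kappa> < k < \<gamma> + \<nu>\<close>. As \<open>B * q \<le> 1\<close>, some block is
  deep with probability at least half of \<open>B * q\<close>.\<close>

lemma annealed_lower_rate:
  assumes \<nu>: "0 < \<nu>" "\<nu> < min 1 \<kappa>" and \<gamma>: "\<kappa> - \<nu> < \<gamma>"
  shows "\<forall>\<^sub>F n in sequentially. \<forall>e'. (\<forall>x\<in>space M. \<forall>i. 0 \<le> e' i x \<and> (1 \<le> i \<longrightarrow> e' i x = e i x)) \<longrightarrow>
    ennreal (real n powr (- \<gamma>)) \<le>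
    (\<integral>\<^sup>+x. ennreal (measure (quenched_law (\<lambda>i. 1 / (1 + e' i x))) {X. \<forall>k\<le>n. X k < \<lfloor>real n powr \<nu>\<rfloor>}) \<partial>M)"
proof -
  \<comment> \<open>The loss \<open>(3 * \<kappa> + 3) * \<delta>\<close> in the Cramer-type bound
    uses at most half of the gap between \<open>\<gamma>\<close> and
    \<open>\<kappa> - \<nu>\<close>.\<close>
  define \<delta> where "\<delta> = min 1 ((\<gamma> - (\<kappa> - \<nu>)) / 2 / (3 * \<kappa> + 3))"
  have \<delta>: "0 < \<delta>" "\<delta> \<le> 1" using \<gamma> \<kappa>_pos by (auto simp: \<delta>_def)
  define k where "k = \<kappa> + (3 * \<kappa> + 3) * \<delta>"
  have k: "\<kappa> < k" "k - \<nu> < \<gamma>"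
  proof -
    show "\<kappa> < k" using \<delta> \<kappa>_pos by (simp add: k_def)
    have "\<delta> \<le> (\<gamma> - (\<kappa> - \<nu>)) / 2 / (3 * \<kappa> + 3)" unfolding \<delta>_def by (rule min.cobounded2)
    then have "\<delta> * (3 * \<kappa> + 3) \<le> (\<gamma> - (\<kappa> - \<nu>)) / 2"
      using \<kappa>_pos by (subst (asm) pos_le_divide_eq) auto
    then have "(3 * \<kappa> + 3) * \<delta> \<le> (\<gamma> - (\<kappa> - \<nu>)) / 2" by (simp only: mult.commute)
    also have "\<dots> < \<gamma> - (\<kappa> - \<nu>)" using \<gamma> by simp
    finally show "k - \<nu> < \<gamma>" by (simp add: k_def)
  qed
  obtain K where K: "0 < K" and ev: "\<forall>\<^sub>F t in at_top. \<exists>l\<ge>1. real l \<le> K * t \<and> (\<forall>I. finite I \<longrightarrow> card I = l \<longrightarrow>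
    exp (- k * t) \<le> prob {x \<in> space M. exp t \<le> (\<Prod>i\<in>I. e i x)})"
    using cramer_lower[OF \<delta>] unfolding k_def by blast
  \<comment> \<open>The level \<open>t = ln (2 * n)\<close> makes \<open>exp t\<close> the required
    trap depth \<open>2 * n\<close>.\<close>
  have "filterlim (\<lambda>n::nat. ln (2 * real n)) at_top sequentially" by real_asymp
  from eventually_compose_filterlim[OF ev this]
  have "\<forall>\<^sub>F n::nat in sequentially. \<exists>l\<ge>1. real l \<le> K * ln (2 * real n) \<and> (\<forall>I. finite I \<longrightarrow> card I = l \<longrightarrow>
    exp (- k * ln (2 * real n)) \<le> prob {x \<in> space M. exp (ln (2 * real n)) \<le> (\<Prod>i\<in>I. e i x)})" .
  moreover have "\<forall>\<^sub>F n::nat in sequentially. real n powr (- \<gamma>) \<le>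
      1 / 4 * ((2 * real n) powr (- k) * ((real n powr \<nu> - 2) / (K * ln (2 * real n)) - 1))"
    using \<nu> k K by real_asymp
  moreover have "\<forall>\<^sub>F n::nat in sequentially. 2 \<le> real n powr \<nu>" using \<nu> by real_asymp
  moreover have "\<forall>\<^sub>F n::nat in sequentially. 1 \<le> n" by (rule eventually_ge_at_top)
  ultimately show ?thesis
  proof eventually_elim
    case (elim n)
    then obtain l where l: "1 \<le> l" "real l \<le> K * ln (2 * real n)"
      "\<And>I. finite I \<Longrightarrow> card I = l \<Longrightarrow>
        exp (- k * ln (2 * real n)) \<le> prob {x \<in> space M. exp (ln (2 * real n)) \<le> (\<Prod>i\<in>I. e i x)}" by blast
    define q where "q = (2 * real n) powr (- k)"
    have n: "1 \<le> real n" using elim by simp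
    have q: "0 < q" "q \<le> prob {x \<in> space M. 2 * real n \<le> (\<Prod>i\<in>I. e i x)}" if "finite I" "card I = l" for I
      using l(3)[OF that] n by (auto simp: q_def powr_def)
    have q0: "0 < q" using n by (simp add: q_def)
    define m where "m = nat \<lfloor>real n powr \<nu>\<rfloor>"
    have m: "1 \<le> m" "real n powr \<nu> - 1 \<le> real m" "real m \<le> real n powr \<nu>" "int m = \<lfloor>real n powr \<nu>\<rfloor>"
      unfolding m_def using elim by linarith+
    \<comment> \<open>Filling only \<open>m - 1\<close> sites makes the last block end strictly
      below \<open>\<lfloor>real n powr \<nu>\<rfloor>\<close>.\<close>
    define B where "B = (m - 1) div l"
    have B1: "B * l \<le> m - 1" by (simp add: B_def)
    have B2: "(real n powr \<nu> - 2) / (K * ln (2 * real n)) - 1 \<le> real B"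
    proof -
      have "m - 1 < (B + 1) * l" using l dividend_less_times_div[of l "m - 1"] by (simp add: B_def algebra_simps)
      then have "real (m - 1) \<le> (real B + 1) * real l"
        using of_nat_mono[of "m - 1" "(B + 1) * l", where 'a=real] by (simp add: algebra_simps)
      then have "real (m - 1) / real l \<le> real B + 1" using l by (simp add: divide_le_eq)
      moreover have "(real n powr \<nu> - 2) / (K * ln (2 * real n)) \<le> real (m - 1) / real l"
        using m l elim by (intro frac_le) (auto simp: of_nat_diff)
      ultimately show ?thesis by linarith
    qed
    \<comment> \<open>This holds because \<open>\<nu> < k\<close>, and it makes the bound
      \<open>exp (- z) \<le> 1 - z / 2\<close> available for \<open>z = B * q\<close>.\<close>
    have Bq: "real B * q \<le> 1"
    proof -
      have "B \<le> m - 1" using B1 l by (metis div_le_dividend B_def)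
      then have "real B \<le> real n powr \<nu>" using m by linarith
      moreover have "q \<le> real n powr (- \<nu>)"
      proof -
        have "q \<le> (2 * real n) powr (- \<nu>)" unfolding q_def using n k \<nu> by (intro powr_mono) auto
        also have "\<dots> \<le> real n powr (- \<nu>)" using n \<nu> by (intro powr_mono2') auto
        finally show ?thesis .
      qed
      ultimately have "real B * q \<le> real n powr \<nu> * real n powr (- \<nu>)" using q0 by (intro mult_mono) auto
      also have "\<dots> = 1" using n by (simp add: powr_add[symmetric])
      finally show ?thesis .
    qed
    have q1: "q \<le> 1" using q(2)[of "{1..int l}"] prob_le_1 order_trans by (metis card_atLeastAtMost_int diff_add_cancel finite_atLeastAtMost_int nat_int)
    have main: "real n powr (- \<gamma>) \<le> 1 / 2 * (1 - (1 - q) ^ B)"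
    proof -
      have "(1 - q) ^ B \<le> exp (- q) ^ B"
        using exp_ge_add_one_self[of "- q"] q1 by (intro power_mono) auto
      also have "\<dots> = exp (- (real B * q))" by (simp add: exp_of_nat_mult[symmetric])
      also have "\<dots> \<le> 1 - real B * q / 2"
      proof -
        define z where "z = real B * q"
        have z: "0 \<le> z" "z \<le> 1" using Bq q0 by (auto simp: z_def)
        have "exp (- z) = 1 / exp z" by (simp add: exp_minus field_simps)
        also have "\<dots> \<le> 1 / (1 + z)" using z exp_ge_add_one_self[of z] by (intro divide_left_mono) auto
        also have "\<dots> \<le> 1 - z / 2"
        proof -
          have "z * z \<le> z * 1" using z by (intro mult_left_mono) auto
          then have "1 \<le> (1 - z / 2) * (1 + z)" by (simp add: algebra_simps)
          then show ?thesis using z by (simp add: divide_le_eq)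
        qed
        finally show ?thesis by (simp add: z_def)
      qed
      finally have "1 / 4 * (q * real B) \<le> 1 / 2 * (1 - (1 - q) ^ B)" by (simp add: algebra_simps)
      moreover have "q * ((real n powr \<nu> - 2) / (K * ln (2 * real n)) - 1) \<le> q * real B"
        using B2 q0 by (intro mult_left_mono) auto
      moreover have "real n powr (- \<gamma>) \<le> 1 / 4 * (q * ((real n powr \<nu> - 2) / (K * ln (2 * real n)) - 1))"
        unfolding q_def by (rule elim(2))
      ultimately show ?thesis by argo
    qed
    show ?case
    proof (intro allI impI)
      fix e' assume e': "\<forall>x\<in>space M. \<forall>i. 0 \<le> e' i x \<and> (1 \<le> i \<longrightarrow> e' i x = e i x)"
      have "ennreal (real n powr (- \<gamma>)) \<le> ennreal (1 / 2 * (1 - (1 - q) ^ B))" using main by (rule ennreal_leI)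
      also have "\<dots> \<le> (\<integral>\<^sup>+x. ennreal (measure (quenched_law (\<lambda>i. 1 / (1 + e' i x))) {X. \<forall>k\<le>n. X k \<le> int (B * l)}) \<partial>M)"
        using q q0 elim l e' by (intro annealed_lower) auto
      also have "\<dots> \<le> (\<integral>\<^sup>+x. ennreal (measure (quenched_law (\<lambda>i. 1 / (1 + e' i x))) {X. \<forall>k\<le>n. X k < \<lfloor>real n powr \<nu>\<rfloor>}) \<partial>M)"
      proof (intro nn_integral_mono ennreal_leI)
        fix x
        interpret Q: prob_space "quenched_law (\<lambda>i. 1 / (1 + e' i x))" by (rule prob_space_quenched_law)
        have "int (B * l) < \<lfloor>real n powr \<nu>\<rfloor>" using B1 m by linarith
        then show "Q.prob {X. \<forall>k\<le>n. X k \<le> int (B * l)} \<le> Q.prob {X. \<forall>k\<le>n. X k < \<lfloor>real n powr \<nu>\<rfloor>}"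
          by (intro Q.finite_measure_mono) (auto intro: le_less_trans)
      qed
      finally show "ennreal (real n powr (- \<gamma>)) \<le>
        (\<integral>\<^sup>+x. ennreal (measure (quenched_law (\<lambda>i. 1 / (1 + e' i x))) {X. \<forall>k\<le>n. X k < \<lfloor>real n powr \<nu>\<rfloor>}) \<partial>M)" .
    qed
  qed
qed

end

section \<open>From polynomial bounds to logarithmic limits\<close>

lemma log_rate_limit:
  fixes p :: "nat \<Rightarrow> real"
  assumes upper: "\<And>\<gamma>. \<gamma> < g \<Longrightarrow> \<forall>\<^sub>F n in sequentially. p n \<le> real n powr (- \<gamma>)"
    and lower: "\<And>\<gamma>. g < \<gamma> \<Longrightarrow> \<forall>\<^sub>F n in sequentially. real n powr (- \<gamma>) \<le> p n"
  shows "(\<lambda>n. ln (p n) / ln (real n)) \<longlonglongrightarrow> - g"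
proof (rule order_tendstoI)
  have pos: "\<forall>\<^sub>F n in sequentially. 0 < p n \<and> 0 < ln (real n)"
  proof -
    have "\<forall>\<^sub>F n in sequentially. real n powr (- (g + 1)) \<le> p n" by (rule lower) simp
    then show ?thesis using eventually_ge_at_top[of "2::nat"]
    proof eventually_elim
      case (elim n)
      then have "0 < real n powr (- (g + 1))" by simp
      also note elim(1)
      finally show ?case using elim by simp
    qed
  qed
  {
    fix a assume a: "a < - g"
    \<comment> \<open>The exponent midway between \<open>g\<close> and \<open>- a\<close> leaves
      room for a strict inequality of the quotients.\<close>
    then have "g < - ((a - g) / 2)" by (simp add: field_simps)
    from pos lower[OF this] show "\<forall>\<^sub>F n in sequentially. a < ln (p n) / ln (real n)"
    proof eventually_elim
      case (elim n)
      then have n: "0 < real n" by (cases n) auto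
      have "(a - g) / 2 * ln (real n) = ln (real n powr ((a - g) / 2))" using n by (simp add: ln_powr)
      also have "\<dots> \<le> ln (p n)" using elim n by (intro ln_mono) auto
      finally have "(a - g) / 2 \<le> ln (p n) / ln (real n)" using elim by (simp add: pos_le_divide_eq)
      moreover have "a < (a - g) / 2" using a by (simp add: field_simps)
      ultimately show ?case by (rule less_le_trans[rotated])
    qed
  next
    fix a assume a: "- g < a"
    then have "- ((a - g) / 2) < g" by (simp add: field_simps)
    from pos upper[OF this] show "\<forall>\<^sub>F n in sequentially. ln (p n) / ln (real n) < a"
    proof eventually_elim
      case (elim n)
      then have n: "0 < real n" by (cases n) auto
      have "ln (p n) \<le> ln (real n powr ((a - g) / 2))" using elim n by (intro ln_mono) auto
      also have "\<dots> = (a - g) / 2 * ln (real n)" using n by (simp add: ln_powr)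
      finally have "ln (p n) / ln (real n) \<le> (a - g) / 2" using elim by (simp add: pos_divide_le_eq)
      moreover have "(a - g) / 2 < a" using a by (simp add: field_simps)
      ultimately show ?case by (rule le_less_trans)
    qed
  }
qed

text \<open>The confinement event \<open>c n\<close> carries the lower bound and lies in both events
  of interest. The upper bound for the position event \<open>a n\<close> passes to the hitting event
  \<open>b n\<close>, because an unvisited level keeps the path below it almost surely.\<close>

lemma (in iid_odds) slowdown_limits:
  fixes P :: "(nat \<Rightarrow> int) measure"
  assumes P: "\<And>A. A \<in> sets path_space \<Longrightarrow> emeasure P A =
      (\<integral>\<^sup>+x. emeasure (quenched_law (\<lambda>i. 1 / (1 + e' i x))) A \<partial>M)"
    and e': "\<And>i x. x \<in> space M \<Longrightarrow> 0 \<le> e' i x \<and> e' i x \<le> e i x \<and> (1 \<le> i \<longrightarrow> e' i x = e i x)"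
    and \<nu>: "0 < \<nu>" "\<nu> < min 1 \<kappa>"
  shows "(\<lambda>n::nat. ln (measure P {X. real_of_int (X n) < real n powr \<nu>}) / ln (real n)) \<longlonglongrightarrow> - (\<kappa> - \<nu>)"
    and "(\<lambda>n::nat. ln (measure P {X. hitting_time \<lfloor>real n powr \<nu>\<rfloor> X > enat n}) / ln (real n)) \<longlonglongrightarrow> - (\<kappa> - \<nu>)"
proof -
  let ?Q = "\<lambda>x. quenched_law (\<lambda>i. 1 / (1 + e' i x))"
  define a where "a n = {X::nat \<Rightarrow> int. X n < int (nat \<lceil>real n powr \<nu>\<rceil>)}" for n
  define b where "b n = {X::nat \<Rightarrow> int. \<forall>k\<le>n. X k \<noteq> \<lfloor>real n powr \<nu>\<rfloor>}" for n
  define c where "c n = {X::nat \<Rightarrow> int. \<forall>k\<le>n. X k < \<lfloor>real n powr \<nu>\<rfloor>}" for n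
  have [measurable]: "a n \<in> sets path_space" "b n \<in> sets path_space" "c n \<in> sets path_space" for n
    unfolding a_def b_def c_def by (rule measurable_position_event measurable_past_event)+
  have P': "emeasure P A = (\<integral>\<^sup>+x. ennreal (measure (?Q x) A) \<partial>M)" if "A \<in> sets path_space" for A
    unfolding P[OF that]
    by (intro nn_integral_cong finite_measure.emeasure_eq_measure prob_space.finite_measure prob_space_quenched_law)
  have fin: "emeasure P A = ennreal (measure P A)" if "A \<in> sets path_space" for A
  proof -
    have "emeasure P A \<le> (\<integral>\<^sup>+x. 1 \<partial>M)"
      unfolding P'[OF that] using prob_space.prob_le_1[OF prob_space_quenched_law]
      by (intro nn_integral_mono) auto
    then have "emeasure P A \<noteq> \<infinity>" by (auto simp: emeasure_space_1 top_unique)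
    then show ?thesis by (simp add: emeasure_eq_ennreal_measure)
  qed
  have mono: "measure P A \<le> measure P B"
    if "A \<in> sets path_space" "B \<in> sets path_space" "\<And>x. x \<in> space M \<Longrightarrow> measure (?Q x) A \<le> measure (?Q x) B" for A B
  proof -
    have "emeasure P A \<le> emeasure P B"
      unfolding P'[OF that(1)] P'[OF that(2)] by (intro nn_integral_mono ennreal_leI that)
    then show ?thesis unfolding fin[OF that(1)] fin[OF that(2)] by (simp add: ennreal_le_iff)
  qed
  have upper: "\<forall>\<^sub>F n in sequentially. measure P (a n) \<le> real n powr (- \<gamma>)" if "\<gamma> < \<kappa> - \<nu>" for \<gamma>
    using annealed_upper_rate[OF \<nu> that]
  proof eventually_elim
    case (elim n)
    have "ennreal (measure P (a n)) = (\<integral>\<^sup>+x. ennreal (measure (?Q x) (a n)) \<partial>M)"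
      by (simp add: fin[symmetric] P')
    also have "\<dots> \<le> ennreal (real n powr (- \<gamma>))"
      unfolding a_def using elim e' by blast
    finally show ?case by (simp add: ennreal_le_iff)
  qed
  have lower: "\<forall>\<^sub>F n in sequentially. real n powr (- \<gamma>) \<le> measure P (c n)" if "\<kappa> - \<nu> < \<gamma>" for \<gamma>
    using annealed_lower_rate[OF \<nu> that]
  proof eventually_elim
    case (elim n)
    have "ennreal (real n powr (- \<gamma>)) \<le> (\<integral>\<^sup>+x. ennreal (measure (?Q x) (c n)) \<partial>M)"
      unfolding c_def using elim e' by blast
    also have "\<dots> = ennreal (measure P (c n))" by (simp add: fin[symmetric] P')
    finally show ?case by (simp add: ennreal_le_iff)
  qed
  have ca: "measure P (c n) \<le> measure P (a n)" for n
  proof (rule mono)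
    fix x
    interpret Q: prob_space "?Q x" by (rule prob_space_quenched_law)
    have "\<lfloor>real n powr \<nu>\<rfloor> \<le> int (nat \<lceil>real n powr \<nu>\<rceil>)" by linarith
    then show "Q.prob (c n) \<le> Q.prob (a n)"
      by (intro Q.finite_measure_mono) (auto simp: a_def c_def intro: less_le_trans)
  qed auto
  have cb: "measure P (c n) \<le> measure P (b n)" for n
  proof (rule mono)
    fix x
    interpret Q: prob_space "?Q x" by (rule prob_space_quenched_law)
    show "Q.prob (c n) \<le> Q.prob (b n)"
      by (intro Q.finite_measure_mono) (auto simp: b_def c_def)
  qed auto
  have ba: "measure P (b n) \<le> measure P (a n)" if n: "1 \<le> n" for n
  proof (rule mono)
    fix x assume x: "x \<in> space M"
    interpret Q: prob_space "?Q x" by (rule prob_space_quenched_law)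
    have "1 \<le> real n powr \<nu>" using n \<nu> by (intro ge_one_powr_ge_zero) auto
    then have "1 \<le> \<lfloor>real n powr \<nu>\<rfloor>" by simp
    then have "Q.prob (b n) \<le> Q.prob {X. X n < \<lfloor>real n powr \<nu>\<rfloor>}"
      unfolding b_def using step_prob_bounds[of "\<lambda>i. e' i x" "\<lambda>i. 1 / (1 + e' i x)"] e'[OF x]
      by (intro quenched_unvisited_le) auto
    also have "\<dots> \<le> Q.prob (a n)"
    proof (rule Q.finite_measure_mono)
      have "\<lfloor>real n powr \<nu>\<rfloor> \<le> int (nat \<lceil>real n powr \<nu>\<rceil>)" by linarith
      then show "{X. X n < \<lfloor>real n powr \<nu>\<rfloor>} \<subseteq> a n" by (auto simp: a_def intro: less_le_trans)
    qed simp
    finally show "Q.prob (b n) \<le> Q.prob (a n)" .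
  qed auto
  have "(\<lambda>n. ln (measure P (a n)) / ln (real n)) \<longlonglongrightarrow> - (\<kappa> - \<nu>)"
  proof (rule log_rate_limit[OF upper])
    fix \<gamma> assume "\<kappa> - \<nu> < \<gamma>"
    from lower[OF this] show "\<forall>\<^sub>F n in sequentially. real n powr (- \<gamma>) \<le> measure P (a n)"
      by eventually_elim (use ca order_trans in blast)
  qed
  \<comment> \<open>An integer is below a real number exactly if it is below its ceiling.\<close>
  moreover have "a n = {X. real_of_int (X n) < real n powr \<nu>}" for n
  proof -
    have "0 \<le> \<lceil>real n powr \<nu>\<rceil>" using powr_ge_zero[of "real n" \<nu>] by linarith
    then show ?thesis by (simp add: a_def less_ceiling_iff)
  qed
  ultimately show "(\<lambda>n::nat. ln (measure P {X. real_of_int (X n) < real n powr \<nu>}) / ln (real n)) \<longlonglongrightarrow> - (\<kappa> - \<nu>)"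
    by simp
  have "(\<lambda>n. ln (measure P (b n)) / ln (real n)) \<longlonglongrightarrow> - (\<kappa> - \<nu>)"
  proof (rule log_rate_limit)
    fix \<gamma> assume "\<gamma> < \<kappa> - \<nu>"
    from upper[OF this] eventually_ge_at_top[of 1]
    show "\<forall>\<^sub>F n in sequentially. measure P (b n) \<le> real n powr (- \<gamma>)"
      by eventually_elim (use ba order_trans in blast)
  next
    fix \<gamma> assume "\<kappa> - \<nu> < \<gamma>"
    from lower[OF this] show "\<forall>\<^sub>F n in sequentially. real n powr (- \<gamma>) \<le> measure P (b n)"
      by eventually_elim (use cb order_trans in blast)
  qed
  then show "(\<lambda>n::nat. ln (measure P {X. hitting_time \<lfloor>real n powr \<nu>\<rfloor> X > enat n}) / ln (real n)) \<longlonglongrightarrow> - (\<kappa> - \<nu>)"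
    by (simp add: hitting_time_gt_iff b_def)
qed

section \<open>From the environment to its odds ratios\<close>

lemma odds_ratio_inverse: "0 < p \<Longrightarrow> 1 / (1 + odds_ratio p) = p"
  by (simp add: odds_ratio_def field_simps)

lemma iid_odds_environment:
  assumes env: "iid_environment M \<omega>"
    and "integrable M (\<lambda>s. ln (odds_ratio (\<omega> 0 s)))" "(\<integral>s. ln (odds_ratio (\<omega> 0 s)) \<partial>M) < 0"
    and "critical_exponent M (\<lambda>s. odds_ratio (\<omega> 0 s)) \<kappa>"
  shows "iid_odds M (\<lambda>i s. odds_ratio (\<omega> i s)) \<kappa>"
proof -
  interpret prob_space M using env unfolding iid_environment_def by blast
  have indep: "indep_vars (\<lambda>_. borel) \<omega> UNIV"
    and \<omega>_distr: "distr M borel (\<omega> i) = distr M borel (\<omega> 0)"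
    and \<omega>_range: "s \<in> space M \<Longrightarrow> 0 < \<omega> i s \<and> \<omega> i s < 1" for i s
    using env unfolding iid_environment_def by blast+
  have odds_meas [measurable]: "odds_ratio \<in> borel_measurable borel"
    unfolding odds_ratio_def[abs_def] by measurable
  have [measurable]: "\<omega> i \<in> borel_measurable M" for i using env by (rule iid_environment_measurable)
  show ?thesis
  proof
    show "indep_vars (\<lambda>_. borel) (\<lambda>i s. odds_ratio (\<omega> i s)) UNIV"
      by (rule indep_vars_compose2[OF indep]) (rule odds_meas)
    fix i
    have "distr M borel (\<lambda>s. odds_ratio (\<omega> j s)) = distr (distr M borel (\<omega> j)) borel odds_ratio" for j
      by (subst distr_distr) (auto simp: comp_def)
    then show "distr M borel (\<lambda>s. odds_ratio (\<omega> i s)) = distr M borel (\<lambda>s. odds_ratio (\<omega> 0 s))"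
      by (simp only: \<omega>_distr[of i])
    show "0 < odds_ratio (\<omega> i s)" if "s \<in> space M" for s
      using \<omega>_range[OF that] by (simp add: odds_ratio_def)
  qed (use assms in \<open>auto simp: critical_exponent_def\<close>)
qed

theorem theorem1p3:
  fixes M :: "'s measure" and \<omega> :: "int \<Rightarrow> 's \<Rightarrow> real" and \<rho>\<^sub>0 :: "'s \<Rightarrow> real"
    and \<kappa> \<nu> :: real
  assumes env: "iid_environment M \<omega>"
    and \<rho>\<^sub>0: "\<rho>\<^sub>0 = (\<lambda>s. odds_ratio (\<omega> 0 s))"
    and transient: "integrable M (\<lambda>s. ln (\<rho>\<^sub>0 s))" "(\<integral>s. ln (\<rho>\<^sub>0 s) \<partial>M) < 0"
    and \<kappa>: "critical_exponent M \<rho>\<^sub>0 \<kappa>"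
    and \<kappa>_unique: "\<And>k. critical_exponent M \<rho>\<^sub>0 k \<Longrightarrow> k = \<kappa>"
    and \<epsilon>\<^sub>0: "\<exists>\<epsilon>\<^sub>0>0. integrable M (\<lambda>s. \<rho>\<^sub>0 s powr (- \<epsilon>\<^sub>0))"
    and \<nu>: "0 < \<nu>" "\<nu> < min 1 \<kappa>"
  shows "\<forall>P \<in> {annealed_law M \<omega>, reflected_annealed_law M \<omega>}.
    ((\<lambda>n::nat. ln (measure P {X. real_of_int (X n) < real n powr \<nu>}) / ln (real n))
       \<longlonglongrightarrow> - (\<kappa> - \<nu>)) \<and>
    ((\<lambda>n::nat. ln (measure P {X. hitting_time \<lfloor>real n powr \<nu>\<rfloor> X > enat n}) / ln (real n))
       \<longlonglongrightarrow> - (\<kappa> - \<nu>))"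
proof -
  let ?e = "\<lambda>i s. odds_ratio (\<omega> i s)"
  interpret iid_odds M ?e \<kappa>
    using env transient \<kappa> unfolding \<rho>\<^sub>0 by (rule iid_odds_environment)
  have \<omega>_pos: "0 < \<omega> i s" if "s \<in> space M" for i s
    using env that unfolding iid_environment_def by blast
  have annealed: "emeasure (annealed_law M \<omega>) A = (\<integral>\<^sup>+s. emeasure (quenched_law (\<lambda>i. 1 / (1 + ?e i s))) A \<partial>M)"
    if "A \<in> sets path_space" for A
    unfolding emeasure_annealed_law[OF env that]
    by (intro nn_integral_cong) (simp add: odds_ratio_inverse \<omega>_pos)
  \<comment> \<open>reflection at the origin means odds ratio \<open>0\<close> there\<close>
  define e' where "e' i s = (if i = 0 then 0 else ?e i s)" for i s
  have reflected: "emeasure (reflected_annealed_law M \<omega>) A =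
      (\<integral>\<^sup>+s. emeasure (quenched_law (\<lambda>i. 1 / (1 + e' i s))) A \<partial>M)" if "A \<in> sets path_space" for A
    unfolding emeasure_reflected_annealed_law[OF env that]
    by (intro nn_integral_cong arg_cong2[where f=emeasure] arg_cong[where f=quenched_law])
      (auto simp: e'_def odds_ratio_inverse \<omega>_pos)
  \<comment> \<open>Both families are dominated by \<open>?e\<close> and agree with it right of the
    origin, so the same limits serve both laws.\<close>
  have bounds: "0 \<le> ?e i s \<and> ?e i s \<le> ?e i s \<and> (1 \<le> i \<longrightarrow> ?e i s = ?e i s)"
    "0 \<le> e' i s \<and> e' i s \<le> ?e i s \<and> (1 \<le> i \<longrightarrow> e' i s = ?e i s)" if "s \<in> space M" for i s
    using e_nonneg[OF that] by (auto simp: e'_def)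
  show ?thesis (is "\<forall>P \<in> _. ?slow P")
  proof -
    have "?slow (annealed_law M \<omega>)"
      by (intro conjI; rule slowdown_limits[where e'="?e"])
        (use annealed bounds(1) \<nu> in blast)+
    moreover have "?slow (reflected_annealed_law M \<omega>)"
      by (intro conjI; rule slowdown_limits[where e'=e'])
        (use reflected bounds(2) \<nu> in blast)+
    ultimately show ?thesis by blast
  qed
qed

end
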